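(* Let $\Gamma$ be a finitely generated amenable group with Cayley graph $G=(V,E)$ (with respect to a finite symmetric generating set $S$, $\iota\notin S$, $k=|S|$). Consider either independent site percolation or independent bond percolation on $G$ with parameter $p<p_c$, where $p_c$ is the corresponding critical parameter. Then there exist positive constants $\alpha_N^+(p),\alpha_N^-(p)$ such that for all $E>0$ small enough $$e^{-\alpha_N^-(p)E^{-1/2}}\le N^N(E)-N^N(0)\le e^{-\alpha_N^+(p)E^{-1/2}}.$$
   Context: Site percolation: each vertex is open independently with probability $p$; $G(\omega)$ is the subgraph induced on the open vertices. Bond percolation: each edge is open independently with probability $p$; $G(\omega)$ has as edges the open edges and as vertices all vertices incident to an open edge. $p_c$ is the critical parameter: for $p<p_c$ almost surely $G(\omega)$ has no infinite connected component, for $p>p_c$ almost surely it has one. For a subgraph $G'=(V',E')$ with degrees $d_{G'}(x)$, the Neumann Laplacian on $\ell^2(V')$ is $\Delta^N(G')=D(G')-A(G')$ with $(D(G')\varphi)(x)=d_{G'}(x)\varphi(x)$ and $(A(G')\varphi)(x)=\sum_{y\in V',\,y\sim_{G'}x}\varphi(y)$. Set $\Delta^N_\omega=\Delta^N(G(\omega))$ on $\ell^2(V(\omega))$ and $N^N(E)=\mathbb{E}\{\langle\chi_{(-\infty,E]}(\Delta^N_\omega)\delta_\iota,\delta_\iota\rangle\}$, with the inner product taken to be $0$ when $\iota\notin V(\omega)$ ($\iota$ the identity of $\Gamma$).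
   Formalization: The group Γ is taken to be infinite and p > 0: for finite Γ, or for p = 0, N^N(E) − N^N(0) = 0 for all small E > 0, so the stated lower bound fails. *)

theory Defs
  imports "HOL-Probability.Probability"
begin

text \<open>The group \<Gamma> is a type of class group_add (not necessarily commutative),
  written additively: identity 0, product x + y, inverse - x.\<close>

definition finite_symm_gen_set :: "'g::group_add set \<Rightarrow> bool" where
  "finite_symm_gen_set S \<longleftrightarrow> finite S \<and> 0 \<notin> S \<and> (\<forall>s\<in>S. - s \<in> S) \<and>
     (\<forall>g::'g. \<exists>xs. set xs \<subseteq> S \<and> g = sum_list xs)"

text \<open>Amenability via the (left) Folner condition.\<close>
definition amenable_group :: "'g::group_add itself \<Rightarrow> bool" where
  "amenable_group _ \<longleftrightarrow> (\<forall>K::'g set. \<forall>\<epsilon>::real. finite K \<and> \<epsilon> > 0 \<longrightarrow>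
     (\<exists>F. finite F \<and> F \<noteq> {} \<and>
        (\<forall>g\<in>K. real (card (((\<lambda>x. g + x) ` F - F) \<union> (F - (\<lambda>x. g + x) ` F))) < \<epsilon> * real (card F))))"

definition cayley_adj :: "'g::group_add set \<Rightarrow> 'g \<Rightarrow> 'g \<Rightarrow> bool" where
  "cayley_adj S x y \<longleftrightarrow> (- x + y) \<in> S"

definition cayley_edges :: "'g::group_add set \<Rightarrow> 'g set set" where
  "cayley_edges S = {{x, y} | x y. cayley_adj S x y}"

definition site_adj :: "'g::group_add set \<Rightarrow> ('g \<Rightarrow> bool) \<Rightarrow> 'g \<Rightarrow> 'g \<Rightarrow> bool" where
  "site_adj S \<omega> x y \<longleftrightarrow> cayley_adj S x y \<and> \<omega> x \<and> \<omega> y"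

definition site_verts :: "('g \<Rightarrow> bool) \<Rightarrow> 'g set" where
  "site_verts \<omega> = {x. \<omega> x}"

definition bond_adj :: "'g::group_add set \<Rightarrow> ('g set \<Rightarrow> bool) \<Rightarrow> 'g \<Rightarrow> 'g \<Rightarrow> bool" where
  "bond_adj S \<omega> x y \<longleftrightarrow> cayley_adj S x y \<and> \<omega> {x, y}"

definition bond_verts :: "'g::group_add set \<Rightarrow> ('g set \<Rightarrow> bool) \<Rightarrow> 'g set" where
  "bond_verts S \<omega> = {x. \<exists>y. bond_adj S \<omega> x y}"

definition site_measure :: "'g::group_add set \<Rightarrow> real \<Rightarrow> ('g \<Rightarrow> bool) measure" where
  "site_measure S p = PiM UNIV (\<lambda>_. measure_pmf (bernoulli_pmf p))"

definition bond_measure :: "'g::group_add set \<Rightarrow> real \<Rightarrow> ('g set \<Rightarrow> bool) measure" where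
  "bond_measure S p = PiM (cayley_edges S) (\<lambda>_. measure_pmf (bernoulli_pmf p))"

definition has_infinite_component :: "'v set \<Rightarrow> ('v \<Rightarrow> 'v \<Rightarrow> bool) \<Rightarrow> bool" where
  "has_infinite_component V adj \<longleftrightarrow> (\<exists>x\<in>V. infinite {y. adj\<^sup>*\<^sup>* x y})"

definition pc_site :: "'g::group_add set \<Rightarrow> real" where
  "pc_site S = Sup {p \<in> {0..1}. AE \<omega> in site_measure S p.
      \<not> has_infinite_component (site_verts \<omega>) (site_adj S \<omega>)}"

definition pc_bond :: "'g::group_add set \<Rightarrow> real" where
  "pc_bond S = Sup {p \<in> {0..1}. AE \<omega> in bond_measure S p.
      \<not> has_infinite_component (bond_verts S \<omega>) (bond_adj S \<omega>)}"

definition neumann_lap :: "'v set \<Rightarrow> ('v \<Rightarrow> 'v \<Rightarrow> bool) \<Rightarrow> ('v \<Rightarrow> real) \<Rightarrow> 'v \<Rightarrow> real" where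
  "neumann_lap V adj f x = (if x \<in> V then
      real (card {y. adj x y}) * f x - (\<Sum>y\<in>{y. adj x y}. f y) else 0)"

text \<open>Spectral measure of \<delta>_{x0} for the bounded self-adjoint operator \<Delta>:
  the (unique) compactly supported finite Borel measure on the reals whose moments
  are \<langle>\<Delta>^n \<delta>_{x0}, \<delta>_{x0}\<rangle>.\<close>
definition is_spectral_measure_at ::
    "'v set \<Rightarrow> ('v \<Rightarrow> 'v \<Rightarrow> bool) \<Rightarrow> 'v \<Rightarrow> real measure \<Rightarrow> bool" where
  "is_spectral_measure_at V adj x0 \<mu> \<longleftrightarrow>
     sets \<mu> = sets borel \<and> finite_measure \<mu> \<and>
     (\<exists>R::real. emeasure \<mu> (- {-R..R}) = 0) \<and>
     (\<forall>n::nat. integrable \<mu> (\<lambda>t. t ^ n) \<and>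
        (\<integral>t. t ^ n \<partial>\<mu>) = ((neumann_lap V adj ^^ n) (\<lambda>y. if y = x0 then 1 else 0)) x0)"

text \<open>\<langle>\<chi>_{(-\<infinity>,E]}(\<Delta>) \<delta>_{x0}, \<delta>_{x0}\<rangle>, taken as 0 if x0 is not a vertex.\<close>
definition spec_proj_diag :: "'v set \<Rightarrow> ('v \<Rightarrow> 'v \<Rightarrow> bool) \<Rightarrow> 'v \<Rightarrow> real \<Rightarrow> real" where
  "spec_proj_diag V adj x0 E = (if x0 \<notin> V then 0 else
      (THE r. \<exists>\<mu>. is_spectral_measure_at V adj x0 \<mu> \<and> r = measure \<mu> {..E}))"

definition ids_site :: "'g::group_add set \<Rightarrow> real \<Rightarrow> real \<Rightarrow> real" where
  "ids_site S p E = (\<integral>\<omega>. spec_proj_diag (site_verts \<omega>) (site_adj S \<omega>) 0 E \<partial>site_measure S p)"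

definition ids_bond :: "'g::group_add set \<Rightarrow> real \<Rightarrow> real \<Rightarrow> real" where
  "ids_bond S p E = (\<integral>\<omega>. spec_proj_diag (bond_verts S \<omega>) (bond_adj S \<omega>) 0 E \<partial>bond_measure S p)"

definition lifshitz_tail :: "(real \<Rightarrow> real) \<Rightarrow> bool" where
  "lifshitz_tail N \<longleftrightarrow> (\<exists>am ap. am > 0 \<and> ap > 0 \<and> (\<exists>E0>0. \<forall>E. 0 < E \<and> E < E0 \<longrightarrow>
      exp (- am * E powr (-1/2)) \<le> N E - N 0 \<and> N E - N 0 \<le> exp (- ap * E powr (-1/2))))"

end

theory Submission
  imports Defs "HOL-Library.Transitive_Closure_Table"
begin

text \<open>The two bounds come from the two extreme shapes of a finite cluster. A connected graph on
  \<open>m\<close> vertices has no eigenvalue in \<open>(0, 1/(2m\<^sup>2))\<close>, so \<open>N(E) - N(0)\<close> is at most the probability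
  that the cluster of \<open>\<iota>\<close> has at least about \<open>1/sqrt E\<close> vertices, and the cluster size has an
  exponential tail below the critical point. Conversely, with probability at least \<open>b\<^sup>n\<close>, for a
  constant \<open>b > 0\<close>, the cluster of \<open>\<iota>\<close> is a geodesic path on \<open>n\<close> vertices starting at \<open>\<iota>\<close>, whose
  first non-constant cosine eigenvector gives an atom of the spectral measure at \<open>\<iota>\<close> with
  position in \<open>(0, (\<pi>/n)\<^sup>2]\<close> and mass at least \<open>1/(2n)\<close>.

  Exponential decay of the cluster size below the critical point is derived from the
  Duminil-Copin--Tassion argument: if \<open>\<phi>\<^sub>p(A) \<ge> 1\<close> for every finite \<open>A\<close>, then Russo's formula makes
  the probability of reaching the boundary of a box uniformly positive at every larger parameter.
  Otherwise \<open>\<phi>\<^sub>p(A) < 1\<close> for some \<open>A\<close>, and exploring the cluster in successive copies of \<open>A\<close> is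
  dominated by a subcritical branching process. Bond percolation is treated as site percolation on
  the line graph, which is quasi-transitive but in general not transitive.

  Spectral measures are handled through moments. They exist for every configuration, including those
  with infinite clusters, by the Hausdorff moment theorem; as the product \<open>\<sigma>\<close>-algebra is not
  complete, the exceptional null set cannot be ignored in proving measurability.\<close>

section \<open>The Hausdorff moment problem and polynomial approximation of spectral projections\<close>

text \<open>No Hilbert space operator is constructed. The Laplacian T acts on finitely supported
  functions, and all that is needed about its spectral measure at a vertex concerns the functional
  sending a polynomial q to the value of q(T) delta at that vertex; this is \<open>mlin\<close> of
  the moment sequence. Positivity on q^2, X q^2 and (c - X) q^2 yields existence of the measure;
  positivity on (n X^2 - X) q^2 for a finite component yields the gap; Cauchy-Schwarz against an
  eigenvector yields the atom. Polynomials bounded on a fixed interval and converging pointwise to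
  an indicator transfer each statement to the measure. Such approximants can be chosen from the
  degree bound alone, so one sequence serves all configurations, and the spectral quantities are
  limits of expressions in finitely many matrix entries. On the probabilistic side every event is
  first confined to a finite set, where an expectation is a polynomial in p. The critical parameter
  enters only through some q > p at which clusters are almost surely finite.\<close>

definition mlin :: "(nat \<Rightarrow> real) \<Rightarrow> real poly \<Rightarrow> real" where
  "mlin m q = (\<Sum>i\<le>degree q. coeff q i * m i)"

lemma mlin_bound: "degree q \<le> N \<Longrightarrow> mlin m q = (\<Sum>i\<le>N. coeff q i * m i)"
  unfolding mlin_def by (rule sum.mono_neutral_left) (auto simp: coeff_eq_0)

lemma mlin_0 [simp]: "mlin m 0 = 0"
  by (simp add: mlin_def)

lemma mlin_add: "mlin m (p + q) = mlin m p + mlin m q"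
proof -
  let ?N = "max (degree p) (degree q)"
  show ?thesis
    using mlin_bound[of "p + q" ?N m] mlin_bound[of p ?N m] mlin_bound[of q ?N m]
    by (simp add: degree_add_le sum.distrib distrib_right)
qed

lemma mlin_smult: "mlin m (smult a q) = a * mlin m q"
  using mlin_bound[of "smult a q" "degree q" m]
  by (simp add: mlin_def sum_distrib_left mult.assoc)

lemma mlin_sum: "mlin m (\<Sum>i\<in>A. f i) = (\<Sum>i\<in>A. mlin m (f i))"
  by (induction A rule: infinite_finite_induct) (auto simp: mlin_add)

lemma mlin_monom: "mlin m (monom a n) = a * m n"
proof -
  have "mlin m (monom a n) = (\<Sum>i\<le>n. coeff (monom a n) i * m i)"
    by (rule mlin_bound) (rule degree_monom_le)
  also have "\<dots> = (\<Sum>i\<in>{n}. coeff (monom a n) i * m i)"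
    by (rule sum.mono_neutral_right) auto
  finally show ?thesis by simp
qed

lemma mlin_pCons: "mlin m (pCons a q) = a * m 0 + mlin (\<lambda>i. m (Suc i)) q"
proof -
  have "mlin m (pCons a q) = (\<Sum>i\<le>Suc (degree q). coeff (pCons a q) i * m i)"
    by (rule mlin_bound) (simp add: degree_pCons_le)
  also have "\<dots> = a * m 0 + (\<Sum>i\<le>degree q. coeff q i * m (Suc i))"
    by (subst sum.atMost_Suc_shift) simp
  finally show ?thesis by (simp add: mlin_def)
qed

lemma mlin_integral:
  assumes "\<And>n. integrable \<mu> (\<lambda>t. t ^ n)" "\<And>n. (\<integral>t. t ^ n \<partial>\<mu>) = m n"
  shows "integrable \<mu> (poly q)" "(\<integral>t. poly q t \<partial>\<mu>) = mlin m q"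
proof -
  have eq: "poly q = (\<lambda>t. \<Sum>i\<le>degree q. coeff q i * t ^ i)"
    by (auto simp: poly_altdef)
  show "integrable \<mu> (poly q)"
    unfolding eq using assms(1) by (intro Bochner_Integration.integrable_sum) auto
  show "(\<integral>t. poly q t \<partial>\<mu>) = mlin m q"
    unfolding eq mlin_def using assms by (subst Bochner_Integration.integral_sum) auto
qed

text \<open>These are the factorial moments of the binomial distribution in homogeneous form:
  \<open>(n choose k) * (k choose j)\<close> regroups as
  \<open>(n choose j) * ((n - j) choose (k - j))\<close>, and the binomial theorem sums the rest.
  Over a semiring it applies to the polynomials X and c - X, whose sum is constant.\<close>

lemma bernstein_factorial_moment:
  fixes X Y :: "'a::comm_semiring_1"
  assumes "j \<le> n"
  shows "(\<Sum>k\<le>n. of_nat ((n choose k) * (k choose j)) * (X ^ k * Y ^ (n - k)))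
       = of_nat (n choose j) * (X ^ j * (X + Y) ^ (n - j))"
proof -
  have "(\<Sum>k\<le>n. of_nat ((n choose k) * (k choose j)) * (X ^ k * Y ^ (n - k)))
      = (\<Sum>k\<in>{j..n}. of_nat ((n choose k) * (k choose j)) * (X ^ k * Y ^ (n - k)))"
    by (rule sum.mono_neutral_right) (auto simp: not_le binomial_eq_0)
  also have "\<dots> = (\<Sum>k\<in>{j..n}. of_nat ((n choose j) * ((n - j) choose (k - j)))
      * (X ^ k * Y ^ (n - k)))"
    by (rule sum.cong) (auto simp: choose_mult)
  also have "\<dots> = (\<Sum>i\<le>n - j. of_nat ((n choose j) * ((n - j) choose i))
      * (X ^ (i + j) * Y ^ (n - j - i)))"
    using assms
    by (intro sum.reindex_bij_witness[of _ "\<lambda>i. i + j" "\<lambda>k. k - j"]) auto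
  also have "\<dots> = of_nat (n choose j) * (X ^ j * (X + Y) ^ (n - j))"
    by (simp add: binomial_ring sum_distrib_left power_add algebra_simps)
  finally show ?thesis .
qed

section \<open>The moment problem on [0, c], solved with Bernstein weights\<close>

context
  fixes m :: "nat \<Rightarrow> real" and c :: real
  assumes c: "c > 0"
    and m0: "m 0 = 1"
    and pos: "\<And>q. 0 \<le> mlin m (q * q)"
    and posX: "\<And>q. 0 \<le> mlin m ([:0, 1:] * (q * q))"
    and posY: "\<And>q. 0 \<le> mlin m ([:c, -1:] * (q * q))"
begin

text \<open>Up to squares only \<open>1\<close>, \<open>X\<close>, \<open>Y = c - X\<close> and \<open>XY\<close> have to be considered,
  and \<open>c X Y q\<^sup>2 = Y (X q)\<^sup>2 + X (Y q)\<^sup>2\<close>.\<close>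

lemma mlin_bernstein_nonneg: "0 \<le> mlin m ([:0, 1:] ^ k * [:c, -1:] ^ l)"
proof -
  let ?X = "[:0, 1::real:]" and ?Y = "[:c, -1::real:]"
  obtain a i where k: "k = 2 * a + i" "i < 2" by (metis mod_less_divisor mult_div_mod_eq zero_less_numeral)
  obtain b j where l: "l = 2 * b + j" "j < 2" by (metis mod_less_divisor mult_div_mod_eq zero_less_numeral)
  let ?q = "?X ^ a * ?Y ^ b"
  have eq: "?X ^ k * ?Y ^ l = (?X ^ i * ?Y ^ j) * (?q * ?q)"
    unfolding k l mult_2 power_add by (simp only: mult_ac)
  consider "i = 0" "j = 0" | "i = 1" "j = 0" | "i = 0" "j = 1" | "i = 1" "j = 1"
    using k l by linarith
  then show ?thesis
  proof cases
    case 4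
    have "smult c (?X * ?Y * (?q * ?q)) = [:c:] * (?X * ?Y * (?q * ?q))"
      by simp
    also have "[:c:] = ?X + ?Y" by simp
    also have "(?X + ?Y) * (?X * ?Y * (?q * ?q))
        = ?Y * ((?X * ?q) * (?X * ?q)) + ?X * ((?Y * ?q) * (?Y * ?q))"
    proof -
      have "(x + y) * (x * y * (z * z)) = y * ((x * z) * (x * z)) + x * ((y * z) * (y * z))"
        for x y z :: "real poly"
        by (simp add: algebra_simps)
      then show ?thesis .
    qed
    finally have "c * mlin m (?X * ?Y * (?q * ?q))
        = mlin m (?Y * ((?X * ?q) * (?X * ?q))) + mlin m (?X * ((?Y * ?q) * (?Y * ?q)))"
      by (metis mlin_add mlin_smult)
    also have "\<dots> \<ge> 0"
      by (rule add_nonneg_nonneg[OF posY posX])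
    finally have "0 \<le> mlin m (?X * ?Y * (?q * ?q))"
      using c by (meson zero_le_mult_iff not_le)
    then show ?thesis
      unfolding eq 4 power_one_right .
  qed (unfold eq, use pos[of ?q] posX[of ?q] posY[of ?q] in \<open>simp_all del: mult_pCons_left mult_pCons_right\<close>)
qed

text \<open>The functional applied to the k-th Bernstein basis polynomial of degree n, rescaled to
  [0, c]. For a sequence that has a representing measure, this is the average over t of the binomial
  probability of k successes with parameter t / c.\<close>

definition bernstein_weight :: "nat \<Rightarrow> nat \<Rightarrow> real" where
  "bernstein_weight n k = (if k \<le> n
     then real (n choose k) * mlin m ([:0, 1:] ^ k * [:c, -1:] ^ (n - k)) / c ^ n else 0)"

lemma bernstein_weight_nonneg: "bernstein_weight n k \<ge> 0"
  using mlin_bernstein_nonneg c by (auto simp: bernstein_weight_def)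

text \<open>In the factorial moment identity X + Y is the constant c, so only the monomial of degree
  j survives. The factorial moments are therefore exact for every n.\<close>

lemma bernstein_weight_moment:
  assumes "j \<le> n"
  shows "(\<Sum>k\<le>n. bernstein_weight n k * real (k choose j)) = real (n choose j) * m j / c ^ j"
proof -
  let ?X = "[:0, 1::real:]" and ?Y = "[:c, -1::real:]"
  have "(\<Sum>k\<le>n. bernstein_weight n k * real (k choose j)) * c ^ n
      = (\<Sum>k\<le>n. mlin m (of_nat ((n choose k) * (k choose j)) * (?X ^ k * ?Y ^ (n - k))))"
    unfolding sum_distrib_right
  proof (rule sum.cong, goal_cases)
    case (2 k)
    have "of_nat ((n choose k) * (k choose j)) * (?X ^ k * ?Y ^ (n - k))
       = smult (real ((n choose k) * (k choose j))) (?X ^ k * ?Y ^ (n - k))"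
      by (simp add: of_nat_poly)
    then show ?case using 2 c
      by (simp only: mlin_smult) (simp add: bernstein_weight_def)
  qed simp
  also have "\<dots> = mlin m (of_nat (n choose j) * (?X ^ j * (?X + ?Y) ^ (n - j)))"
    using bernstein_factorial_moment[OF assms, of ?X ?Y] by (simp only: mlin_sum[symmetric])
  also have "of_nat (n choose j) * (?X ^ j * (?X + ?Y) ^ (n - j))
      = smult (real (n choose j) * c ^ (n - j)) (monom 1 j)"
  proof -
    have "?X + ?Y = [:c:]" by simp
    moreover have "?X ^ j = monom 1 j" by (simp add: monom_altdef)
    moreover have "[:c:] ^ (n - j) = [:c ^ (n - j):]" by (rule poly_const_pow)
    ultimately show ?thesis by (simp add: of_nat_poly mult.commute)
  qed
  also have "mlin m \<dots> = real (n choose j) * c ^ (n - j) * m j"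
    by (simp add: mlin_smult mlin_monom)
  finally have "(\<Sum>k\<le>n. bernstein_weight n k * real (k choose j)) = real (n choose j) * m j * (c ^ (n - j) / c ^ n)"
    using c by (simp add: field_simps)
  also have "c ^ (n - j) / c ^ n = 1 / c ^ j"
    using assms c by (simp add: power_diff)
  finally show ?thesis by simp
qed

lemma bernstein_weight_sum: "(\<Sum>k\<le>n. bernstein_weight n k) = 1"
  using bernstein_weight_moment[of 0 n] by (simp add: m0)

definition bernstein_pmf :: "nat \<Rightarrow> nat pmf" where
  "bernstein_pmf n = embed_pmf (bernstein_weight n)"

lemma pmf_bernstein: "pmf (bernstein_pmf n) k = bernstein_weight n k"
  unfolding bernstein_pmf_def
proof (rule pmf_embed_pmf)
  show "0 \<le> bernstein_weight n x" for x by (rule bernstein_weight_nonneg)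
  have "(\<integral>\<^sup>+ x. ennreal (bernstein_weight n x) \<partial>count_space UNIV) = (\<Sum>k\<le>n. ennreal (bernstein_weight n k))"
    by (subst nn_integral_count_space'[of "{..n}"]) (auto simp: bernstein_weight_def)
  also have "\<dots> = 1" using bernstein_weight_sum[of n] bernstein_weight_nonneg by (simp add: sum_ennreal)
  finally show "(\<integral>\<^sup>+ x. ennreal (bernstein_weight n x) \<partial>count_space UNIV) = 1" .
qed

lemma set_bernstein_pmf: "set_pmf (bernstein_pmf n) \<subseteq> {..n}"
  by (auto simp: set_pmf_eq pmf_bernstein bernstein_weight_def split: if_splits)

definition bernstein_measure :: "nat \<Rightarrow> real measure" where
  "bernstein_measure n = distr (measure_pmf (bernstein_pmf n)) borel (\<lambda>k. real k / real n)"

lemma real_distribution_bernstein_measure: "real_distribution (bernstein_measure n)"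
proof -
  interpret prob_space "bernstein_measure n"
    unfolding bernstein_measure_def by (rule measure_pmf.prob_space_distr) simp
  show ?thesis by unfold_locales (auto simp: bernstein_measure_def)
qed

lemma integral_bernstein_measure:
  assumes "f \<in> borel_measurable borel"
  shows "(\<integral>t. f t \<partial>bernstein_measure n) = (\<Sum>k\<le>n. bernstein_weight n k * f (real k / real n))"
proof -
  have "(\<integral>t. f t \<partial>bernstein_measure n) = (\<integral>k. f (real k / real n) \<partial>measure_pmf (bernstein_pmf n))"
    unfolding bernstein_measure_def using assms by (subst integral_distr) auto
  also have "\<dots> = (\<Sum>k\<le>n. f (real k / real n) * pmf (bernstein_pmf n) k)"
    using set_bernstein_pmf by (intro integral_measure_pmf_real) auto
  finally show ?thesis by (simp add: pmf_bernstein mult.commute)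
qed

text \<open>In the variable t = k / n the coefficient \<open>k choose j\<close> becomes, up to the
  factor \<open>fact j / n ^ j\<close>, the product of the t - i / n. These falling moments are
  known exactly, ordinary power moments only in the limit.\<close>

lemma bernstein_measure_falling_moment:
  assumes "j \<le> n" "0 < n"
  shows "(\<integral>t. (\<Prod>i<j. t - real i / real n) \<partial>bernstein_measure n)
     = (\<Prod>i<j. 1 - real i / real n) * (m j / c ^ j)"
proof -
  have ff: "(\<Prod>i<j. real k / real n - real i / real n) = fact j / real n ^ j * real (k choose j)" for k
  proof -
    have "(\<Prod>i<j. real k / real n - real i / real n) = (\<Prod>i<j. (real k - real i) / real n)"
      by (simp add: diff_divide_distrib)
    also have "\<dots> = (\<Prod>i<j. real k - real i) / real n ^ j"
      by (simp add: prod_dividef)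
    also have "(\<Prod>i<j. real k - real i) = fact j * real (k choose j)"
      using gbinomial_mult_fact[of j "real k"] by (simp add: binomial_gbinomial atLeast0LessThan)
    finally show ?thesis by simp
  qed
  have "(\<integral>t. (\<Prod>i<j. t - real i / real n) \<partial>bernstein_measure n)
      = (\<Sum>k\<le>n. bernstein_weight n k * (fact j / real n ^ j * real (k choose j)))"
    by (subst integral_bernstein_measure) (auto simp: ff)
  also have "\<dots> = fact j / real n ^ j * (\<Sum>k\<le>n. bernstein_weight n k * real (k choose j))"
    by (simp add: sum_distrib_left mult_ac)
  also have "\<dots> = (fact j / real n ^ j * real (n choose j)) * (m j / c ^ j)"
    using bernstein_weight_moment[OF assms(1)] by simp
  also have "\<dots> = (\<Prod>i<j. real n / real n - real i / real n) * (m j / c ^ j)"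
    by (simp only: ff)
  finally show ?thesis using assms by simp
qed

lemma AE_bernstein_measure: "AE t in bernstein_measure n. t \<in> {0..1}"
  unfolding bernstein_measure_def
  using set_bernstein_pmf[of n] by (subst AE_distr_iff) (auto simp: AE_measure_pmf_iff divide_le_eq_1)

text \<open>On [0, 1] the power and the falling product differ by at most the sum of the i / n over
  i < j, which vanishes as n grows.\<close>

lemma bernstein_measure_moment_tendsto: "(\<lambda>n. \<integral>t. t ^ j \<partial>bernstein_measure n) \<longlonglongrightarrow> m j / c ^ j"
proof -
  have lim1: "(\<lambda>n. (\<Prod>i<j. 1 - real i / real n) * (m j / c ^ j)) \<longlonglongrightarrow> (\<Prod>i<j. 1 - 0) * (m j / c ^ j)"
    by (intro tendsto_intros lim_const_over_n)
  have bd: "\<bar>(\<integral>t. t ^ j \<partial>bernstein_measure n) - (\<integral>t. (\<Prod>i<j. t - real i / real n) \<partial>bernstein_measure n)\<bar>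
      \<le> (\<Sum>i<j. real i / real n)" if n: "n > j" for n
  proof -
    interpret B: real_distribution "bernstein_measure n" by (rule real_distribution_bernstein_measure)
    have dif: "\<bar>t ^ j - (\<Prod>i<j. t - real i / real n)\<bar> \<le> (\<Sum>i<j. real i / real n)"
      if t: "t \<in> {0..1}" for t
    proof -
      have le1: "real i / real n \<le> 1" if "i < j" for i using that n by simp
      have "norm ((\<Prod>i<j. t) - (\<Prod>i<j. t - real i / real n)) \<le> (\<Sum>i<j. norm (t - (t - real i / real n)))"
      proof (rule norm_prod_diff)
        fix i assume "i \<in> {..<j}"
        then have "real i / real n \<le> 1" "0 \<le> real i / real n" using le1 by auto
        then show "norm (t - real i / real n) \<le> 1" using t by (auto simp: abs_le_iff simp del: divide_nonneg_nonneg)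
      qed (use t in auto)
      then show ?thesis by simp
    qed
    have i1: "integrable (bernstein_measure n) (\<lambda>t. t ^ j)"
      by (rule B.integrable_const_bound[of _ 1])
         (use AE_bernstein_measure[of n] in \<open>auto simp: power_le_one\<close>)
    have i2: "integrable (bernstein_measure n) (\<lambda>t. (\<Prod>i<j. t - real i / real n))"
    proof (rule B.integrable_const_bound[of _ "1 + (\<Sum>i<j. real i / real n)"])
      show "AE t in bernstein_measure n. norm (\<Prod>i<j. t - real i / real n) \<le> 1 + (\<Sum>i<j. real i / real n)"
        using AE_bernstein_measure[of n]
      proof eventually_elim
        case (elim t)
        then have "\<bar>t ^ j\<bar> \<le> 1" by (simp add: power_le_one)
        then show ?case using dif[OF elim] by simp
      qed
    qed simp
    have "\<bar>(\<integral>t. t ^ j \<partial>bernstein_measure n) - (\<integral>t. (\<Prod>i<j. t - real i / real n) \<partial>bernstein_measure n)\<bar>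
       = \<bar>\<integral>t. t ^ j - (\<Prod>i<j. t - real i / real n) \<partial>bernstein_measure n\<bar>"
      using i1 i2 by simp
    also have "\<dots> \<le> (\<integral>t. \<bar>t ^ j - (\<Prod>i<j. t - real i / real n)\<bar> \<partial>bernstein_measure n)"
      by (rule integral_abs_bound)
    also have "\<dots> \<le> (\<integral>t. (\<Sum>i<j. real i / real n) \<partial>bernstein_measure n)"
    proof (rule integral_mono_AE)
      show "AE t in bernstein_measure n. \<bar>t ^ j - (\<Prod>i<j. t - real i / real n)\<bar> \<le> (\<Sum>i<j. real i / real n)"
        using AE_bernstein_measure[of n] by eventually_elim (rule dif)
    qed (use i1 i2 in auto)
    also have "\<dots> = (\<Sum>i<j. real i / real n)" using B.prob_space by simp
    finally show ?thesis .
  qed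
  have ev: "eventually (\<lambda>n. n > j) sequentially" by (rule eventually_gt_at_top)
  have lim2: "(\<lambda>n. \<Sum>i<j. real i / real n) \<longlonglongrightarrow> (\<Sum>i<j. 0)"
    by (intro tendsto_intros lim_const_over_n)
  have "(\<lambda>n. (\<integral>t. t ^ j \<partial>bernstein_measure n) - (\<integral>t. (\<Prod>i<j. t - real i / real n) \<partial>bernstein_measure n)) \<longlonglongrightarrow> 0"
    by (rule Lim_null_comparison[of _ "\<lambda>n. \<Sum>i<j. real i / real n"])
       (use lim2 bd in \<open>auto intro: eventually_mono[OF ev]\<close>)
  moreover have "(\<lambda>n. (\<integral>t. (\<Prod>i<j. t - real i / real n) \<partial>bernstein_measure n)) \<longlonglongrightarrow> m j / c ^ j"
  proof (rule Lim_transform_eventually)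
    show "(\<lambda>n. (\<Prod>i<j. 1 - real i / real n) * (m j / c ^ j)) \<longlonglongrightarrow> m j / c ^ j"
      using lim1 by simp
    show "\<forall>\<^sub>F n in sequentially. (\<Prod>i<j. 1 - real i / real n) * (m j / c ^ j) =
        (\<integral>t. (\<Prod>i<j. t - real i / real n) \<partial>bernstein_measure n)"
      using ev by eventually_elim (subst bernstein_measure_falling_moment, auto)
  qed
  ultimately have "(\<lambda>n. ((\<integral>t. t ^ j \<partial>bernstein_measure n) - (\<integral>t. (\<Prod>i<j. t - real i / real n) \<partial>bernstein_measure n))
     + (\<integral>t. (\<Prod>i<j. t - real i / real n) \<partial>bernstein_measure n)) \<longlonglongrightarrow> 0 + m j / c ^ j"
    by (rule tendsto_add)
  then show ?thesis by simp
qed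

lemma bernstein_measure_tight: "tight bernstein_measure"
  unfolding tight_def
proof (intro conjI allI impI)
  fix e :: real assume e: "e > 0"
  have "measure (bernstein_measure n) {-1<..1} > 1 - e" for n
  proof -
    interpret B: real_distribution "bernstein_measure n" by (rule real_distribution_bernstein_measure)
    have "AE t in bernstein_measure n. t \<in> {-1<..1}"
      using AE_bernstein_measure[of n] by eventually_elim auto
    then have "measure (bernstein_measure n) {-1<..1} = 1"
      by (subst B.prob_eq_1) auto
    then show ?thesis using e by simp
  qed
  then show "\<exists>a b. a < b \<and> (\<forall>n. 1 - e < measure (bernstein_measure n) {a<..b})"
    by (intro exI[of _ "-1"] exI[of _ 1]) auto
qed (rule real_distribution_bernstein_measure)

lemma hausdorff_moment_problem:
  "\<exists>\<mu>. real_distribution \<mu> \<and> (AE t in \<mu>. t \<in> {0..c}) \<and>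
     (\<forall>n. integrable \<mu> (\<lambda>t. t ^ n) \<and> (\<integral>t. t ^ n \<partial>\<mu>) = m n)"
proof -
  obtain r M where r: "strict_mono (r :: nat \<Rightarrow> nat)" and M: "real_distribution M"
    and w: "weak_conv_m (bernstein_measure \<circ> id \<circ> r) M"
    using tight_imp_convergent_subsubsequence[OF bernstein_measure_tight, of id] by (auto simp: strict_mono_def)
  interpret M: real_distribution M by fact
  have conv: "(\<lambda>n. \<integral>t. f t \<partial>bernstein_measure (r n)) \<longlonglongrightarrow> (\<integral>t. f t \<partial>M)"
    if "\<And>x. isCont f x" "\<And>x. norm (f x) \<le> B" for f :: "real \<Rightarrow> real" and B
    using weak_conv_imp_integral_bdd_continuous_conv[of "bernstein_measure \<circ> id \<circ> r" M f B]
      real_distribution_bernstein_measure M w that by simp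
  \<comment> \<open>Weak convergence tests only bounded continuous functions. Clipping makes powers
    admissible and changes nothing on [0, 1], where all the measures are carried.\<close>
  define clip :: "real \<Rightarrow> real" where "clip t = max 0 (min 1 t)" for t
  have clip_cont: "isCont clip x" for x
    unfolding clip_def by (intro continuous_intros)
  have clip_meas [measurable]: "clip \<in> borel_measurable borel"
    unfolding clip_def by measurable
  have clip_id: "clip t = t" if "t \<in> {0..1}" for t using that by (auto simp: clip_def)
  have clip_range: "clip t \<in> {0..1}" for t by (auto simp: clip_def)
  have M01: "AE t in M. t \<in> {0..1}"
  proof -
    \<comment> \<open>A bounded continuous function vanishing exactly on [0, 1]. Its integral passes
      to the limit, so the limit measure is carried by [0, 1] as well.\<close>
    define g where "g t = min 1 \<bar>t - clip t\<bar>" for t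
    have gm: "g \<in> borel_measurable borel" unfolding g_def by measurable
    have g0: "(\<integral>t. g t \<partial>bernstein_measure n) = 0" for n
    proof -
      have "(\<integral>t. g t \<partial>bernstein_measure n) = (\<integral>t. 0 \<partial>bernstein_measure n)"
      proof (rule integral_cong_AE)
        show "AE t in bernstein_measure n. g t = 0"
          using AE_bernstein_measure[of n] by eventually_elim (simp add: g_def clip_id)
      qed (use gm in \<open>auto simp: bernstein_measure_def\<close>)
      then show ?thesis by simp
    qed
    have "isCont g x" for x unfolding g_def by (intro continuous_intros clip_cont)
    moreover have "norm (g x) \<le> 1" for x by (auto simp: g_def)
    ultimately have "(\<lambda>n. \<integral>t. g t \<partial>bernstein_measure (r n)) \<longlonglongrightarrow> (\<integral>t. g t \<partial>M)" by (rule conv)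
    then have "(\<integral>t. g t \<partial>M) = 0" by (simp add: g0 LIMSEQ_const_iff)
    moreover have "integrable M g"
      using gm by (intro M.integrable_const_bound[of _ 1]) (auto simp: g_def)
    ultimately have "AE t in M. g t = 0"
      by (subst (asm) integral_nonneg_eq_0_iff_AE) (auto simp: g_def)
    then show ?thesis
    proof eventually_elim
      case (elim t)
      then have "t = clip t" by (auto simp: g_def min_def split: if_splits)
      then show ?case using clip_range[of t] by simp
    qed
  qed
  have Mint: "integrable M (\<lambda>t. t ^ j)" for j
    by (rule M.integrable_const_bound[of _ 1]) (use M01 in \<open>auto simp: power_le_one\<close>)
  have Mmom: "(\<integral>t. t ^ j \<partial>M) = m j / c ^ j" for j
  proof -
    have eq: "(\<integral>t. clip t ^ j \<partial>N) = (\<integral>t. t ^ j \<partial>N)"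
      if "AE t in N. t \<in> {0..1}" "sets N = sets borel" for N
      using that by (intro integral_cong_AE) (auto simp: clip_id measurable_cong_sets[OF that(2) refl])
    have "(\<lambda>n. \<integral>t. clip t ^ j \<partial>bernstein_measure (r n)) \<longlonglongrightarrow> (\<integral>t. clip t ^ j \<partial>M)"
    proof (rule conv[of _ 1])
      show "isCont (\<lambda>t. clip t ^ j) x" for x by (intro continuous_intros clip_cont)
      show "norm (clip x ^ j) \<le> 1" for x
        using clip_range[of x] by (simp add: power_le_one)
    qed
    then have "(\<lambda>n. \<integral>t. t ^ j \<partial>bernstein_measure (r n)) \<longlonglongrightarrow> (\<integral>t. t ^ j \<partial>M)"
      using eq[OF AE_bernstein_measure] eq[OF M01] by (simp add: bernstein_measure_def)
    moreover have "(\<lambda>n. \<integral>t. t ^ j \<partial>bernstein_measure (r n)) \<longlonglongrightarrow> m j / c ^ j"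
      using LIMSEQ_subseq_LIMSEQ[OF bernstein_measure_moment_tendsto r] by (simp add: o_def)
    ultimately show ?thesis by (rule LIMSEQ_unique)
  qed
  \<comment> \<open>Scaling by c undoes the normalisation by \<open>c ^ j\<close> and moves the
    support to [0, c].\<close>
  define \<mu> where "\<mu> = distr M borel (\<lambda>t. c * t)"
  have "prob_space \<mu>" unfolding \<mu>_def by (rule M.prob_space_distr) simp
  then have "real_distribution \<mu>"
    by (simp add: real_distribution_def real_distribution_axioms_def \<mu>_def)
  moreover have "AE t in \<mu>. t \<in> {0..c}"
    unfolding \<mu>_def using M01 c by (subst AE_distr_iff) (auto elim!: eventually_mono)
  moreover have "integrable \<mu> (\<lambda>t. t ^ n)" "(\<integral>t. t ^ n \<partial>\<mu>) = m n" for n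
    unfolding \<mu>_def using Mint[of n] Mmom[of n] c
    by (auto simp: integrable_distr_eq integral_distr power_mult_distrib)
  ultimately show ?thesis by blast
qed

end

text \<open>For j > 0 the ramp \<open>g j\<close> is 1 up to E and falls linearly to 0 at E + 1/j,
  so the ramps converge pointwise to the indicator with E itself included. Weierstrass approximation
  with vanishing error keeps the limit; the bound 2 is 1 for the ramp plus 1 for the error.\<close>

lemma poly_approx_indicator:
  fixes E R :: real
  obtains q :: "nat \<Rightarrow> real poly"
  where "\<And>j t. \<bar>t\<bar> \<le> R \<Longrightarrow> \<bar>poly (q j) t\<bar> \<le> 2"
    and "\<And>t. \<bar>t\<bar> \<le> R \<Longrightarrow> (\<lambda>j. poly (q j) t) \<longlonglongrightarrow> indicator {..E} t"
proof -
  define g where "g j t = max 0 (min 1 (1 - real j * (t - E)))" for j :: nat and t :: real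
  have "\<exists>q. \<forall>t\<in>{-R..R}. \<bar>g j t - poly q t\<bar> < inverse (real (Suc j))" for j
  proof -
    have "continuous_on {-R..R} (g j)" unfolding g_def by (intro continuous_intros)
    then obtain f where f: "real_polynomial_function f"
      "\<And>x. x \<in> {-R..R} \<Longrightarrow> \<bar>g j x - f x\<bar> < inverse (real (Suc j))"
      by (rule Stone_Weierstrass_real_polynomial_function[rotated]) auto
    obtain a n where "f = (\<lambda>x. \<Sum>i\<le>n. a i * x ^ i)"
      using f(1) by (auto simp: real_polynomial_function_iff_sum)
    then have "f x = poly (\<Sum>i\<le>n. monom (a i) i) x" for x
      by (simp add: poly_sum poly_monom)
    with f(2) show ?thesis by metis
  qed
  then obtain q where q: "\<And>j t. t \<in> {-R..R} \<Longrightarrow> \<bar>g j t - poly (q j) t\<bar> < inverse (real (Suc j))"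
    by metis
  show thesis
  proof (rule that[of q])
    fix j and t :: real assume "\<bar>t\<bar> \<le> R"
    then have "t \<in> {-R..R}" by auto
    from q[OF this, of j] have "\<bar>g j t - poly (q j) t\<bar> < 1"
      by (rule less_le_trans) (simp add: inverse_le_1_iff)
    moreover have "\<bar>g j t\<bar> \<le> 1" by (simp add: g_def)
    ultimately show "\<bar>poly (q j) t\<bar> \<le> 2" by linarith
  next
    fix t :: real assume "\<bar>t\<bar> \<le> R"
    then have t: "t \<in> {-R..R}" by auto
    have "(\<lambda>j. g j t - poly (q j) t) \<longlonglongrightarrow> 0"
      by (rule Lim_null_comparison[OF _ LIMSEQ_inverse_real_of_nat])
         (use q[OF t] in \<open>auto intro!: always_eventually less_imp_le\<close>)
    moreover have "(\<lambda>j. g j t) \<longlonglongrightarrow> indicator {..E} t"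
    proof (cases "t \<le> E")
      case True
      then have "g j t = 1" for j
        by (auto simp: g_def mult_le_0_iff min_def)
      then show ?thesis using True by simp
    next
      case False
      obtain N where N: "real N * (t - E) > 1" using False reals_Archimedean3[of "t - E"] by auto
      have "g j t = 0" if "j \<ge> N" for j
      proof -
        have "real N * (t - E) \<le> real j * (t - E)"
          using that False by (intro mult_right_mono) auto
        then show ?thesis using N by (auto simp: g_def)
      qed
      then have "(\<lambda>j. g j t) \<longlonglongrightarrow> 0"
        by (intro tendsto_eventually) (auto simp: eventually_sequentially)
      then show ?thesis using False by simp
    qed
    ultimately have "(\<lambda>j. g j t - (g j t - poly (q j) t)) \<longlonglongrightarrow> indicator {..E} t - 0"
      by (intro tendsto_diff)
    then show "(\<lambda>j. poly (q j) t) \<longlonglongrightarrow> indicator {..E} t" by simp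
  qed
qed

section \<open>Spectral measures of the Neumann Laplacian\<close>

lemma bounded_support_AE:
  assumes "sets \<mu> = sets borel" "emeasure \<mu> (- {-R..R::real}) = 0"
  shows "AE t in \<mu>. \<bar>t\<bar> \<le> R"
  by (rule AE_I[of _ _ "- {-R..R}"]) (use assms in auto)

text \<open>Dominated convergence. The numbers \<open>mlin m (q j)\<close> depend on the moments
  only, so they determine the integral of f: uniqueness, the spectral estimates and measurability
  all rest on this.\<close>

lemma mlin_tendsto_integral:
  fixes \<mu> :: "real measure"
  assumes sets: "sets \<mu> = sets borel" and fin: "finite_measure \<mu>"
    and R: "emeasure \<mu> (- {-R..R}) = 0"
    and moment: "\<And>n. integrable \<mu> (\<lambda>t. t ^ n)" "\<And>n. (\<integral>t. t ^ n \<partial>\<mu>) = m n"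
    and bd: "\<And>j t. \<bar>t\<bar> \<le> R \<Longrightarrow> \<bar>poly (q j) t\<bar> \<le> B"
    and lim: "\<And>t. \<bar>t\<bar> \<le> R \<Longrightarrow> (\<lambda>j. poly (q j) t) \<longlonglongrightarrow> f t"
    and f: "f \<in> borel_measurable borel"
  shows "integrable \<mu> f" "(\<lambda>j. mlin m (q j)) \<longlonglongrightarrow> (\<integral>t. f t \<partial>\<mu>)"
proof -
  note AE = bounded_support_AE[OF sets R]
  have c: "integrable \<mu> (\<lambda>_. B)" using fin by (simp add: finite_measure.integrable_const)
  have bm: "f \<in> borel_measurable \<mu>" "poly (q j) \<in> borel_measurable \<mu>" for j
    using f borel_measurable_integrable[OF mlin_integral(1)[OF moment]]
    by (auto simp: measurable_cong_sets[OF sets refl])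
  have a: "AE t in \<mu>. (\<lambda>j. poly (q j) t) \<longlonglongrightarrow> f t" using AE by eventually_elim (rule lim)
  have b: "AE t in \<mu>. norm (poly (q j) t) \<le> B" for j
    using AE by eventually_elim (simp add: bd)
  show "integrable \<mu> f"
    by (rule integrable_dominated_convergence[OF bm(1) bm(2) c a b])
  show "(\<lambda>j. mlin m (q j)) \<longlonglongrightarrow> (\<integral>t. f t \<partial>\<mu>)"
    using integral_dominated_convergence[OF bm(1) bm(2) c a b] mlin_integral(2)[OF moment] by simp
qed

section \<open>The Laplacian as a symmetric form on finitely supported functions\<close>

definition delta :: "'v \<Rightarrow> 'v \<Rightarrow> real" where
  "delta x0 = (\<lambda>y. if y = x0 then 1 else 0)"

text \<open>The l^2 inner product, summed over the support of the first argument, so that the second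
  may be arbitrary as long as the first is finitely supported.\<close>

definition finner :: "('v \<Rightarrow> real) \<Rightarrow> ('v \<Rightarrow> real) \<Rightarrow> real" where
  "finner f g = (\<Sum>x | f x \<noteq> 0. f x * g x)"

lemma finner_eq:
  assumes "finite {x. f x \<noteq> 0}" "finite B" "\<And>x. x \<notin> B \<Longrightarrow> f x * g x = 0"
  shows "finner f g = (\<Sum>x\<in>B. f x * g x)"
  unfolding finner_def using assms by (intro sum.mono_neutral_cong) auto

lemma finner_commute:
  assumes "finite {x. f x \<noteq> 0}" "finite {x. g x \<noteq> 0}"
  shows "finner f g = finner g f"
  using finner_eq[of f "{x. f x \<noteq> 0}" g] finner_eq[of g "{x. f x \<noteq> 0}" f] assms
  by (auto simp: mult.commute)

lemma finner_delta_left: "finner (delta x0) g = g x0"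
proof -
  have "{x. delta x0 x \<noteq> 0} = {x0}" by (auto simp: delta_def)
  then show ?thesis by (simp add: finner_def delta_def)
qed

lemma finner_delta_right: "finite {x. f x \<noteq> 0} \<Longrightarrow> finner f (delta x0) = f x0"
  using finner_commute[of f "delta x0"] finner_delta_left[of x0 f] by (simp add: delta_def)

lemma finner_add_left:
  assumes "finite {x. f x \<noteq> 0}" "finite {x. g x \<noteq> 0}"
  shows "finner (\<lambda>x. a * f x + b * g x) h = a * finner f h + b * finner g h"
proof -
  let ?B = "{x. f x \<noteq> 0} \<union> {x. g x \<noteq> 0}"
  have "finite {x. a * f x + b * g x \<noteq> 0}"
    by (rule finite_subset[of _ ?B]) (use assms in auto)
  then show ?thesis
    using assms finner_eq[of f ?B h] finner_eq[of g ?B h] finner_eq[of "\<lambda>x. a * f x + b * g x" ?B h]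
    by (auto simp: sum_distrib_left sum.distrib algebra_simps)
qed

lemma finner_add_right: "finner h (\<lambda>x. a * f x + b * g x) = a * finner h f + b * finner h g"
  by (simp add: finner_def sum_distrib_left sum.distrib algebra_simps)

lemma finner_self_nonneg: "0 \<le> finner f f"
  unfolding finner_def by (rule sum_nonneg) simp

lemma finner_Cauchy_Schwarz:
  assumes "finite {x. f x \<noteq> 0}" "finite {x. g x \<noteq> 0}"
  shows "(finner f g)\<^sup>2 \<le> finner f f * finner g g"
proof -
  let ?B = "{x. f x \<noteq> 0} \<union> {x. g x \<noteq> 0}"
  show ?thesis
    using assms finner_eq[of f ?B g] finner_eq[of f ?B f] finner_eq[of g ?B g]
      Cauchy_Schwarz_ineq_sum[of f g ?B]
    by (auto simp: power2_eq_square)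
qed

text \<open>The uniform degree bound \<open>k\<close> later fixes one interval carrying the spectral
  measures of all configurations, infinite components included.\<close>

locale lap_graph =
  fixes V :: "'v set" and adj :: "'v \<Rightarrow> 'v \<Rightarrow> bool" and k :: nat
  assumes adj_sym: "adj x y \<Longrightarrow> adj y x"
    and adj_V: "adj x y \<Longrightarrow> x \<in> V"
    and nbr_fin: "finite {y. adj x y}"
    and nbr_card: "card {y. adj x y} \<le> k"
begin

abbreviation T :: "('v \<Rightarrow> real) \<Rightarrow> 'v \<Rightarrow> real" where
  "T \<equiv> neumann_lap V adj"

lemma T_eq: "T f x = (\<Sum>y\<in>{y. adj x y}. f x - f y)"
proof (cases "x \<in> V")
  case False
  then have "{y. adj x y} = {}" using adj_V by auto
  then show ?thesis using False by (simp add: neumann_lap_def)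
qed (simp add: neumann_lap_def sum_subtractf)

lemma T_lin: "T (\<lambda>x. mlin (\<lambda>i. F i x) q) x = mlin (\<lambda>i. T (F i) x) q"
  unfolding T_eq mlin_def sum_subtractf[symmetric] right_diff_distrib[symmetric] sum_distrib_left
  by (rule sum.swap)

lemma T_fsupp:
  assumes "finite {x. f x \<noteq> 0}"
  shows "finite {x. T f x \<noteq> 0}"
proof (rule finite_subset)
  show "{x. T f x \<noteq> 0} \<subseteq> {x. f x \<noteq> 0} \<union> (\<Union>x\<in>{x. f x \<noteq> 0}. {y. adj x y})"
  proof (rule subsetI, rule ccontr)
    fix x assume x: "x \<in> {x. T f x \<noteq> 0}" "x \<notin> {x. f x \<noteq> 0} \<union> (\<Union>x\<in>{x. f x \<noteq> 0}. {y. adj x y})"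
    then have "f x = 0" "\<And>y. adj x y \<Longrightarrow> f y = 0" using adj_sym by auto
    then have "T f x = 0" unfolding T_eq by (intro sum.neutral) auto
    then show False using x by simp
  qed
qed (use assms nbr_fin in auto)

text \<open>Summation by parts. \<open>P\<close> consists of ordered pairs, so each edge between
  distinct vertices is counted twice, whence the factor 2. Pairs with one end outside
  \<open>B\<close> are kept because the functions may jump there.\<close>

lemma energy:
  assumes B: "finite B" "{x. f x \<noteq> 0} \<subseteq> B" "{x. g x \<noteq> 0} \<subseteq> B"
  defines "P \<equiv> {(x, y). adj x y \<and> (x \<in> B \<or> y \<in> B)}"
  shows "finite P" "2 * finner (T f) g = (\<Sum>(x,y)\<in>P. (f x - f y) * (g x - g y))"
proof -
  let ?Q = "SIGMA x:B. {y. adj x y}"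
  have Qfin: "finite ?Q" using B nbr_fin by auto
  have "P \<subseteq> ?Q \<union> prod.swap ` ?Q"
    unfolding P_def using adj_sym by (force simp: image_iff)
  then show fP: "finite P" using Qfin finite_subset by blast
  have ff: "finite {x. T f x \<noteq> 0}"
    using B by (intro T_fsupp) (auto intro: finite_subset)
  have g0: "g x = 0" if "x \<notin> B" for x using that B by auto
  have "finner (T f) g = (\<Sum>x\<in>B. \<Sum>y\<in>{y. adj x y}. (f x - f y) * g x)"
    using B(1) ff g0 by (subst finner_eq[of _ B]) (auto simp: T_eq sum_distrib_right)
  also have "\<dots> = (\<Sum>(x,y)\<in>?Q. (f x - f y) * g x)"
    using B nbr_fin by (subst sum.Sigma) auto
  also have "\<dots> = (\<Sum>(x,y)\<in>P. (f x - f y) * g x)"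
    using fP B by (intro sum.mono_neutral_left) (auto simp: P_def)
  finally have 1: "finner (T f) g = (\<Sum>(x,y)\<in>P. (f x - f y) * g x)" .
  have "(\<Sum>(x,y)\<in>P. (f x - f y) * g x) = (\<Sum>(x,y)\<in>P. (f y - f x) * g y)"
    using adj_sym by (intro sum.reindex_bij_witness[of _ prod.swap prod.swap]) (auto simp: P_def)
  then have "2 * finner (T f) g = (\<Sum>(x,y)\<in>P. (f x - f y) * g x) + (\<Sum>(x,y)\<in>P. (f y - f x) * g y)"
    using 1 by simp
  also have "\<dots> = (\<Sum>(x,y)\<in>P. (f x - f y) * (g x - g y))"
    unfolding sum.distrib[symmetric] by (rule sum.cong) (auto simp: algebra_simps)
  finally show "2 * finner (T f) g = (\<Sum>(x,y)\<in>P. (f x - f y) * (g x - g y))" .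
qed

lemma T_symmetric:
  assumes "finite {x. f x \<noteq> 0}" "finite {x. g x \<noteq> 0}"
  shows "finner (T f) g = finner f (T g)"
proof -
  let ?B = "{x. f x \<noteq> 0} \<union> {x. g x \<noteq> 0}"
  have "2 * finner (T f) g = 2 * finner (T g) f"
    using assms energy(2)[of ?B f g] energy(2)[of ?B g f] by (simp add: mult.commute)
  then show ?thesis using finner_commute[of f "T g"] T_fsupp assms by simp
qed

lemma T_nonneg:
  assumes "finite {x. f x \<noteq> 0}"
  shows "0 \<le> finner (T f) f"
proof -
  have "0 \<le> 2 * finner (T f) f"
    using assms by (subst energy(2)[of "{x. f x \<noteq> 0}"]) (auto intro: sum_nonneg)
  then show ?thesis by simp
qed

text \<open>On every edge (a - b)^2 \<le> 2 a^2 + 2 b^2, and there are at most \<open>k\<close>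
  edges at each vertex: as a form, T is at most 2 k.\<close>

lemma T_bounded:
  assumes "finite {x. f x \<noteq> 0}"
  shows "finner (T f) f \<le> 2 * real k * finner f f"
proof -
  let ?B = "{x. f x \<noteq> 0}"
  define P where "P = {(x, y). adj x y \<and> (x \<in> ?B \<or> y \<in> ?B)}"
  note e = energy[of ?B f f, folded P_def]
  have fP: "finite P" using e(1) assms by auto
  have "2 * finner (T f) f = (\<Sum>(x,y)\<in>P. (f x - f y) * (f x - f y))"
    using e(2) assms by auto
  also have "\<dots> \<le> (\<Sum>(x,y)\<in>P. 2 * (f x)\<^sup>2 + 2 * (f y)\<^sup>2)"
  proof (intro sum_mono, clarify)
    fix x y
    have "0 \<le> (f x + f y)\<^sup>2" by simp
    then show "(f x - f y) * (f x - f y) \<le> 2 * (f x)\<^sup>2 + 2 * (f y)\<^sup>2"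
      by (simp add: power2_eq_square algebra_simps)
  qed
  also have "\<dots> = (\<Sum>(x,y)\<in>P. 2 * (f x)\<^sup>2) + (\<Sum>(x,y)\<in>P. 2 * (f y)\<^sup>2)"
    unfolding sum.distrib[symmetric] by (rule sum.cong) auto
  also have "(\<Sum>(x,y)\<in>P. 2 * (f y)\<^sup>2) = (\<Sum>(x,y)\<in>P. 2 * (f x)\<^sup>2)"
    using adj_sym by (intro sum.reindex_bij_witness[of _ prod.swap prod.swap]) (auto simp: P_def)
  also have "(\<Sum>(x,y)\<in>P. 2 * (f x)\<^sup>2) = (\<Sum>(x,y)\<in>(SIGMA x:?B. {y. adj x y}). 2 * (f x)\<^sup>2)"
    using fP by (intro sum.mono_neutral_right) (auto simp: P_def)
  also have "\<dots> = (\<Sum>x\<in>?B. real (card {y. adj x y}) * (2 * (f x)\<^sup>2))"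
    using assms nbr_fin by (subst sum.Sigma[symmetric]) auto
  also have "\<dots> \<le> (\<Sum>x\<in>?B. real k * (2 * (f x)\<^sup>2))"
    using nbr_card by (intro sum_mono mult_right_mono) auto
  also have "\<dots> = 2 * real k * finner f f"
    by (simp add: finner_def sum_distrib_left power2_eq_square mult_ac)
  finally show ?thesis by simp
qed

section \<open>Vectors q(T) delta and the spectral measure at a vertex\<close>

definition pvec :: "'v \<Rightarrow> real poly \<Rightarrow> 'v \<Rightarrow> real" where
  "pvec x0 q = (\<lambda>x. mlin (\<lambda>i. (T ^^ i) (delta x0) x) q)"

definition moment :: "'v \<Rightarrow> nat \<Rightarrow> real" where
  "moment x0 i = (T ^^ i) (delta x0) x0"

lemma pvec_at: "pvec x0 q x0 = mlin (moment x0) q"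
  by (simp add: pvec_def moment_def[abs_def])

lemma pvec_0: "pvec x0 0 = (\<lambda>x. 0)"
  by (simp add: pvec_def)

lemma pvec_pCons: "pvec x0 (pCons a q) = (\<lambda>x. a * delta x0 x + 1 * T (pvec x0 q) x)"
  by (rule ext) (simp add: pvec_def mlin_pCons T_lin)

lemma pvec_X: "pvec x0 (pCons 0 q) = T (pvec x0 q)"
  by (simp add: pvec_pCons)

lemma delta_fsupp: "finite {x. delta x0 x \<noteq> 0}"
  by (simp add: delta_def)

lemma pvec_fsupp: "finite {x. pvec x0 q x \<noteq> 0}"
proof (induction q)
  case (pCons a q)
  then show ?case
    unfolding pvec_pCons
    by (intro finite_subset[OF _ finite_UnI[OF delta_fsupp[of x0] T_fsupp[OF pCons(2)]]]) auto
qed (simp add: pvec_0)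

text \<open>\<open>pvec x0 p\<close> is p(T) delta, and symmetry of T moves the factors of p one at
  a time to the other side. Through this identity an inequality between quadratic forms of T becomes
  positivity of the moment functional.\<close>

lemma finner_pvec: "finner (pvec x0 p) (pvec x0 q) = mlin (moment x0) (p * q)"
proof (induction p arbitrary: q)
  case 0
  then show ?case by (simp add: pvec_0 finner_def)
next
  case (pCons a p)
  have "finner (pvec x0 (pCons a p)) (pvec x0 q) 
      = a * pvec x0 q x0 + finner (T (pvec x0 p)) (pvec x0 q)"
    unfolding pvec_pCons
    using finner_add_left[OF delta_fsupp T_fsupp[OF pvec_fsupp], where b = 1]
    by (simp add: finner_delta_left)
  also have "finner (T (pvec x0 p)) (pvec x0 q) = finner (pvec x0 p) (pvec x0 (pCons 0 q))"
    by (simp add: T_symmetric pvec_fsupp pvec_X)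
  also have "\<dots> = mlin (moment x0) (p * pCons 0 q)" by (rule pCons.IH)
  also have "a * pvec x0 q x0 + \<dots> = mlin (moment x0) (pCons a p * q)"
    by (simp add: pvec_at mlin_add mlin_smult)
  finally show ?case .
qed

text \<open>The form bounds 0 \<le> T \<le> 2 k give the positivity on X q^2 and (c - X) q^2 which
  the moment problem on [0, c] asks for. The added 1 keeps c positive when \<open>k\<close> is
  0.\<close>

lemma spectral_measure_exists:
  "\<exists>\<mu>. is_spectral_measure_at V adj x0 \<mu> \<and> prob_space \<mu> \<and>
     emeasure \<mu> (- {- (2 * real k + 1)..2 * real k + 1}) = 0"
proof -
  let ?c = "2 * real k + 1"
  have posX: "0 \<le> mlin (moment x0) ([:0, 1:] * (q * q))" for q
  proof -
    have "[:0, 1:] * (q * q) = pCons 0 q * q" by simp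
    then show ?thesis using T_nonneg[OF pvec_fsupp, of x0 q]
      by (simp only: finner_pvec[symmetric] pvec_X)
  qed
  have posY: "0 \<le> mlin (moment x0) ([:?c, -1:] * (q * q))" for q
  proof -
    have "[:?c, -1:] * (q * q) = smult ?c (q * q) + smult (- 1) (pCons 0 q * q)" by simp
    then have "mlin (moment x0) ([:?c, -1:] * (q * q)) = ?c * finner (pvec x0 q) (pvec x0 q)
        - finner (T (pvec x0 q)) (pvec x0 q)"
      by (simp only: finner_pvec[symmetric] pvec_X mlin_add mlin_smult)
    then show ?thesis
      using T_bounded[OF pvec_fsupp, of x0 q] finner_self_nonneg[of "pvec x0 q"]
      by (simp add: algebra_simps)
  qed
  have pos: "0 \<le> mlin (moment x0) (q * q)" for q
    using finner_self_nonneg by (simp only: finner_pvec[symmetric])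
  obtain \<mu> where \<mu>: "real_distribution \<mu>" "AE t in \<mu>. t \<in> {0..?c}"
    "\<And>n. integrable \<mu> (\<lambda>t. t ^ n)" "\<And>n. (\<integral>t. t ^ n \<partial>\<mu>) = moment x0 n"
    using hausdorff_moment_problem[of ?c "moment x0"] posX posY pos
    by (auto simp: moment_def delta_def)
  interpret real_distribution \<mu> by fact
  have 1: "AE t in \<mu>. t \<in> {-?c..?c}" using \<mu>(2) by eventually_elim auto
  have 2: "emeasure \<mu> (- {-?c..?c}) = 0"
    using 1 by (subst (asm) AE_iff_measurable[of "- {-?c..?c}"]) auto
  have "is_spectral_measure_at V adj x0 \<mu>"
    unfolding is_spectral_measure_at_def
    using exI[of "\<lambda>R. emeasure \<mu> (- {-R..R}) = 0", OF 2] \<mu>(3,4)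
    by (auto simp: moment_def delta_def finite_measure_axioms)
  then show ?thesis using 2 prob_space_axioms by blast
qed

lemma spectral_moments:
  assumes "is_spectral_measure_at V adj x0 \<mu>"
  shows "sets \<mu> = sets borel" "finite_measure \<mu>" "integrable \<mu> (\<lambda>t. t ^ n)"
    "(\<integral>t. t ^ n \<partial>\<mu>) = moment x0 n"
  using assms by (auto simp: is_spectral_measure_at_def moment_def delta_def)

lemma spectral_support:
  assumes "is_spectral_measure_at V adj x0 \<mu>"
  obtains R where "R > 0" "\<And>R'. R' \<ge> R \<Longrightarrow> emeasure \<mu> (- {-R'..R'}) = 0"
proof -
  obtain R where R: "emeasure \<mu> (- {-R..R}) = 0"
    using assms by (auto simp: is_spectral_measure_at_def)
  have "emeasure \<mu> (- {-R'..R'}) = 0" if "R' \<ge> max 1 R" for R'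
  proof -
    have "emeasure \<mu> (- {-R'..R'}) \<le> emeasure \<mu> (- {-R..R})"
      using that spectral_moments(1)[OF assms] by (intro emeasure_mono) auto
    then show ?thesis using R by simp
  qed
  then show thesis by (intro that[of "max 1 R"]) auto
qed

lemma mlin_tendsto_measure_le:
  assumes \<mu>: "is_spectral_measure_at V adj x0 \<mu>" and R: "emeasure \<mu> (- {-R..R}) = 0"
    and q: "\<And>j t. \<bar>t\<bar> \<le> R \<Longrightarrow> \<bar>poly (q j) t\<bar> \<le> B"
      "\<And>t. \<bar>t\<bar> \<le> R \<Longrightarrow> (\<lambda>j. poly (q j) t) \<longlonglongrightarrow> indicator {..E} t"
  shows "(\<lambda>j. mlin (moment x0) (q j)) \<longlonglongrightarrow> measure \<mu> {..E}"
proof -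
  interpret finite_measure \<mu> by (rule spectral_moments[OF \<mu>])
  have "(\<integral>t. indicator {..E} t \<partial>\<mu>) = measure \<mu> {..E}"
    using spectral_moments(1)[OF \<mu>] by (simp add: sets_eq_imp_space_eq)
  then show ?thesis
    using mlin_tendsto_integral(2)[OF spectral_moments(1,2)[OF \<mu>] R spectral_moments(3,4)[OF \<mu>] q]
    by simp
qed

text \<open>The definite description is justified by uniqueness: two candidates have the same
  moments and a common bounding interval, so a single sequence of polynomials computes the mass of
  the half-line for both.\<close>

lemma spec_proj_diag_eq:
  assumes \<mu>: "is_spectral_measure_at V adj x0 \<mu>" and "x0 \<in> V"
  shows "spec_proj_diag V adj x0 E = measure \<mu> {..E}"
proof -
  have "(THE r. \<exists>\<mu>. is_spectral_measure_at V adj x0 \<mu> \<and> r = measure \<mu> {..E}) = measure \<mu> {..E}"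
  proof (rule the_equality)
    fix r assume "\<exists>\<nu>. is_spectral_measure_at V adj x0 \<nu> \<and> r = measure \<nu> {..E}"
    then obtain \<nu> where \<nu>: "is_spectral_measure_at V adj x0 \<nu>" and r: "r = measure \<nu> {..E}" by blast
    obtain R1 where R1: "R1 > 0" "\<And>R'. R' \<ge> R1 \<Longrightarrow> emeasure \<mu> (- {-R'..R'}) = 0"
      using spectral_support[OF \<mu>] by metis
    obtain R2 where R2: "R2 > 0" "\<And>R'. R' \<ge> R2 \<Longrightarrow> emeasure \<nu> (- {-R'..R'}) = 0"
      using spectral_support[OF \<nu>] by metis
    obtain q where q: "\<And>j t. \<bar>t\<bar> \<le> max R1 R2 \<Longrightarrow> \<bar>poly (q j) t\<bar> \<le> 2"
      "\<And>t. \<bar>t\<bar> \<le> max R1 R2 \<Longrightarrow> (\<lambda>j. poly (q j) t) \<longlonglongrightarrow> indicator {..E} t"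
      by (rule poly_approx_indicator[of "max R1 R2" E]) blast
    have "(\<lambda>j. mlin (moment x0) (q j)) \<longlonglongrightarrow> measure \<mu> {..E}"
      by (rule mlin_tendsto_measure_le[OF \<mu> R1(2) q]) auto
    moreover have "(\<lambda>j. mlin (moment x0) (q j)) \<longlonglongrightarrow> measure \<nu> {..E}"
      by (rule mlin_tendsto_measure_le[OF \<nu> R2(2) q]) auto
    ultimately show "r = measure \<mu> {..E}"
      unfolding r by (rule LIMSEQ_unique[symmetric])
  qed (use \<mu> in blast)
  then show ?thesis using assms by (simp add: spec_proj_diag_def)
qed

text \<open>The interval depends on \<open>k\<close> only and not on the graph, so the polynomials
  can be fixed before the configuration is drawn. This is what makes the random spectral quantity
  measurable.\<close>

lemma spec_proj_diag_tendsto: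
  assumes "x0 \<in> V"
    and q: "\<And>j t. \<bar>t\<bar> \<le> 2 * real k + 1 \<Longrightarrow> \<bar>poly (q j) t\<bar> \<le> B"
      "\<And>t. \<bar>t\<bar> \<le> 2 * real k + 1 \<Longrightarrow> (\<lambda>j. poly (q j) t) \<longlonglongrightarrow> indicator {..E} t"
  shows "(\<lambda>j. mlin (moment x0) (q j)) \<longlonglongrightarrow> spec_proj_diag V adj x0 E"
proof -
  obtain \<mu> where \<mu>: "is_spectral_measure_at V adj x0 \<mu>"
    "emeasure \<mu> (- {- (2 * real k + 1)..2 * real k + 1}) = 0"
    using spectral_measure_exists by blast
  show ?thesis
    unfolding spec_proj_diag_eq[OF \<mu>(1) assms(1)]
    by (rule mlin_tendsto_measure_le[OF \<mu> q])
qed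

lemma spec_proj_diag_bounds: "0 \<le> spec_proj_diag V adj x0 E" "spec_proj_diag V adj x0 E \<le> 1"
proof -
  have "0 \<le> spec_proj_diag V adj x0 E \<and> spec_proj_diag V adj x0 E \<le> 1"
  proof (cases "x0 \<in> V")
    case True
    obtain \<mu> where \<mu>: "is_spectral_measure_at V adj x0 \<mu>" "prob_space \<mu>"
      using spectral_measure_exists by blast
    then show ?thesis
      using spec_proj_diag_eq[OF \<mu>(1) True] prob_space.prob_le_1[OF \<mu>(2)] by simp
  qed (simp add: spec_proj_diag_def)
  then show "0 \<le> spec_proj_diag V adj x0 E" "spec_proj_diag V adj x0 E \<le> 1" by auto
qed

lemma spec_proj_diag_diff:
  assumes \<mu>: "is_spectral_measure_at V adj x0 \<mu>" and "x0 \<in> V" "0 \<le> E"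
  shows "spec_proj_diag V adj x0 E - spec_proj_diag V adj x0 0 = measure \<mu> {0<..E}"
proof -
  interpret finite_measure \<mu> by (rule spectral_moments[OF \<mu>])
  have "{..E} = {..0} \<union> {0<..E}" using assms(3) by auto
  then have "measure \<mu> {..E} = measure \<mu> {..0} + measure \<mu> {0<..E}"
    using spectral_moments(1)[OF \<mu>] by (metis Int_emptyI atMost_borel finite_measure_Union
        greaterThanAtMost_borel greaterThanAtMost_iff atMost_iff not_le)
  then show ?thesis by (simp add: spec_proj_diag_eq[OF \<mu> assms(2)])
qed

lemma finner_eigenvector_pvec:
  assumes f: "finite {x. f x \<noteq> 0}" and ev: "\<And>x. T f x = l * f x"
  shows "finner f (pvec x0 q) = poly q l * f x0"
proof (induction q)
  case 0
  then show ?case by (simp add: pvec_0 finner_def)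
next
  case (pCons a q)
  have "finner f (T (pvec x0 q)) = finner (T f) (pvec x0 q)"
    using f by (simp add: T_symmetric pvec_fsupp)
  also have "T f = (\<lambda>x. l * f x + 0 * f x)" using ev by auto
  also have "finner \<dots> (pvec x0 q) = l * finner f (pvec x0 q)"
    using finner_add_left[OF f f, of l 0 "pvec x0 q"] by simp
  finally show ?case
    unfolding pvec_pCons finner_add_right using pCons f by (simp add: finner_delta_right algebra_simps)
qed

text \<open>If q(l) = 1, then f(x0) is the inner product of f with q(T) delta, and Cauchy-Schwarz
  bounds its square by the squared norm of f times the integral of q^2. For q concentrating at l
  this integral tends to the mass of the atom.\<close>

lemma eigenvector_atom:
  assumes \<mu>: "is_spectral_measure_at V adj x0 \<mu>"
    and f: "finite {x. f x \<noteq> 0}" and ev: "\<And>x. T f x = l * f x"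
  shows "(f x0)\<^sup>2 \<le> finner f f * measure \<mu> {l}"
proof -
  obtain R where R: "R > 0" "emeasure \<mu> (- {-R..R}) = 0"
    using spectral_support[OF \<mu>] by (metis order_refl)
  \<comment> \<open>Large enough that |t - l| < S on the support, so that the base of the power lies
    in [0, 1] there and is 1 only at t = l.\<close>
  define S where "S = \<bar>l\<bar> + R + 1"
  have S: "S > 0" using R by (simp add: S_def)
  define q where "q j = [:1 - l\<^sup>2 / S\<^sup>2, 2 * l / S\<^sup>2, - 1 / S\<^sup>2:] ^ j" for j :: nat
  have pq: "poly (q j) t = (1 - ((t - l) / S)\<^sup>2) ^ j" for j t
  proof -
    have "poly [:1 - l\<^sup>2 / S\<^sup>2, 2 * l / S\<^sup>2, - 1 / S\<^sup>2:] t = 1 - ((t - l) / S)\<^sup>2"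
      using S by (simp add: field_simps power2_eq_square)
    then show ?thesis by (simp only: q_def poly_power)
  qed
  have u: "0 \<le> 1 - ((t - l) / S)\<^sup>2 \<and> 1 - ((t - l) / S)\<^sup>2 \<le> 1" if "\<bar>t\<bar> \<le> R" for t
  proof -
    have "\<bar>(t - l) / S\<bar> \<le> 1" using that S by (simp add: S_def abs_if field_simps split: if_splits)
    then show ?thesis by (simp add: abs_square_le_1)
  qed
  have bound: "\<bar>poly (q j * q j) t\<bar> \<le> 1" if "\<bar>t\<bar> \<le> R" for j t
    using u[OF that] by (simp add: pq abs_mult power_le_one mult_le_one)
  have lim: "(\<lambda>j. poly (q j * q j) t) \<longlonglongrightarrow> indicator {l} t" if "\<bar>t\<bar> \<le> R" for t
  proof (cases "t = l")
    case False
    then have "((t - l) / S)\<^sup>2 > 0" using S by simp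
    then have "(\<lambda>j. (1 - ((t - l) / S)\<^sup>2) ^ j) \<longlonglongrightarrow> 0"
      using u[OF that] by (intro LIMSEQ_realpow_zero) auto
    from tendsto_mult[OF this this] show ?thesis using False by (simp add: pq)
  qed (simp add: pq)
  interpret finite_measure \<mu> by (rule spectral_moments[OF \<mu>])
  have "(\<lambda>j. mlin (moment x0) (q j * q j)) \<longlonglongrightarrow> (\<integral>t. indicator {l} t \<partial>\<mu>)"
    by (rule mlin_tendsto_integral(2)[OF spectral_moments(1,2)[OF \<mu>] R(2) spectral_moments(3,4)[OF \<mu>] bound lim])
       auto
  then have "(\<lambda>j. finner f f * mlin (moment x0) (q j * q j)) \<longlonglongrightarrow> finner f f * measure \<mu> {l}"
    using spectral_moments(1)[OF \<mu>] by (intro tendsto_mult_left) (simp add: sets_eq_imp_space_eq)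
  moreover have "(f x0)\<^sup>2 \<le> finner f f * mlin (moment x0) (q j * q j)" for j
  proof -
    have "finner f (pvec x0 (q j)) = f x0"
      by (simp add: finner_eigenvector_pvec[OF f ev] pq)
    then show ?thesis
      using finner_Cauchy_Schwarz[OF f pvec_fsupp, of x0 "q j"] by (simp add: finner_pvec)
  qed
  ultimately show ?thesis by (intro LIMSEQ_le_const) auto
qed

section \<open>Spectral gap of a finite component\<close>

lemma rtrancl_path_telescope:
  fixes g :: "'v \<Rightarrow> real"
  assumes "rtrancl_path adj x xs y" "distinct (x # xs)"
  shows "\<bar>g x - g y\<bar> \<le> (\<Sum>(u,v)\<in>set (zip (x # xs) xs). \<bar>g u - g v\<bar>)"
  using assms
proof (induction rule: rtrancl_path.induct)
  case (step x y ys z)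
  have "(x, y) \<notin> set (zip (y # ys) ys)"
    using step.prems by (auto dest: set_zip_leftD)
  then show ?case using step by simp
qed simp

lemma rtrancl_path_zip_adj:
  assumes "rtrancl_path adj x xs y" "(u, v) \<in> set (zip (x # xs) xs)"
  shows "adj u v"
  using assms by (induction rule: rtrancl_path.induct) auto

lemma rtrancl_path_closed:
  assumes "rtrancl_path adj x xs y" "x \<in> C" "\<And>u v. u \<in> C \<Longrightarrow> adj u v \<Longrightarrow> v \<in> C"
  shows "set xs \<subseteq> C"
  using assms by (induction rule: rtrancl_path.induct) auto

context
  fixes C :: "'v set"
  assumes Cfin: "finite C" and Cclosed: "\<And>u v. u \<in> C \<Longrightarrow> adj u v \<Longrightarrow> v \<in> C"
    and Cconn: "\<And>u v. u \<in> C \<Longrightarrow> v \<in> C \<Longrightarrow> adj\<^sup>*\<^sup>* u v"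
begin

text \<open>A simple path from x to y has fewer than |C| steps and uses every ordered edge at most
  once. Telescoping and Cauchy-Schwarz bound the squared difference by |C| times the energy along
  the path, which is part of the sum over all ordered pairs, twice the form.\<close>

lemma oscillation_le_energy:
  assumes g: "{x. g x \<noteq> 0} \<subseteq> C" and xy: "x \<in> C" "y \<in> C"
  shows "(g x - g y)\<^sup>2 \<le> real (card C) * (2 * finner (T g) g)"
proof -
  define P where "P = {(x, y). adj x y \<and> (x \<in> C \<or> y \<in> C)}"
  note e = energy[OF Cfin g g, folded P_def]
  obtain xs where xs: "rtrancl_path adj x xs y" "distinct (x # xs)"
    using Cconn[OF xy] rtrancl_path_distinct by (metis rtranclp_eq_rtrancl_path)
  define Z where "Z = set (zip (x # xs) xs)"
  have sub: "set (x # xs) \<subseteq> C" using rtrancl_path_closed[OF xs(1) xy(1)] Cclosed xy by auto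
  have ZP: "Z \<subseteq> P"
  proof
    fix z assume z: "z \<in> Z"
    then obtain u v where uv: "z = (u, v)" "(u, v) \<in> set (zip (x # xs) xs)"
      unfolding Z_def by (metis surj_pair)
    then show "z \<in> P"
      using rtrancl_path_zip_adj[OF xs(1) uv(2)] sub by (auto simp: P_def dest: set_zip_rightD)
  qed
  have "card Z \<le> length (zip (x # xs) xs)" unfolding Z_def by (rule card_length)
  also have "\<dots> \<le> length (x # xs)" by simp
  also have "\<dots> = card (set (x # xs))" using xs(2) by (simp add: distinct_card)
  also have "\<dots> \<le> card C" using sub Cfin by (intro card_mono)
  finally have cZ: "card Z \<le> card C" .
  have "(g x - g y)\<^sup>2 = \<bar>g x - g y\<bar>\<^sup>2" by simp
  also have "\<dots> \<le> (\<Sum>(u,v)\<in>Z. \<bar>g u - g v\<bar>)\<^sup>2"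
    using rtrancl_path_telescope[OF xs, of g] by (intro power_mono) (auto simp: Z_def)
  also have "\<dots> = (\<Sum>z\<in>Z. 1 * (case z of (u,v) \<Rightarrow> \<bar>g u - g v\<bar>))\<^sup>2" by simp
  also have "\<dots> \<le> (\<Sum>z\<in>Z. 1\<^sup>2) * (\<Sum>z\<in>Z. (case z of (u,v) \<Rightarrow> \<bar>g u - g v\<bar>)\<^sup>2)"
    by (rule Cauchy_Schwarz_ineq_sum)
  also have "\<dots> = real (card Z) * (\<Sum>(u,v)\<in>Z. (g u - g v) * (g u - g v))"
    by (simp add: case_prod_unfold power2_eq_square flip: abs_mult)
  also have "\<dots> \<le> real (card C) * (\<Sum>(u,v)\<in>P. (g u - g v) * (g u - g v))"
    using cZ ZP e(1) by (intro mult_mono sum_mono2 sum_nonneg) auto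
  finally show ?thesis using e(2) by simp
qed

text \<open>A Poincare inequality in the operator form T \<le> n T^2 with n = 2 |C|^2, which
  excludes spectrum in (0, 1/n) without a projection away from the constants. Since T g has sum zero
  over C, g may be shifted by the constant g(a) in the pairing that defines e; Cauchy-Schwarz and
  the oscillation bound then give e^2 \<le> n e times the squared norm of T g.\<close>

lemma poincare:
  assumes g: "{x. g x \<noteq> 0} \<subseteq> C"
  shows "finner (T g) g \<le> 2 * (real (card C))\<^sup>2 * finner (T g) (T g)"
proof (cases "C = {}")
  case True
  then have "finner (T g) g = 0" using g by (auto simp: finner_def)
  then show ?thesis using finner_self_nonneg[of "T g"] by simp
next
  case False
  then obtain a where a: "a \<in> C" by blast
  define e where "e = finner (T g) g"
  have gf: "finite {x. g x \<noteq> 0}" using g Cfin finite_subset by blast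
  have Tgf: "finite {x. T g x \<noteq> 0}" by (rule T_fsupp[OF gf])
  have e0: "e \<ge> 0" unfolding e_def by (rule T_nonneg[OF gf])
  have Tg: "T g x = 0" if "x \<notin> C" for x
  proof -
    have "g x = 0" "\<And>y. adj x y \<Longrightarrow> g y = 0" using that g Cclosed adj_sym by blast+
    then show ?thesis by (simp add: T_eq)
  qed
  \<comment> \<open>The indicator of C is annihilated by T, as C is closed under adjacency; by
    symmetry T g then sums to zero over C.\<close>
  define h where "h x = (if x \<in> C then 1 else 0 :: real)" for x
  have hf: "finite {x. h x \<noteq> 0}" by (simp add: h_def Cfin)
  have "T h x = 0" for x
  proof -
    have "h x = h y" if "adj x y" for y
      using that Cclosed adj_sym by (auto simp: h_def)
    then show ?thesis by (auto simp: T_eq intro!: sum.neutral)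
  qed
  then have "finner g (T h) = 0" by (simp add: finner_def)
  then have "finner (T g) h = 0" by (simp add: T_symmetric gf hf)
  then have s0: "(\<Sum>x\<in>C. T g x) = 0"
    using Tg Tgf Cfin by (subst (asm) finner_eq[of _ C]) (auto simp: h_def)
  have "e = (\<Sum>x\<in>C. T g x * g x)"
    unfolding e_def using Tg Tgf Cfin by (subst finner_eq[of _ C]) auto
  also have "\<dots> = (\<Sum>x\<in>C. T g x * (g x - g a))"
    using s0 by (simp add: right_diff_distrib sum_subtractf flip: sum_distrib_right)
  finally have "e\<^sup>2 = (\<Sum>x\<in>C. T g x * (g x - g a))\<^sup>2" by simp
  also have "\<dots> \<le> (\<Sum>x\<in>C. (T g x)\<^sup>2) * (\<Sum>x\<in>C. (g x - g a)\<^sup>2)"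
    by (rule Cauchy_Schwarz_ineq_sum)
  also have "\<dots> \<le> (\<Sum>x\<in>C. (T g x)\<^sup>2) * (\<Sum>x\<in>C. real (card C) * (2 * e))"
    unfolding e_def
    using oscillation_le_energy[OF g _ a] by (intro mult_left_mono sum_mono sum_nonneg) auto
  also have "(\<Sum>x\<in>C. (T g x)\<^sup>2) = finner (T g) (T g)"
    using Tg Tgf Cfin by (subst finner_eq[of _ C]) (auto simp: power2_eq_square)
  finally have "e * e \<le> (2 * (real (card C))\<^sup>2 * finner (T g) (T g)) * e"
    by (simp add: power2_eq_square mult_ac)
  then show ?thesis
    using e0 finner_self_nonneg[of "T g"] unfolding e_def
    by (cases "finner (T g) g = 0") (auto intro!: mult_nonneg_nonneg)
qed

lemma pvec_support_closed:
  assumes "x0 \<in> C"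
  shows "{x. pvec x0 q x \<noteq> 0} \<subseteq> C"
proof (induction q)
  case (pCons a q)
  have "T (pvec x0 q) x = 0" if "x \<notin> C" for x
  proof -
    have "pvec x0 q x = 0" "\<And>y. adj x y \<Longrightarrow> pvec x0 q y = 0" using that pCons Cclosed adj_sym by blast+
    then show ?thesis by (simp add: T_eq)
  qed
  then show ?case using assms by (auto simp: pvec_pCons delta_def split: if_splits)
qed (simp add: pvec_0)

text \<open>By the Poincare inequality the moment functional is nonnegative on (n X^2 - X) q^2. When
  q tends to the indicator of (0, E], the integral of n t^2 - t over (0, E] comes out nonnegative,
  although n t < 1 makes the integrand negative there; so this interval has no mass.\<close>

lemma spectral_gap:
  assumes \<mu>: "is_spectral_measure_at V adj x0 \<mu>" and x0: "x0 \<in> C"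
    and E: "0 \<le> E" "2 * (real (card C))\<^sup>2 * E < 1"
  shows "measure \<mu> {0<..E} = 0"
proof -
  define n where "n = 2 * (real (card C))\<^sup>2"
  obtain R where R: "R > 0" "emeasure \<mu> (- {-R..R}) = 0"
    using spectral_support[OF \<mu>] by (metis order_refl)
  obtain p where p: "\<And>j t. \<bar>t\<bar> \<le> R \<Longrightarrow> \<bar>poly (p j) t\<bar> \<le> 2"
      "\<And>t. \<bar>t\<bar> \<le> R \<Longrightarrow> (\<lambda>j. poly (p j) t) \<longlonglongrightarrow> indicator {..E} t"
    by (rule poly_approx_indicator[of R E]) blast
  obtain p' where p': "\<And>j t. \<bar>t\<bar> \<le> R \<Longrightarrow> \<bar>poly (p' j) t\<bar> \<le> 2"
      "\<And>t. \<bar>t\<bar> \<le> R \<Longrightarrow> (\<lambda>j. poly (p' j) t) \<longlonglongrightarrow> indicator {..0} t"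
    by (rule poly_approx_indicator[of R 0]) blast
  define q where "q j = p j - p' j" for j
  define r where "r = [:0, -1, n:]"
  have pr: "poly r t = n * t\<^sup>2 - t" for t
    by (simp add: r_def power2_eq_square algebra_simps)
  have qb: "\<bar>poly (q j) t\<bar> \<le> 4" if "\<bar>t\<bar> \<le> R" for j t
    using p(1)[OF that, of j] p'(1)[OF that, of j] by (simp add: q_def)
  have ql: "(\<lambda>j. poly (q j) t) \<longlonglongrightarrow> indicator {0<..E} t" if "\<bar>t\<bar> \<le> R" for t
  proof -
    have "(\<lambda>j. poly (p j) t - poly (p' j) t) \<longlonglongrightarrow> indicator {..E} t - indicator {..0} t"
      by (intro tendsto_diff p p' that)
    moreover have "indicator {..E} t - indicator {..0} t = (indicator {0<..E} t :: real)"
      using E by (auto simp: indicator_def)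
    ultimately show ?thesis by (simp add: q_def)
  qed
  have n0: "n \<ge> 0" by (simp add: n_def)
  have bound: "\<bar>poly (r * (q j * q j)) t\<bar> \<le> (n * R\<^sup>2 + R) * 16" if "\<bar>t\<bar> \<le> R" for j t
  proof -
    have "t\<^sup>2 \<le> R\<^sup>2" using power_mono[of "\<bar>t\<bar>" R 2] that by simp
    then have "n * t\<^sup>2 \<le> n * R\<^sup>2" using n0 by (rule mult_left_mono)
    then have "\<bar>poly r t\<bar> \<le> n * R\<^sup>2 + R"
      unfolding pr using that n0 by (intro order_trans[OF abs_triangle_ineq4] add_mono) auto
    moreover have "\<bar>poly (q j) t * poly (q j) t\<bar> \<le> 4 * 4"
      unfolding abs_mult using qb[OF that, of j] by (intro mult_mono) auto
    ultimately have "\<bar>poly r t\<bar> * \<bar>poly (q j) t * poly (q j) t\<bar> \<le> (n * R\<^sup>2 + R) * (4 * 4)"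
      using n0 R by (intro mult_mono) auto
    then show ?thesis by (simp add: abs_mult)
  qed
  define f where "f t = poly r t * (indicator {0<..E} t * indicator {0<..E} t)" for t
  have lim: "(\<lambda>j. poly (r * (q j * q j)) t) \<longlonglongrightarrow> f t" if "\<bar>t\<bar> \<le> R" for t
    unfolding poly_mult f_def by (intro tendsto_intros ql that)
  have fm: "f \<in> borel_measurable borel" unfolding f_def pr by measurable
  note L = mlin_tendsto_integral[OF spectral_moments(1,2)[OF \<mu>] R(2) spectral_moments(3,4)[OF \<mu>] bound lim fm]
  have "0 \<le> mlin (moment x0) (r * (q j * q j))" for j
  proof -
    have "r * (q j * q j) = smult n (pCons 0 (q j) * pCons 0 (q j)) + smult (-1) (pCons 0 (q j) * q j)"
      by (simp add: r_def)
    then have "mlin (moment x0) (r * (q j * q j)) = n * finner (T (pvec x0 (q j))) (T (pvec x0 (q j)))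
        - finner (T (pvec x0 (q j))) (pvec x0 (q j))"
      by (simp only: mlin_add mlin_smult finner_pvec[symmetric] pvec_X)
    then show ?thesis using poincare[OF pvec_support_closed[OF x0], of "q j"] by (simp add: n_def)
  qed
  then have pos: "0 \<le> (\<integral>t. f t \<partial>\<mu>)" using L(2) by (intro LIMSEQ_le_const) auto
  have neg: "f t < 0" if "t \<in> {0<..E}" for t
  proof -
    have "n * t \<le> n * E" using that n0 by (intro mult_left_mono) auto
    then have "n * t < 1" using E by (simp add: n_def)
    then have "t * (n * t - 1) < 0" using that by (simp add: mult_pos_neg)
    then show ?thesis using that by (simp add: f_def pr power2_eq_square algebra_simps)
  qed
  have zero: "f t = 0" if "t \<notin> {0<..E}" for t using that by (simp add: f_def)
  have "f t \<le> 0" for t using neg[of t] zero[of t] by force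
  then have "0 \<le> (\<integral>t. - f t \<partial>\<mu>)" by (intro integral_nonneg_AE) auto
  with pos have "(\<integral>t. - f t \<partial>\<mu>) = 0" by simp
  then have "AE t in \<mu>. - f t = 0"
    using L(1) \<open>\<And>t. f t \<le> 0\<close> by (subst (asm) integral_nonneg_eq_0_iff_AE) auto
  then have "AE t in \<mu>. t \<notin> {0<..E}"
    by eventually_elim (use neg in force)
  then have "emeasure \<mu> {0<..E} = 0"
    using spectral_moments(1)[OF \<mu>]
    by (subst (asm) AE_iff_measurable[of "{0<..E}"]) (auto simp: sets_eq_imp_space_eq)
  then show ?thesis by (simp add: measure_def)
qed

end

text \<open>With h = pi / n, the half-integer phase produces reflecting ends, c(-1) = c(0) and c(n)
  = c(n - 1), so the cosine recurrence also holds at the end vertices, where one neighbour is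
  missing. The eigenvalue 2 - 2 cos h is at most h^2 and the squared norm at most n. Since n \<ge> 2
  makes cos h nonnegative, the squared value cos^2 (h/2) at \<open>w 0\<close> is at least
  1/2.\<close>

lemma path_spectrum:
  fixes w :: "nat \<Rightarrow> 'v"
  assumes n: "n \<ge> 2" and inj: "inj_on w {..<n}"
    and V: "w 0 \<in> V"
    and nb: "\<And>i. i < n \<Longrightarrow> {y. adj (w i) y} = w ` {j. j < n \<and> (j = Suc i \<or> i = Suc j)}"
    and E: "(pi / real n)\<^sup>2 \<le> E"
  shows "1 / (2 * real n) \<le> spec_proj_diag V adj (w 0) E - spec_proj_diag V adj (w 0) 0"
proof -
  define h where "h = pi / real n"
  have h: "0 < h" "h \<le> pi / 2" "real n * h = pi"
    using n divide_left_mono[of 2 "real n" pi] by (auto simp: h_def)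
  define c where "c r = cos ((r + 1/2) * h)" for r :: real
  define l where "l = 2 - 2 * cos h"
  define f where "f x = (if x \<in> w ` {..<n} then c (real (the_inv_into {..<n} w x)) else 0)" for x
  have fw: "f (w i) = c (real i)" if "i < n" for i
    using that by (simp add: f_def the_inv_into_f_f[OF inj])
  have crec: "2 * c r - c (r - 1) - c (r + 1) = l * c r" for r
  proof -
    have rec: "2 * cos a - cos (a - h) - cos (a + h) = (2 - 2 * cos h) * cos a" for a
      by (simp add: cos_add cos_diff left_diff_distrib)
    have sh: "(r - 1 + 1/2) * h = (r + 1/2) * h - h" "(r + 1 + 1/2) * h = (r + 1/2) * h + h"
      by (simp_all add: distrib_right left_diff_distrib)
    show ?thesis unfolding l_def c_def sh by (rule rec)
  qed
  have c0: "c (-1) = c 0" by (simp add: c_def)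
  have cn: "c (real n) = c (real n - 1)"
  proof -
    have "(real n + 1/2) * h = pi + h / 2" "(real n - 1 + 1/2) * h = pi - h / 2"
      using h(3) by (simp_all add: algebra_simps)
    then show ?thesis by (simp add: c_def cos_add cos_diff)
  qed
  have Tw: "T f (w i) = l * f (w i)" if i: "i < n" for i
  proof -
    let ?J = "{j. j < n \<and> (j = Suc i \<or> i = Suc j)}"
    have "inj_on w ?J" by (rule inj_on_subset[OF inj]) auto
    then have "T f (w i) = (\<Sum>j\<in>?J. f (w i) - f (w j))"
      unfolding T_eq nb[OF i] by (simp add: sum.reindex)
    also have "\<dots> = (\<Sum>j\<in>?J. c (real i) - c (real j))"
      using i by (intro sum.cong) (auto simp: fw)
    also have "\<dots> = 2 * c (real i) - c (real i - 1) - c (real i + 1)"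
    proof -
      consider "i = 0" | "i > 0" "Suc i < n" | "i > 0" "Suc i = n" using i by linarith
      then show ?thesis
      proof cases
        case 1
        then have "?J = {1}" using n by auto
        then show ?thesis using 1 c0 by simp
      next
        case 2
        then have "?J = {i - 1, Suc i}" by auto
        then show ?thesis using 2 by (simp add: of_nat_diff add.commute)
      next
        case 3
        then have "?J = {i - 1}" by auto
        moreover have "c (real i + 1) = c (real i)"
        proof -
          have "real n = real i + 1" using 3 by linarith
          then show ?thesis using cn by simp
        qed
        ultimately show ?thesis using 3 by (simp add: of_nat_diff)
      qed
    qed
    also have "\<dots> = l * f (w i)" using i by (simp add: crec fw)
    finally show ?thesis .
  qed
  have ev: "T f x = l * f x" for x
  proof (cases "x \<in> w ` {..<n}")
    case False
    have "f y = 0" if "adj x y" for y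
    proof (rule ccontr)
      assume "f y \<noteq> 0"
      then obtain i where "y = w i" "i < n" by (auto simp: f_def split: if_splits)
      then have "x \<in> w ` {..<n}" using nb[of i] adj_sym[OF that] by auto
      then show False using False by simp
    qed
    then show ?thesis using False by (simp add: T_eq f_def)
  qed (use Tw in auto)
  have sub: "{x. f x \<noteq> 0} \<subseteq> w ` {..<n}" by (auto simp: f_def split: if_splits)
  have ff: "finite {x. f x \<noteq> 0}" by (rule finite_subset[OF sub]) simp
  have "finner f f = (\<Sum>x\<in>w ` {..<n}. f x * f x)"
    using sub by (intro finner_eq[OF ff]) auto
  also have "\<dots> = (\<Sum>i<n. f (w i) * f (w i))" using inj by (simp add: sum.reindex)
  also have "\<dots> \<le> (\<Sum>i<n. 1)"
  proof (rule sum_mono)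
    fix i assume "i \<in> {..<n}"
    then show "f (w i) * f (w i) \<le> 1"
      by (simp add: fw c_def abs_square_le_1 flip: power2_eq_square)
  qed
  finally have ipf: "finner f f \<le> real n" by simp
  have fw0: "(f (w 0))\<^sup>2 \<ge> 1 / 2"
  proof -
    have "cos h \<ge> 0" using h by (intro cos_ge_zero) auto
    moreover have "cos h = 2 * (cos (h / 2))\<^sup>2 - 1" using cos_double_cos[of "h / 2"] by simp
    ultimately show ?thesis using n by (simp add: fw c_def)
  qed
  have l: "0 < l" "l \<le> E"
  proof -
    have "cos h < cos 0" using h by (intro cos_monotone_0_pi) auto
    then show "0 < l" by (simp add: l_def)
    have "l = 4 * (sin (h / 2))\<^sup>2" using cos_double_sin[of "h / 2"] by (simp add: l_def)
    also have "\<dots> \<le> 4 * (h / 2)\<^sup>2"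
      using abs_sin_x_le_abs_x[of "h / 2"] by (simp only: abs_le_square_iff)
    also have "\<dots> \<le> E" using E by (simp add: h_def power_divide)
    finally show "l \<le> E" .
  qed
  obtain \<mu> where \<mu>: "is_spectral_measure_at V adj (w 0) \<mu>" using spectral_measure_exists by blast
  interpret finite_measure \<mu> by (rule spectral_moments[OF \<mu>])
  have "1 / 2 \<le> finner f f * measure \<mu> {l}"
    using eigenvector_atom[OF \<mu> ff ev] fw0 by linarith
  also have "\<dots> \<le> real n * measure \<mu> {l}" by (rule mult_right_mono[OF ipf]) simp
  also have "\<dots> \<le> real n * measure \<mu> {0<..E}"
    using l spectral_moments(1)[OF \<mu>] by (intro mult_left_mono finite_measure_mono) auto
  finally have "1 / (2 * real n) \<le> measure \<mu> {0<..E}" using n by (simp add: field_simps)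
  also have "\<dots> = spec_proj_diag V adj (w 0) E - spec_proj_diag V adj (w 0) 0"
    using l by (intro spec_proj_diag_diff[OF \<mu> V, symmetric]) linarith
  finally show ?thesis .
qed

lemma spec_proj_diag_diff_le:
  assumes "0 \<le> E" shows "spec_proj_diag V adj x0 0 \<le> spec_proj_diag V adj x0 E"
proof (cases "x0 \<in> V")
  case True
  obtain \<mu> where "is_spectral_measure_at V adj x0 \<mu>" using spectral_measure_exists by blast
  then show ?thesis using spec_proj_diag_diff[OF _ True assms] measure_nonneg[of \<mu> "{0<..E}"] by smt
qed (simp add: spec_proj_diag_def)

lemma cluster_spectral_gap:
  assumes fin: "finite {y. adj\<^sup>*\<^sup>* x0 y}" and E: "0 \<le> E" "2 * (real (card {y. adj\<^sup>*\<^sup>* x0 y}))\<^sup>2 * E < 1"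
  shows "spec_proj_diag V adj x0 E = spec_proj_diag V adj x0 0"
proof (cases "x0 \<in> V")
  case True
  have sy: "adj\<^sup>*\<^sup>* u x0" if "adj\<^sup>*\<^sup>* x0 u" for u
    using sympD[OF symp_rtranclp, of adj] that adj_sym by (auto simp: symp_def)
  obtain \<mu> where \<mu>: "is_spectral_measure_at V adj x0 \<mu>" using spectral_measure_exists by blast
  have "measure \<mu> {0<..E} = 0"
  proof (rule spectral_gap[OF fin _ _ \<mu> _ E])
    fix u v assume "u \<in> {y. adj\<^sup>*\<^sup>* x0 y}" "adj u v"
    then show "v \<in> {y. adj\<^sup>*\<^sup>* x0 y}" by auto
  next
    fix u v assume "u \<in> {y. adj\<^sup>*\<^sup>* x0 y}" "v \<in> {y. adj\<^sup>*\<^sup>* x0 y}"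
    then show "adj\<^sup>*\<^sup>* u v" using sy by (auto intro: rtranclp_trans)
  qed auto
  then show ?thesis using spec_proj_diag_diff[OF \<mu> True E(1)] by simp
qed (simp add: spec_proj_diag_def)

end

section \<open>Bernoulli sums and cluster exploration\<close>

text \<open>Expectation over a random subset of \<open>L\<close> that contains each point
  independently with probability p. As a finite sum it can be differentiated in p and computed by
  recursion on \<open>L\<close>.\<close>

definition bsum :: "real \<Rightarrow> 'v set \<Rightarrow> ('v set \<Rightarrow> real) \<Rightarrow> real" where
  "bsum p L f = (\<Sum>\<eta>\<in>Pow L. p ^ card \<eta> * (1 - p) ^ card (L - \<eta>) * f \<eta>)"

lemma bsum_empty [simp]: "bsum p {} f = f {}"
  by (simp add: bsum_def)

lemma bsum_cong: "(\<And>\<eta>. \<eta> \<subseteq> L \<Longrightarrow> f \<eta> = g \<eta>) \<Longrightarrow> bsum p L f = bsum p L g"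
  by (simp add: bsum_def)

lemma bsum_add: "bsum p L (\<lambda>\<eta>. f \<eta> + g \<eta>) = bsum p L f + bsum p L g"
  by (simp add: bsum_def distrib_left sum.distrib)

lemma bsum_diff: "bsum p L (\<lambda>\<eta>. f \<eta> - g \<eta>) = bsum p L f - bsum p L g"
  by (simp add: bsum_def right_diff_distrib sum_subtractf)

lemma bsum_cmult: "bsum p L (\<lambda>\<eta>. c * f \<eta>) = c * bsum p L f"
  by (simp add: bsum_def sum_distrib_left mult_ac)

lemma bsum_sum: "bsum p L (\<lambda>\<eta>. \<Sum>i\<in>A. f i \<eta>) = (\<Sum>i\<in>A. bsum p L (f i))"
  by (simp add: bsum_def sum_distrib_left sum.swap[of _ A])

lemma bsum_insert:
  assumes "finite L" "a \<notin> L"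
  shows "bsum p (insert a L) f = p * bsum p L (\<lambda>\<eta>. f (insert a \<eta>)) + (1 - p) * bsum p L f"
proof -
  have inj: "inj_on (insert a) (Pow L)" using assms by (auto simp: inj_on_def)
  have "bsum p (insert a L) f
      = (\<Sum>\<eta>\<in>Pow L. p ^ card \<eta> * (1 - p) ^ card (insert a L - \<eta>) * f \<eta>)
      + (\<Sum>\<eta>\<in>insert a ` Pow L. p ^ card \<eta> * (1 - p) ^ card (insert a L - \<eta>) * f \<eta>)"
    unfolding bsum_def Pow_insert using assms by (intro sum.union_disjoint) auto
  also have "(\<Sum>\<eta>\<in>insert a ` Pow L. p ^ card \<eta> * (1 - p) ^ card (insert a L - \<eta>) * f \<eta>)
      = (\<Sum>\<eta>\<in>Pow L. p ^ card (insert a \<eta>) * (1 - p) ^ card (insert a L - insert a \<eta>) * f (insert a \<eta>))"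
    by (simp add: sum.reindex[OF inj])
  also have "\<dots> = p * bsum p L (\<lambda>\<eta>. f (insert a \<eta>))"
    unfolding bsum_def sum_distrib_left
  proof (rule sum.cong, goal_cases)
    case (2 \<eta>)
    then have "finite \<eta>" "a \<notin> \<eta>" "insert a L - insert a \<eta> = L - \<eta>"
      using assms finite_subset by auto
    then show ?case by simp
  qed simp
  also have "(\<Sum>\<eta>\<in>Pow L. p ^ card \<eta> * (1 - p) ^ card (insert a L - \<eta>) * f \<eta>) = (1 - p) * bsum p L f"
    unfolding bsum_def sum_distrib_left
  proof (rule sum.cong, goal_cases)
    case (2 \<eta>)
    then have "insert a L - \<eta> = insert a (L - \<eta>)" using assms by auto
    then show ?case using assms by (simp add: mult_ac)
  qed simp
  finally show ?thesis by simp
qed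

lemma bsum_const: "finite L \<Longrightarrow> bsum p L (\<lambda>_. c) = c"
  by (induction L rule: finite_induct) (auto simp: bsum_insert algebra_simps)

lemma bsum_mono:
  assumes "0 \<le> p" "p \<le> 1" "\<And>\<eta>. \<eta> \<subseteq> L \<Longrightarrow> f \<eta> \<le> g \<eta>"
  shows "bsum p L f \<le> bsum p L g"
  unfolding bsum_def using assms by (intro sum_mono mult_left_mono) auto

lemma bsum_nonneg:
  assumes "0 \<le> p" "p \<le> 1" "\<And>\<eta>. \<eta> \<subseteq> L \<Longrightarrow> 0 \<le> f \<eta>"
  shows "0 \<le> bsum p L f"
  unfolding bsum_def using assms by (intro sum_nonneg mult_nonneg_nonneg) auto

lemma bsum_split:
  assumes "finite A" "finite B" "A \<inter> B = {}"
  shows "bsum p (A \<union> B) f = bsum p B (\<lambda>\<rho>. bsum p A (\<lambda>\<zeta>. f (\<rho> \<union> \<zeta>)))"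
  using assms
proof (induction A arbitrary: f rule: finite_induct)
  case (insert a A)
  then show ?case
    by (simp add: bsum_insert bsum_add bsum_cmult)
qed simp

lemma bsum_image:
  assumes "finite L" "inj_on g L"
  shows "bsum p (g ` L) f = bsum p L (\<lambda>\<eta>. f (g ` \<eta>))"
  using assms
proof (induction L arbitrary: f rule: finite_induct)
  case (insert a L)
  then have "g a \<notin> g ` L" "inj_on g L" by auto
  then show ?case using insert by (simp add: bsum_insert)
qed simp

text \<open>Here \<open>S \<eta>\<close> is the part left unexplored by an exploration of \<open>\<eta>\<close>: the assumption \<open>det\<close> says
  that it is a function of the explored part of the configuration alone.\<close>

lemma bsum_spatial_Markov:
  assumes L: "finite L"
    and SL: "\<And>\<eta>. \<eta> \<subseteq> L \<Longrightarrow> S \<eta> \<subseteq> L"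
    and det: "\<And>\<eta> \<eta>'. \<eta> \<subseteq> L \<Longrightarrow> \<eta>' \<subseteq> L \<Longrightarrow> \<eta>' - S \<eta> = \<eta> - S \<eta> \<Longrightarrow> S \<eta>' = S \<eta>"
  shows "bsum p L (\<lambda>\<eta>. g (\<eta> - S \<eta>) (S \<eta>) (\<eta> \<inter> S \<eta>))
       = bsum p L (\<lambda>\<eta>. bsum p (S \<eta>) (g (\<eta> - S \<eta>) (S \<eta>)))"
proof -
  have dec: "bsum p L (\<lambda>\<eta>. h (S \<eta>) \<eta>) = (\<Sum>A\<in>Pow L. bsum p L (\<lambda>\<eta>. if S \<eta> = A then h A \<eta> else 0))"
    for h :: "'a set \<Rightarrow> 'a set \<Rightarrow> real"
    unfolding bsum_sum[symmetric]
  proof (rule bsum_cong)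
    fix \<eta> assume "\<eta> \<subseteq> L"
    then have "S \<eta> \<in> Pow L" "finite (Pow L)" using SL L by auto
    then show "h (S \<eta>) \<eta> = (\<Sum>A\<in>Pow L. if S \<eta> = A then h A \<eta> else 0)"
      by (subst sum.delta') simp_all
  qed
  \<comment> \<open>Once the value A of the random region is fixed, \<open>det\<close> says that the
    condition S = A involves only the configuration outside A. The coordinates in A remain free and
    can be averaged on their own.\<close>
  have spl: "bsum p L (\<lambda>\<eta>. if S \<eta> = A then h A \<eta> else 0)
     = bsum p (L - A) (\<lambda>\<rho>. bsum p A (\<lambda>\<zeta>. if S \<rho> = A then h A (\<rho> \<union> \<zeta>) else 0))"
    if A: "A \<subseteq> L" for A and h :: "'a set \<Rightarrow> 'a set \<Rightarrow> real"
  proof -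
    have fin: "finite A" "finite (L - A)" "A \<inter> (L - A) = {}" using A L finite_subset by auto
    have LA: "A \<union> (L - A) = L" using A by auto
    have "bsum p L (\<lambda>\<eta>. if S \<eta> = A then h A \<eta> else 0)
      = bsum p (L - A) (\<lambda>\<rho>. bsum p A (\<lambda>\<zeta>. if S (\<rho> \<union> \<zeta>) = A then h A (\<rho> \<union> \<zeta>) else 0))"
      using bsum_split[OF fin, of p "\<lambda>\<eta>. if S \<eta> = A then h A \<eta> else 0"] unfolding LA .
    also have "\<dots> = bsum p (L - A) (\<lambda>\<rho>. bsum p A (\<lambda>\<zeta>. if S \<rho> = A then h A (\<rho> \<union> \<zeta>) else 0))"
    proof (intro bsum_cong)
      fix \<rho> \<zeta> assume *: "\<rho> \<subseteq> L - A" "\<zeta> \<subseteq> A"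
      then have sub: "\<rho> \<subseteq> L" "\<rho> \<union> \<zeta> \<subseteq> L" using A by auto
      have "\<rho> - A = \<rho> \<union> \<zeta> - A" using * by auto
      then have "S (\<rho> \<union> \<zeta>) = A \<longleftrightarrow> S \<rho> = A"
        using det[OF sub] det[OF sub(2,1)] by metis
      then show "(if S (\<rho> \<union> \<zeta>) = A then h A (\<rho> \<union> \<zeta>) else 0) = (if S \<rho> = A then h A (\<rho> \<union> \<zeta>) else 0)"
        by simp
    qed
    finally show ?thesis .
  qed
  have "bsum p L (\<lambda>\<eta>. g (\<eta> - S \<eta>) (S \<eta>) (\<eta> \<inter> S \<eta>))
      = (\<Sum>A\<in>Pow L. bsum p (L - A) (\<lambda>\<rho>. bsum p A (\<lambda>\<zeta>. if S \<rho> = A then g ((\<rho> \<union> \<zeta>) - A) A ((\<rho> \<union> \<zeta>) \<inter> A) else 0)))"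
    unfolding dec[of "\<lambda>A \<eta>. g (\<eta> - A) A (\<eta> \<inter> A)"] by (intro sum.cong refl spl) auto
  also have "\<dots> = (\<Sum>A\<in>Pow L. bsum p (L - A) (\<lambda>\<rho>. bsum p A (\<lambda>\<zeta>. if S \<rho> = A then bsum p A (g ((\<rho> \<union> \<zeta>) - A) A) else 0)))"
  proof (rule sum.cong[OF refl], rule bsum_cong)
    fix A \<rho> assume A: "A \<in> Pow L" and \<rho>: "\<rho> \<subseteq> L - A"
    have finA: "finite A" using A L finite_subset by auto
    have *: "\<rho> \<union> \<zeta> - A = \<rho>" "(\<rho> \<union> \<zeta>) \<inter> A = \<zeta>" if "\<zeta> \<subseteq> A" for \<zeta> using that \<rho> by auto
    have "bsum p A (\<lambda>\<zeta>. if S \<rho> = A then g ((\<rho> \<union> \<zeta>) - A) A ((\<rho> \<union> \<zeta>) \<inter> A) else 0)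
        = bsum p A (\<lambda>\<zeta>. if S \<rho> = A then g \<rho> A \<zeta> else 0)"
      using * by (intro bsum_cong) simp
    also have "\<dots> = (if S \<rho> = A then bsum p A (g \<rho> A) else 0)"
      using bsum_const[OF finA] by auto
    also have "\<dots> = bsum p A (\<lambda>\<zeta>. if S \<rho> = A then bsum p A (g \<rho> A) else 0)"
      by (rule bsum_const[OF finA, symmetric])
    also have "\<dots> = bsum p A (\<lambda>\<zeta>. if S \<rho> = A then bsum p A (g ((\<rho> \<union> \<zeta>) - A) A) else 0)"
      using * by (intro bsum_cong) simp
    finally show "bsum p A (\<lambda>\<zeta>. if S \<rho> = A then g ((\<rho> \<union> \<zeta>) - A) A ((\<rho> \<union> \<zeta>) \<inter> A) else 0)
       = bsum p A (\<lambda>\<zeta>. if S \<rho> = A then bsum p A (g ((\<rho> \<union> \<zeta>) - A) A) else 0)" .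
  qed
  also have "\<dots> = bsum p L (\<lambda>\<eta>. bsum p (S \<eta>) (g (\<eta> - S \<eta>) (S \<eta>)))"
    unfolding dec[of "\<lambda>A \<eta>. bsum p A (g (\<eta> - A) A)"] by (intro sum.cong refl spl[symmetric]) auto
  finally show ?thesis .
qed

text \<open>For an arbitrary f the derivative is a sum of discrete derivatives; adding one point to
  \<open>L\<close> is the product rule. For the indicator of an increasing event the sum is the
  expected number of pivotal points.\<close>

lemma russo_formula:
  assumes "finite L"
  shows "((\<lambda>p. bsum p L f) has_real_derivative
           (\<Sum>v\<in>L. bsum p L (\<lambda>\<eta>. f (insert v \<eta>) - f (\<eta> - {v})))) (at p)"
  using assms
proof (induction L arbitrary: f rule: finite_induct)
  case (insert a L)
  let ?g = "\<lambda>\<eta>. f (insert a \<eta>)"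
  have der: "((\<lambda>p. p * bsum p L ?g + (1 - p) * bsum p L f) has_real_derivative
      (1 * bsum p L ?g + (\<Sum>v\<in>L. bsum p L (\<lambda>\<eta>. ?g (insert v \<eta>) - ?g (\<eta> - {v}))) * p)
      + ((0 - 1) * bsum p L f + (\<Sum>v\<in>L. bsum p L (\<lambda>\<eta>. f (insert v \<eta>) - f (\<eta> - {v}))) * (1 - p))) (at p)"
    by (intro derivative_intros insert.IH)
  have fn: "(\<lambda>p. bsum p (insert a L) f) = (\<lambda>p. p * bsum p L ?g + (1 - p) * bsum p L f)"
    using insert by (simp add: bsum_insert)
  have at_a: "bsum p (insert a L) (\<lambda>\<eta>. f (insert a \<eta>) - f (\<eta> - {a})) = bsum p L ?g - bsum p L f"
  proof -
    have "bsum p (insert a L) (\<lambda>\<eta>. f (insert a \<eta>) - f (\<eta> - {a}))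
      = p * bsum p L (\<lambda>\<eta>. ?g \<eta> - f \<eta>) + (1 - p) * bsum p L (\<lambda>\<eta>. ?g \<eta> - f \<eta>)"
      unfolding bsum_insert[OF insert(1,2)] using insert(2)
      by (intro arg_cong2[of _ _ _ _ "(+)"] arg_cong2[of _ _ _ _ "(*)"] refl bsum_cong)
         (auto simp: insert_absorb intro!: arg_cong[of _ _ f])
    then show ?thesis by (simp add: bsum_diff algebra_simps)
  qed
  have at_v: "bsum p (insert a L) (\<lambda>\<eta>. f (insert v \<eta>) - f (\<eta> - {v}))
     = bsum p L (\<lambda>\<eta>. ?g (insert v \<eta>) - ?g (\<eta> - {v})) * p + bsum p L (\<lambda>\<eta>. f (insert v \<eta>) - f (\<eta> - {v})) * (1 - p)"
    if "v \<in> L" for v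
  proof -
    have "insert a \<eta> - {v} = insert a (\<eta> - {v})" for \<eta> using that insert(2) by auto
    then show ?thesis using insert by (simp add: bsum_insert insert_commute mult.commute)
  qed
  have "(\<Sum>v\<in>insert a L. bsum p (insert a L) (\<lambda>\<eta>. f (insert v \<eta>) - f (\<eta> - {v})))
    = (bsum p L ?g - bsum p L f) + (\<Sum>v\<in>L. bsum p L (\<lambda>\<eta>. ?g (insert v \<eta>) - ?g (\<eta> - {v})) * p
        + bsum p L (\<lambda>\<eta>. f (insert v \<eta>) - f (\<eta> - {v})) * (1 - p))"
    unfolding sum.insert[OF insert(1,2)] at_a by (intro arg_cong2[of _ _ _ _ "(+)"] refl sum.cong at_v)
  also have "\<dots> = (1 * bsum p L ?g + (\<Sum>v\<in>L. bsum p L (\<lambda>\<eta>. ?g (insert v \<eta>) - ?g (\<eta> - {v}))) * p)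
      + ((0 - 1) * bsum p L f + (\<Sum>v\<in>L. bsum p L (\<lambda>\<eta>. f (insert v \<eta>) - f (\<eta> - {v}))) * (1 - p))"
    by (simp only: sum.distrib sum_distrib_right[symmetric]) simp
  finally show ?case using der unfolding fn by simp
qed simp

lemma bsum_mono_param:
  assumes L: "finite L" and p: "0 \<le> p" "p \<le> q" "q \<le> 1"
    and f: "\<And>\<eta> \<eta>'. \<eta> \<subseteq> \<eta>' \<Longrightarrow> \<eta>' \<subseteq> L \<Longrightarrow> f \<eta> \<le> f \<eta>'"
  shows "bsum p L f \<le> bsum q L f"
proof (rule DERIV_nonneg_imp_nondecreasing[OF p(2)])
  fix x assume x: "p \<le> x" "x \<le> q"
  have "0 \<le> (\<Sum>v\<in>L. bsum x L (\<lambda>\<eta>. f (insert v \<eta>) - f (\<eta> - {v})))"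
    using x p f by (intro sum_nonneg bsum_nonneg) (auto intro!: f)
  then show "\<exists>y. ((\<lambda>p. bsum p L f) has_real_derivative y) (at x) \<and> 0 \<le> y"
    using russo_formula[OF L] by blast
qed

section \<open>Clusters and the differential inequality for connection probabilities\<close>

inductive_set clus :: "('v \<Rightarrow> 'v \<Rightarrow> bool) \<Rightarrow> 'v set \<Rightarrow> 'v set \<Rightarrow> 'v set"
  for E :: "'v \<Rightarrow> 'v \<Rightarrow> bool" and H Q :: "'v set"
where
  seed: "q \<in> Q \<Longrightarrow> q \<in> H \<Longrightarrow> q \<in> clus E H Q"
| step: "x \<in> clus E H Q \<Longrightarrow> E x y \<Longrightarrow> y \<in> H \<Longrightarrow> y \<in> clus E H Q"

lemma clus_subset: "clus E H Q \<subseteq> H"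
  by (rule subsetI, erule clus.induct)

lemma clus_mono:
  assumes "H \<subseteq> H'" "Q \<subseteq> Q'" shows "clus E H Q \<subseteq> clus E H' Q'"
proof
  fix x assume "x \<in> clus E H Q"
  then show "x \<in> clus E H' Q'" by induction (use assms in \<open>auto intro: clus.intros\<close>)
qed

lemma clus_reverse:
  assumes sym: "\<And>x y. E x y \<Longrightarrow> E y x" and H: "H \<subseteq> H'"
    and x: "x \<in> clus E H {a}" "x \<in> clus E H' B"
  shows "a \<in> clus E H' B"
  using x
proof induction
  case (step x y)
  then have "x \<in> H'" using clus_subset H by fast
  then show ?case using step sym by (auto intro: clus.step)
qed simp

definition touched :: "('v \<Rightarrow> 'v \<Rightarrow> bool) \<Rightarrow> 'v set \<Rightarrow> 'v \<Rightarrow> 'v set \<Rightarrow> 'v set" where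
  "touched E A a \<eta> = {v. v \<notin> A \<and> (\<exists>x\<in>clus E \<eta> {a}. E x v)}"

text \<open>The Duminil-Copin--Tassion functional, in a version for site percolation: the expected number of
  vertices outside \<open>A\<close> adjacent to the cluster of \<open>a\<close> in \<open>A\<close>. The status of these vertices does not
  matter, so there is no extra factor \<open>p\<close>.\<close>

definition phi :: "('v \<Rightarrow> 'v \<Rightarrow> bool) \<Rightarrow> real \<Rightarrow> 'v \<Rightarrow> 'v set \<Rightarrow> real" where
  "phi E p a A = bsum p A (\<lambda>\<eta>. real (card (touched E A a \<eta>)))"

text \<open>Loops are permitted: the line graph relation used for bond percolation relates every
  edge to itself.\<close>

locale perc_graph =
  fixes I :: "'v set" and E :: "'v \<Rightarrow> 'v \<Rightarrow> bool" and D :: nat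
  assumes E_sym: "E x y \<Longrightarrow> E y x"
    and E_I: "E x y \<Longrightarrow> x \<in> I"
    and E_fin: "finite {y. E x y}"
    and E_card: "card {y. E x y} \<le> D"
begin

lemma touched_sub: "\<eta> \<subseteq> A \<Longrightarrow> touched E A a \<eta> \<subseteq> (\<Union>x\<in>A. {y. E x y})"
  using clus_subset[of E \<eta> "{a}"] by (auto simp: touched_def)

lemma touched_finite: "finite A \<Longrightarrow> \<eta> \<subseteq> A \<Longrightarrow> finite (touched E A a \<eta>)"
  by (rule finite_subset[OF touched_sub]) (use E_fin in auto)

lemma touched_card:
  assumes "finite A" "\<eta> \<subseteq> A" shows "card (touched E A a \<eta>) \<le> D * card A"
proof -
  have "card (touched E A a \<eta>) \<le> card (\<Union>x\<in>A. {y. E x y})"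
    using assms E_fin by (intro card_mono touched_sub) auto
  also have "\<dots> \<le> (\<Sum>x\<in>A. card {y. E x y})" using assms by (intro card_UN_le)
  also have "\<dots> \<le> (\<Sum>x\<in>A. D)" by (intro sum_mono E_card)
  finally show ?thesis by (simp add: mult.commute)
qed

lemma touched_mono: "\<eta> \<subseteq> \<eta>' \<Longrightarrow> touched E A a \<eta> \<subseteq> touched E A a \<eta>'"
  using clus_mono[of \<eta> \<eta>' "{a}" "{a}" E] by (auto simp: touched_def)

lemma phi_mono:
  assumes "finite A" "0 \<le> p" "p \<le> q" "q \<le> 1"
  shows "phi E p a A \<le> phi E q a A"
  unfolding phi_def using assms
  by (intro bsum_mono_param) (auto intro!: card_mono touched_mono touched_finite)

definition bdry :: "'v set \<Rightarrow> 'v set" where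
  "bdry L = {x \<in> L. \<exists>y. y \<notin> L \<and> E x y}"

lemma russo_lower_bound:
  assumes L: "finite L" and a: "a \<in> L" and p: "0 \<le> p" "p \<le> 1"
    and phi: "\<And>A. A \<subseteq> L \<Longrightarrow> a \<in> A \<Longrightarrow> 1 \<le> phi E p a A"
  defines "f \<equiv> \<lambda>\<eta>. of_bool (a \<in> clus E \<eta> (bdry L)) :: real"
  shows "1 - bsum p L f \<le> (\<Sum>v\<in>L. bsum p L (\<lambda>\<eta>. f (insert v \<eta>) - f (\<eta> - {v})))"
proof -
  define B where "B = bdry L"
  define U where "U \<eta> = clus E \<eta> B" for \<eta>
  define W where "W \<eta> = {v \<in> L - \<eta>. v \<in> B \<or> (\<exists>u\<in>U \<eta>. E u v)}" for \<eta>
  define S where "S \<eta> = L - U \<eta> - W \<eta>" for \<eta>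
  \<comment> \<open>Exploring from the boundary reveals the open set \<open>U\<close> and its closed rim \<open>W\<close>. When \<open>a\<close> lies in
    the fresh region \<open>S\<close>, the vertices of \<open>W\<close> touched by its cluster in \<open>S\<close> are pivotal, and their
    expected number is \<open>phi\<close> of \<open>S\<close>.\<close>
  have BL: "B \<subseteq> L" by (auto simp: B_def bdry_def)
  have U\<eta>: "U \<eta> \<subseteq> \<eta>" for \<eta> unfolding U_def by (rule clus_subset)
  have Umono: "U \<eta> \<subseteq> U \<eta>'" if "\<eta> \<subseteq> \<eta>'" for \<eta> \<eta>' unfolding U_def using that by (intro clus_mono) auto
  have Useed: "q \<in> U \<eta>" if "q \<in> B" "q \<in> \<eta>" for q \<eta> unfolding U_def using that by (rule clus.seed)
  have Ustep: "y \<in> U \<eta>" if "x \<in> U \<eta>" "E x y" "y \<in> \<eta>" for x y \<eta>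
    using that unfolding U_def by (rule clus.step)
  have Wopen: "v \<in> U (insert v \<eta>)" if v: "v \<in> W \<eta>" for v \<eta>
  proof (cases "v \<in> B")
    case True
    then show ?thesis by (rule Useed) simp
  next
    case False
    then obtain u where u: "u \<in> U \<eta>" "E u v" using v by (auto simp: W_def)
    have "u \<in> U (insert v \<eta>)" using u Umono[of \<eta> "insert v \<eta>"] by blast
    then show ?thesis using u(2) by (rule Ustep) simp
  qed
  have f_U: "f \<eta> = of_bool (a \<in> U \<eta>)" for \<eta> by (simp add: f_def U_def B_def)
  have det: "S \<eta>' = S \<eta>" if \<eta>: "\<eta> \<subseteq> L" "\<eta>' \<subseteq> L" and eq: "\<eta>' - S \<eta> = \<eta> - S \<eta>" for \<eta> \<eta>'
  proof -
    have nS: "v \<in> \<eta>' \<longleftrightarrow> v \<in> \<eta>" if "v \<notin> S \<eta>" for v using eq that by blast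
    have U1: "x \<in> U \<eta>'" if "x \<in> U \<eta>" for x
      using that[unfolded U_def]
    proof induction
      case (seed q)
      then have "q \<notin> S \<eta>" using Useed by (auto simp: S_def)
      then show ?case using seed nS Useed by auto
    next
      case (step x y)
      then have "y \<in> U \<eta>" using Ustep U_def by auto
      then have "y \<notin> S \<eta>" by (auto simp: S_def)
      then show ?case using step nS Ustep by blast
    qed
    have U2: "x \<in> U \<eta>" if "x \<in> U \<eta>'" for x
      using that[unfolded U_def]
    proof induction
      case (seed q)
      show ?case
      proof (cases "q \<in> \<eta>")
        case False
        then have "q \<in> W \<eta>" using seed BL by (auto simp: W_def)
        then have "q \<notin> S \<eta>" by (auto simp: S_def)
        then show ?thesis using False seed nS by blast
      qed (use seed Useed in auto)
    next
      case (step x y)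
      show ?case
      proof (cases "y \<in> \<eta>")
        case False
        then have "y \<in> W \<eta>" using step \<eta> by (auto simp: W_def)
        then have "y \<notin> S \<eta>" by (auto simp: S_def)
        then show ?thesis using False step nS by blast
      qed (use step Ustep in auto)
    qed
    have UU: "U \<eta>' = U \<eta>" using U1 U2 by blast
    have "v \<in> W \<eta>' \<longleftrightarrow> v \<in> W \<eta>" for v
    proof
      assume v: "v \<in> W \<eta>"
      then have "v \<notin> S \<eta>" by (auto simp: S_def)
      then show "v \<in> W \<eta>'" using v nS UU by (auto simp: W_def)
    next
      assume v: "v \<in> W \<eta>'"
      show "v \<in> W \<eta>"
      proof (cases "v \<in> \<eta>")
        case True
        then have "v \<in> U \<eta>" using v UU Useed Ustep by (auto simp: W_def)
        then have "v \<notin> S \<eta>" by (auto simp: S_def)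
        then show ?thesis using True v nS by (auto simp: W_def)
      qed (use v UU in \<open>auto simp: W_def\<close>)
    qed
    then show ?thesis using UU by (auto simp: S_def)
  qed
  \<comment> \<open>A lower bound for the number of pivotal points in terms of the exploration: the
    touched vertices when \<open>a\<close> is still fresh, none when \<open>a\<close> is already
    connected, and one, namely \<open>a\<close> itself, when \<open>a\<close> is a closed rim
    vertex.\<close>
  define g where "g \<rho> A \<zeta> = (if a \<in> A then real (card (touched E A a \<zeta>)) else if a \<in> \<rho> then 0 else 1)"
    for \<rho> A \<zeta>
  have key: "g (\<eta> - S \<eta>) (S \<eta>) (\<eta> \<inter> S \<eta>) \<le> (\<Sum>v\<in>L. f (insert v \<eta>) - f \<eta>)"
    if \<eta>: "\<eta> \<subseteq> L" for \<eta>
  proof -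
    have ge: "f (insert v \<eta>) - f \<eta> \<ge> 0" for v
      using Umono[of \<eta> "insert v \<eta>"] by (auto simp: f_U)
    show ?thesis
    proof (cases "a \<in> U \<eta>")
      case True
      then have "a \<notin> S \<eta>" "a \<in> \<eta> - S \<eta>" using U\<eta> by (auto simp: S_def)
      then show ?thesis using ge by (simp add: g_def sum_nonneg)
    next
      case nF: False
      then have sumeq: "(\<Sum>v\<in>L. f (insert v \<eta>) - f \<eta>) = real (card {v\<in>L. a \<in> U (insert v \<eta>)})"
        using L by (simp add: f_U of_bool_def sum.If_cases Int_def)
      show ?thesis
      proof (cases "a \<in> S \<eta>")
        case True
        have "touched E (S \<eta>) a (\<eta> \<inter> S \<eta>) \<subseteq> {v\<in>L. a \<in> U (insert v \<eta>)}"
        proof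
          fix v assume "v \<in> touched E (S \<eta>) a (\<eta> \<inter> S \<eta>)"
          then obtain x where v: "v \<notin> S \<eta>" and x: "x \<in> clus E (\<eta> \<inter> S \<eta>) {a}" and xv: "E x v"
            by (auto simp: touched_def)
          have x': "x \<in> \<eta>" "x \<in> S \<eta>" using x clus_subset[of E "\<eta> \<inter> S \<eta>" "{a}"] by auto
          then have xU: "x \<notin> U \<eta>" "x \<in> L" by (auto simp: S_def)
          \<comment> \<open>Were v outside \<open>L\<close>, x would be an open vertex of the inner
            boundary and hence already in \<open>U\<close>.\<close>
          have "v \<in> L" using xU x' xv Useed by (force simp: B_def bdry_def)
          moreover have "v \<notin> U \<eta>" using xU x' xv E_sym Ustep by blast
          ultimately have "v \<in> W \<eta>" using v by (auto simp: S_def)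
          then have "v \<in> U (insert v \<eta>)" by (rule Wopen)
          then have "x \<in> U (insert v \<eta>)" using Ustep E_sym xv x' by blast
          then have "a \<in> U (insert v \<eta>)"
            unfolding U_def by (intro clus_reverse[OF E_sym _ x]) auto
          then show "v \<in> {v\<in>L. a \<in> U (insert v \<eta>)}" using \<open>v \<in> L\<close> by simp
        qed
        then have "card (touched E (S \<eta>) a (\<eta> \<inter> S \<eta>)) \<le> card {v\<in>L. a \<in> U (insert v \<eta>)}"
          using L by (intro card_mono) auto
        then show ?thesis using True sumeq by (simp add: g_def)
      next
        case False
        then have aW: "a \<in> W \<eta>" using nF a by (auto simp: S_def)
        then have "a \<in> U (insert a \<eta>)" by (rule Wopen)
        then have "card {v\<in>L. a \<in> U (insert v \<eta>)} \<noteq> 0" using a L by auto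
        then have "1 \<le> real (card {v\<in>L. a \<in> U (insert v \<eta>)})" by linarith
        then show ?thesis using False sumeq by (simp add: g_def)
      qed
    qed
  qed
  have "1 - bsum p L f = bsum p L (\<lambda>\<eta>. 1 - f \<eta>)" by (simp add: bsum_diff bsum_const[OF L])
  also have "\<dots> \<le> bsum p L (\<lambda>\<eta>. bsum p (S \<eta>) (g (\<eta> - S \<eta>) (S \<eta>)))"
  proof (rule bsum_mono[OF p])
    fix \<eta> assume \<eta>: "\<eta> \<subseteq> L"
    have SL: "S \<eta> \<subseteq> L" "finite (S \<eta>)" using L by (auto simp: S_def)
    show "1 - f \<eta> \<le> bsum p (S \<eta>) (g (\<eta> - S \<eta>) (S \<eta>))"
    proof (cases "a \<in> S \<eta>")
      case True
      then have "bsum p (S \<eta>) (g (\<eta> - S \<eta>) (S \<eta>)) = phi E p a (S \<eta>)"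
        unfolding phi_def by (intro bsum_cong) (simp add: g_def)
      then show ?thesis using phi[OF SL(1) True] by (simp add: f_def of_bool_def)
    next
      case False
      have "a \<in> U \<eta>" if "a \<in> \<eta>" using that False a by (auto simp: S_def W_def)
      moreover have "bsum p (S \<eta>) (g (\<eta> - S \<eta>) (S \<eta>)) = bsum p (S \<eta>) (\<lambda>_. if a \<in> \<eta> then 0 else 1)"
        using False by (intro bsum_cong) (simp add: g_def)
      ultimately show ?thesis using bsum_const[OF SL(2)] by (simp add: f_U)
    qed
  qed
  also have "\<dots> = bsum p L (\<lambda>\<eta>. g (\<eta> - S \<eta>) (S \<eta>) (\<eta> \<inter> S \<eta>))"
    by (rule bsum_spatial_Markov[OF L _ det, symmetric]) (auto simp: S_def)
  also have "\<dots> \<le> bsum p L (\<lambda>\<eta>. \<Sum>v\<in>L. f (insert v \<eta>) - f (\<eta> - {v}))"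
  proof (rule bsum_mono[OF p])
    fix \<eta> assume \<eta>: "\<eta> \<subseteq> L"
    have "f (\<eta> - {v}) \<le> f \<eta>" for v using Umono[of "\<eta> - {v}" \<eta>] by (auto simp: f_U)
    then have "(\<Sum>v\<in>L. f (insert v \<eta>) - f \<eta>) \<le> (\<Sum>v\<in>L. f (insert v \<eta>) - f (\<eta> - {v}))"
      by (intro sum_mono diff_left_mono)
    then show "g (\<eta> - S \<eta>) (S \<eta>) (\<eta> \<inter> S \<eta>) \<le> (\<Sum>v\<in>L. f (insert v \<eta>) - f (\<eta> - {v}))"
      using key[OF \<eta>] by linarith
  qed
  finally show ?thesis by (simp only: bsum_sum)
qed

text \<open>By Russo's formula the previous estimate reads theta' \<ge> 1 - theta for the connection
  probability theta, so (1 - theta(x)) exp(x) does not increase from p to q. The condition on phi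
  passes from p to larger parameters by monotonicity. The bound obtained does not depend on
  \<open>L\<close>.\<close>

lemma connection_lower_bound:
  assumes L: "finite L" and a: "a \<in> L" and p: "0 \<le> p" "p \<le> q" "q \<le> 1"
    and phi: "\<And>A. A \<subseteq> L \<Longrightarrow> a \<in> A \<Longrightarrow> 1 \<le> phi E p a A"
  shows "1 - exp (p - q) \<le> bsum q L (\<lambda>\<eta>. of_bool (a \<in> clus E \<eta> (bdry L)))"
proof -
  define f where "f = (\<lambda>\<eta>. of_bool (a \<in> clus E \<eta> (bdry L)) :: real)"
  define h where "h x = (1 - bsum x L f) * exp x" for x
  have "h q \<le> h p"
  proof (rule DERIV_nonpos_imp_nonincreasing[OF p(2)])
    fix x assume x: "p \<le> x" "x \<le> q"
    define d where "d = (\<Sum>v\<in>L. bsum x L (\<lambda>\<eta>. f (insert v \<eta>) - f (\<eta> - {v})))"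
    have "1 \<le> phi E x a A" if "A \<subseteq> L" "a \<in> A" for A
      using phi[OF that] phi_mono[of A p x a] that x p L finite_subset by force
    then have "1 - bsum x L f \<le> d"
      unfolding d_def f_def using x p by (intro russo_lower_bound L a) auto
    then have "(1 - bsum x L f) * exp x \<le> d * exp x" by (intro mult_right_mono) auto
    then have "(0 - d) * exp x + exp x * (1 - bsum x L f) \<le> 0" by (simp add: mult.commute)
    moreover have "(h has_real_derivative (0 - d) * exp x + exp x * (1 - bsum x L f)) (at x)"
      unfolding h_def d_def by (intro derivative_intros DERIV_exp russo_formula[OF L])
    ultimately show "\<exists>y. (h has_real_derivative y) (at x) \<and> y \<le> 0" by blast
  qed
  also have "h p \<le> 1 * exp p"
    unfolding h_def using p by (intro mult_right_mono) (auto simp: f_def intro!: bsum_nonneg)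
  finally have "(1 - bsum q L f) * exp q \<le> exp p" by (simp add: h_def)
  then have "1 - bsum q L f \<le> exp (p - q)" by (simp add: exp_diff field_simps)
  then show ?thesis by (simp add: f_def)
qed

text \<open>Its purpose is to carry a set with small phi from an orbit representative to any other
  vertex of the orbit.\<close>

lemma phi_automorphism:
  assumes A: "finite A" "A \<subseteq> I" and aI: "a \<in> I" and p: "0 \<le> p" "p \<le> 1"
    and g: "bij_betw g I I" "\<And>x y. x \<in> I \<Longrightarrow> y \<in> I \<Longrightarrow> E (g x) (g y) \<longleftrightarrow> E x y"
  shows "phi E p (g a) (g ` A) \<le> phi E p a A"
proof -
  have inj: "inj_on g A" using g(1) A by (auto simp: bij_betw_def intro: inj_on_subset)
  have "phi E p (g a) (g ` A) = bsum p A (\<lambda>\<eta>. real (card (touched E (g ` A) (g a) (g ` \<eta>))))"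
    unfolding phi_def by (rule bsum_image[OF A(1) inj])
  also have "\<dots> \<le> phi E p a A"
    unfolding phi_def
  proof (rule bsum_mono[OF p])
    fix \<eta> assume \<eta>: "\<eta> \<subseteq> A"
    have cl: "x \<in> g ` clus E \<eta> {a}" if "x \<in> clus E (g ` \<eta>) {g a}" for x
      using that
    proof induction
      case (seed q)
      then obtain y where "y \<in> \<eta>" "g y = g a" by auto
      then have "y = a" using g(1) aI A \<eta> by (auto simp: bij_betw_def dest: inj_onD)
      then show ?case using seed \<open>y \<in> \<eta>\<close> by (auto intro: clus.seed)
    next
      case (step x y)
      then obtain x' y' where x': "x' \<in> clus E \<eta> {a}" "x = g x'" and y': "y' \<in> \<eta>" "y = g y'" by blast
      have "x' \<in> I" "y' \<in> I" using x' y' A \<eta> clus_subset[of E \<eta> "{a}"] by auto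
      then have "E x' y'" using step x' y' g(2) by auto
      then show ?case using x' y' by (auto intro: clus.step)
    qed
    have "touched E (g ` A) (g a) (g ` \<eta>) \<subseteq> g ` touched E A a \<eta>"
    proof
      fix v assume "v \<in> touched E (g ` A) (g a) (g ` \<eta>)"
      then obtain x where v: "v \<notin> g ` A" "x \<in> clus E (g ` \<eta>) {g a}" "E x v" by (auto simp: touched_def)
      obtain x' where x': "x' \<in> clus E \<eta> {a}" "x = g x'" using cl v(2) by blast
      have "v \<in> I" using v(3) E_sym E_I by blast
      then obtain u where u: "u \<in> I" "v = g u" using g(1) by (auto simp: bij_betw_def)
      have "x' \<in> I" using x' A \<eta> clus_subset[of E \<eta> "{a}"] by auto
      then have "E x' u" using v(3) u x' g(2) by auto
      then show "v \<in> g ` touched E A a \<eta>" using u v x' by (auto simp: touched_def)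
    qed
    then have "card (touched E (g ` A) (g a) (g ` \<eta>)) \<le> card (g ` touched E A a \<eta>)"
      using touched_finite[OF A(1) \<eta>] by (intro card_mono) auto
    also have "\<dots> \<le> card (touched E A a \<eta>)" by (rule card_image_le[OF touched_finite[OF A(1) \<eta>]])
    finally show "real (card (touched E (g ` A) (g a) (g ` \<eta>))) \<le> real (card (touched E A a \<eta>))" by simp
  qed
  finally show ?thesis .
qed

text \<open>Linearises z^t for t up to l, so that only the expectation of the number of new seeds
  matters, not its distribution. The slope is close to z - 1 when z is close to 1.\<close>

lemma power_le_linear:
  fixes z :: real assumes "1 \<le> z" "t \<le> l"
  shows "z ^ t \<le> 1 + (z - 1) * z ^ l * real t"
  using assms(2)
proof (induction t)
  case (Suc t)
  then have "z ^ t \<le> z ^ l" using assms by (intro power_increasing) auto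
  then have "(z - 1) * z ^ t \<le> (z - 1) * z ^ l" using assms by (intro mult_left_mono) auto
  moreover have "z ^ Suc t = z ^ t + (z - 1) * z ^ t" by (simp add: algebra_simps)
  ultimately show ?case using Suc by (simp add: algebra_simps)
qed simp

lemma exploration_step:
  assumes U: "finite U" and Q: "Q \<subseteq> U" and a: "a \<in> Q"
    and A: "finite A" "a \<in> A" "card A \<le> M" and phi: "phi E p a A \<le> c"
    and p: "0 \<le> p" "p \<le> 1" and s: "1 \<le> s" and z: "1 \<le> z"
    and choice: "s ^ M * (1 + (z - 1) * z ^ (D * M) * c) \<le> z"
    and IH: "\<And>U' Q'. U' \<subset> U \<Longrightarrow> Q' \<subseteq> U' \<Longrightarrow> bsum p U' (\<lambda>\<eta>. s ^ card (clus E \<eta> Q')) \<le> z ^ card Q'"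
  shows "bsum p U (\<lambda>\<eta>. s ^ card (clus E \<eta> Q)) \<le> z ^ card Q"
proof -
  \<comment> \<open>Earlier explorations have already removed vertices, so only the part of
    \<open>A\<close> inside \<open>U\<close> is available.\<close>
  define A' where "A' = A \<inter> U"
  define K where "K \<eta> = clus E (\<eta> \<inter> A') {a}" for \<eta>
  define R where "R \<eta> = K \<eta> \<union> {v \<in> A' - \<eta>. v = a \<or> (\<exists>x\<in>K \<eta>. E x v)}" for \<eta>
  define S where "S \<eta> = U - R \<eta>" for \<eta>
  \<comment> \<open>Seeds for the next step: the old seeds in the unexplored region X, and the
    vertices of X adjacent to the explored open set.\<close>
  define Q' where "Q' \<rho> X = (Q \<inter> X) \<union> {v \<in> X. \<exists>x\<in>\<rho>. E x v}" for \<rho> X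
  define t where "t \<zeta> = card (touched E A a \<zeta>)" for \<zeta>
  \<comment> \<open>Only the cluster \<open>K\<close> of \<open>a\<close> in \<open>A'\<close> and its closed rim are revealed. The touched vertices outside
    \<open>A'\<close> replace \<open>a\<close> as seeds, and there are on average at most \<open>c < 1\<close> of them.\<close>
  have aU: "a \<in> A'" using a A Q by (auto simp: A'_def)
  have Ksub: "K \<eta> \<subseteq> \<eta> \<inter> A'" for \<eta> unfolding K_def by (rule clus_subset)
  have Kseed: "a \<in> K \<eta>" if "a \<in> \<eta>" for \<eta>
    unfolding K_def using that aU by (intro clus.seed) auto
  have Kstep: "y \<in> K \<eta>" if "x \<in> K \<eta>" "E x y" "y \<in> \<eta>" "y \<in> A'" for x y \<eta>
    unfolding K_def by (rule clus.step[of x]) (use that in \<open>auto simp: K_def\<close>)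
  have RU: "R \<eta> \<subseteq> A'" "A' \<subseteq> U" for \<eta> using Ksub by (auto simp: R_def A'_def)
  have aR: "a \<in> R \<eta>" for \<eta> using Kseed aU by (auto simp: R_def)
  have RK: "\<eta> \<inter> R \<eta> = K \<eta>" for \<eta> using Ksub by (auto simp: R_def)
  have diffS: "\<eta> - S \<eta> = K \<eta>" if "\<eta> \<subseteq> U" for \<eta> using that RK by (auto simp: S_def)
  have det: "S \<eta>' = S \<eta>" if \<eta>: "\<eta> \<subseteq> U" "\<eta>' \<subseteq> U" and eq: "\<eta>' - S \<eta> = \<eta> - S \<eta>" for \<eta> \<eta>'
  proof -
    have nR: "v \<in> \<eta>' \<longleftrightarrow> v \<in> \<eta>" if "v \<in> R \<eta>" for v using eq that by (auto simp: S_def)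
    have K1: "x \<in> K \<eta>'" if "x \<in> K \<eta>" for x
      using that[unfolded K_def]
    proof induction
      case (seed q)
      then show ?case using nR[of a] aR Kseed by auto
    next
      case (step x y)
      then have "y \<in> K \<eta>" using Kstep K_def by auto
      then have "y \<in> R \<eta>" by (auto simp: R_def)
      then show ?case using step nR Kstep by blast
    qed
    have K2: "x \<in> K \<eta>" if "x \<in> K \<eta>'" for x
      using that[unfolded K_def]
    proof induction
      case (seed q)
      then show ?case using nR[of a] aR Kseed by auto
    next
      case (step x y)
      show ?case
      proof (cases "y \<in> \<eta>")
        case False
        then have "y \<in> R \<eta>" using step by (auto simp: R_def)
        then show ?thesis using False step nR by blast
      qed (use step Kstep in auto)
    qed
    have KK: "K \<eta>' = K \<eta>" using K1 K2 by blast
    have "v \<in> R \<eta>' \<longleftrightarrow> v \<in> R \<eta>" for v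
    proof (cases "v \<in> K \<eta>")
      case False
      have "v \<in> \<eta>' \<longleftrightarrow> v \<in> \<eta>" if "v \<in> A'" "v = a \<or> (\<exists>x\<in>K \<eta>. E x v)"
      proof
        assume "v \<in> \<eta>"
        then have "v \<in> K \<eta>" using that Kseed Kstep by auto
        then show "v \<in> \<eta>'" using False by simp
      next
        assume "v \<in> \<eta>'"
        then have "v \<in> K \<eta>'" using that KK Kseed Kstep by metis
        then show "v \<in> \<eta>" using False KK by simp
      qed
      then show ?thesis using False KK by (auto simp: R_def)
    qed (use KK in \<open>auto simp: R_def\<close>)
    then show ?thesis by (auto simp: S_def)
  qed
  have cover: "clus E \<eta> Q \<subseteq> K \<eta> \<union> clus E (\<eta> \<inter> S \<eta>) (Q' (\<eta> - S \<eta>) (S \<eta>))" if \<eta>: "\<eta> \<subseteq> U" for \<eta>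
  proof
    fix x assume "x \<in> clus E \<eta> Q"
    then show "x \<in> K \<eta> \<union> clus E (\<eta> \<inter> S \<eta>) (Q' (\<eta> - S \<eta>) (S \<eta>))"
    proof induction
      case (seed q)
      show ?case
      proof (cases "q \<in> R \<eta>")
        case True then show ?thesis using RK seed by blast
      next
        case False
        then have "q \<in> S \<eta>" using seed \<eta> by (auto simp: S_def)
        then show ?thesis using seed by (intro UnI2 clus.seed) (auto simp: Q'_def)
      qed
    next
      case (step x y)
      show ?case
      proof (cases "y \<in> R \<eta>")
        case True then show ?thesis using RK step by blast
      next
        case False
        then have y: "y \<in> S \<eta>" using step \<eta> by (auto simp: S_def)
        show ?thesis
        proof (cases "x \<in> K \<eta>")
          case True
          then show ?thesis using y step diffS[OF \<eta>]
            by (intro UnI2 clus.seed) (auto simp: Q'_def)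
        next
          case False
          then have "x \<in> clus E (\<eta> \<inter> S \<eta>) (Q' (\<eta> - S \<eta>) (S \<eta>))" using step by blast
          then have "y \<in> clus E (\<eta> \<inter> S \<eta>) (Q' (\<eta> - S \<eta>) (S \<eta>))"
            by (rule clus.step) (use y step in auto)
          then show ?thesis by blast
        qed
      qed
    qed
  qed
  have tL: "t (\<eta> \<inter> A) \<le> D * M" for \<eta>
    unfolding t_def using touched_card[OF A(1), of "\<eta> \<inter> A" a] A(3) mult_le_mono2[of "card A" M D]
    by (meson Int_lower2 order_trans)
  have cQ': "card (Q' (\<eta> - S \<eta>) (S \<eta>)) \<le> (card Q - 1) + t (\<eta> \<inter> A)" if \<eta>: "\<eta> \<subseteq> U" for \<eta>
  proof -
    have fQ: "finite Q" using Q U finite_subset by blast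
    have "Q \<inter> S \<eta> \<subseteq> Q - {a}" using aR by (auto simp: S_def)
    then have "card (Q \<inter> S \<eta>) \<le> card (Q - {a})" using fQ by (intro card_mono) auto
    then have 1: "card (Q \<inter> S \<eta>) \<le> card Q - 1" using fQ a by simp
    have KA: "K \<eta> = clus E (\<eta> \<inter> A) {a}"
      using \<eta> by (simp add: K_def A'_def Int_absorb2 inf.absorb1 flip: Int_assoc)
        (metis Int_assoc Int_commute inf.absorb1)
    have "{v \<in> S \<eta>. \<exists>x\<in>K \<eta>. E x v} \<subseteq> touched E A a (\<eta> \<inter> A)"
    proof
      fix v assume "v \<in> {v \<in> S \<eta>. \<exists>x\<in>K \<eta>. E x v}"
      then obtain x where v: "v \<in> U" "v \<notin> R \<eta>" "x \<in> K \<eta>" "E x v" by (auto simp: S_def)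
      have "v \<notin> A'" using v Kstep by (auto simp: R_def)
      then show "v \<in> touched E A a (\<eta> \<inter> A)" using v KA by (auto simp: touched_def A'_def)
    qed
    then have 2: "card {v \<in> S \<eta>. \<exists>x\<in>K \<eta>. E x v} \<le> t (\<eta> \<inter> A)"
      unfolding t_def using A by (intro card_mono touched_finite) auto
    show ?thesis
      unfolding Q'_def diffS[OF \<eta>] using 1 2 card_Un_le[of "Q \<inter> S \<eta>" "{v \<in> S \<eta>. \<exists>x\<in>K \<eta>. E x v}"]
      by linarith
  qed
  \<comment> \<open>Restoring the vertices of \<open>A\<close> outside \<open>U\<close> as fresh
    coordinates can only enlarge the cluster of \<open>a\<close>, so the expectation is at most phi
    of the whole of \<open>A\<close>.\<close>
  have tc: "bsum p U (\<lambda>\<eta>. real (t (\<eta> \<inter> A))) \<le> c"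
  proof -
    have fin: "finite (U \<inter> A)" "finite (U - A)" "finite (A - U)" using U A by auto
    have "bsum p U (\<lambda>\<eta>. real (t (\<eta> \<inter> A))) = bsum p ((U - A) \<union> (U \<inter> A)) (\<lambda>\<eta>. real (t (\<eta> \<inter> A)))"
      by (simp only: Un_Diff_Int)
    also have "\<dots> = bsum p (U \<inter> A) (\<lambda>\<rho>. bsum p (U - A) (\<lambda>\<zeta>. real (t ((\<rho> \<union> \<zeta>) \<inter> A))))"
      using fin by (intro bsum_split) auto
    also have "\<dots> = bsum p (U \<inter> A) (\<lambda>\<rho>. bsum p (U - A) (\<lambda>\<zeta>. real (t \<rho>)))"
    proof (intro bsum_cong)
      fix \<rho> \<zeta> assume "\<rho> \<subseteq> U \<inter> A" "\<zeta> \<subseteq> U - A"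
      then have "(\<rho> \<union> \<zeta>) \<inter> A = \<rho>" by auto
      then show "real (t ((\<rho> \<union> \<zeta>) \<inter> A)) = real (t \<rho>)" by simp
    qed
    also have "\<dots> = bsum p (U \<inter> A) (\<lambda>\<rho>. bsum p (A - U) (\<lambda>\<zeta>. real (t \<rho>)))"
      by (simp add: bsum_const fin)
    also have "\<dots> \<le> bsum p (U \<inter> A) (\<lambda>\<rho>. bsum p (A - U) (\<lambda>\<zeta>. real (t (\<rho> \<union> \<zeta>))))"
      unfolding t_def using A
      by (intro bsum_mono p) (auto intro!: card_mono touched_finite touched_mono)
    also have "\<dots> = bsum p ((A - U) \<union> (U \<inter> A)) (\<lambda>\<eta>. real (t \<eta>))"
      using fin by (intro bsum_split[symmetric]) auto
    also have "(A - U) \<union> (U \<inter> A) = A" by auto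
    finally show ?thesis using phi by (simp add: phi_def t_def)
  qed
  have zs: "0 \<le> s ^ M * z ^ (card Q - 1)" using s z by simp
  have "bsum p U (\<lambda>\<eta>. s ^ card (clus E \<eta> Q))
     \<le> bsum p U (\<lambda>\<eta>. s ^ M * s ^ card (clus E (\<eta> \<inter> S \<eta>) (Q' (\<eta> - S \<eta>) (S \<eta>))))"
  proof (rule bsum_mono[OF p])
    fix \<eta> assume \<eta>: "\<eta> \<subseteq> U"
    let ?C = "clus E (\<eta> \<inter> S \<eta>) (Q' (\<eta> - S \<eta>) (S \<eta>))"
    have KA: "K \<eta> \<subseteq> A" using Ksub[of \<eta>] by (auto simp: A'_def)
    have fK: "finite (K \<eta>)" "K \<eta> \<subseteq> A" using KA A(1) by (auto intro: finite_subset)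
    have fC: "finite ?C" using clus_subset U \<eta> by (meson Int_lower1 finite_subset)
    have "card (clus E \<eta> Q) \<le> card (K \<eta> \<union> ?C)"
      using fK fC by (intro card_mono cover[OF \<eta>]) auto
    also have "\<dots> \<le> card (K \<eta>) + card ?C" by (rule card_Un_le)
    also have "card (K \<eta>) \<le> M" using fK A by (meson card_mono order_trans)
    finally have "s ^ card (clus E \<eta> Q) \<le> s ^ (M + card ?C)" using s by (intro power_increasing) auto
    then show "s ^ card (clus E \<eta> Q) \<le> s ^ M * s ^ card ?C" by (simp add: power_add)
  qed
  also have "\<dots> = bsum p U (\<lambda>\<eta>. bsum p (S \<eta>) (\<lambda>\<zeta>. s ^ M * s ^ card (clus E \<zeta> (Q' (\<eta> - S \<eta>) (S \<eta>)))))"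
    using bsum_spatial_Markov[OF U _ det, where p = p and g = "\<lambda>\<rho> X \<zeta>. s ^ M * s ^ card (clus E \<zeta> (Q' \<rho> X))"]
    by (auto simp: S_def)
  also have "\<dots> \<le> bsum p U (\<lambda>\<eta>. s ^ M * z ^ (card Q - 1) * (1 + (z - 1) * z ^ (D * M) * real (t (\<eta> \<inter> A))))"
  proof (rule bsum_mono[OF p])
    fix \<eta> assume \<eta>: "\<eta> \<subseteq> U"
    let ?q = "Q' (\<eta> - S \<eta>) (S \<eta>)"
    have "S \<eta> \<subset> U" using aR[of \<eta>] aU RU by (auto simp: S_def)
    then have "bsum p (S \<eta>) (\<lambda>\<zeta>. s ^ card (clus E \<zeta> ?q)) \<le> z ^ card ?q"
      by (rule IH) (auto simp: Q'_def)
    also have "\<dots> \<le> z ^ ((card Q - 1) + t (\<eta> \<inter> A))" using z cQ'[OF \<eta>] by (intro power_increasing) auto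
    also have "\<dots> = z ^ (card Q - 1) * z ^ t (\<eta> \<inter> A)" by (simp add: power_add)
    also have "\<dots> \<le> z ^ (card Q - 1) * (1 + (z - 1) * z ^ (D * M) * real (t (\<eta> \<inter> A)))"
      using z by (intro mult_left_mono power_le_linear tL) auto
    finally show "bsum p (S \<eta>) (\<lambda>\<zeta>. s ^ M * s ^ card (clus E \<zeta> ?q))
        \<le> s ^ M * z ^ (card Q - 1) * (1 + (z - 1) * z ^ (D * M) * real (t (\<eta> \<inter> A)))"
      unfolding bsum_cmult using s by (simp add: mult.assoc mult_left_mono)
  qed
  also have "\<dots> = s ^ M * z ^ (card Q - 1) * (1 + (z - 1) * z ^ (D * M) * bsum p U (\<lambda>\<eta>. real (t (\<eta> \<inter> A))))"
    by (simp only: bsum_cmult bsum_add bsum_const[OF U])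
  also have "\<dots> \<le> s ^ M * z ^ (card Q - 1) * (1 + (z - 1) * z ^ (D * M) * c)"
    using z tc zs by (intro mult_left_mono add_left_mono) auto
  also have "\<dots> = z ^ (card Q - 1) * (s ^ M * (1 + (z - 1) * z ^ (D * M) * c))" by simp
  also have "\<dots> \<le> z ^ (card Q - 1) * z" using z choice by (intro mult_left_mono) auto
  also have "\<dots> = z ^ card Q"
  proof -
    have "card Q > 0" using a Q U by (auto simp: card_gt_0_iff intro: finite_subset)
    then show ?thesis by (simp flip: power_Suc2)
  qed
  finally show ?thesis .
qed

text \<open>One exploration costs a factor s^M for the at most M open vertices found, and replaces a
  factor z by at most 1 + (z - 1) z^(D M) c on average. As c < 1, the latter is below z for z
  slightly above 1, which leaves room for some s > 1. Both constants depend on c, D and M only,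
  hence the uniformity in U and Q.\<close>

lemma exponential_moment:
  assumes c: "c < 1" and p: "0 \<le> p" "p \<le> 1"
    and ex: "\<And>a. a \<in> I \<Longrightarrow> \<exists>A. finite A \<and> a \<in> A \<and> card A \<le> M \<and> phi E p a A \<le> c"
  shows "\<exists>s>1. \<exists>z\<ge>1. \<forall>U Q. finite U \<longrightarrow> U \<subseteq> I \<longrightarrow> Q \<subseteq> U \<longrightarrow>
     bsum p U (\<lambda>\<eta>. s ^ card (clus E \<eta> Q)) \<le> z ^ card Q"
proof -
  have "((\<lambda>z. z ^ (D * M) * c) \<longlongrightarrow> 1 ^ (D * M) * c) (at_right 1)"
    by (intro tendsto_intros)
  then have "\<forall>\<^sub>F z in at_right 1. z ^ (D * M) * c < (1 + c) / 2"
    using c by (intro order_tendstoD) auto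
  moreover have "\<forall>\<^sub>F z in at_right 1. z > (1::real)" by (simp add: eventually_at_right_less)
  ultimately have "\<forall>\<^sub>F z in at_right 1. z > 1 \<and> z ^ (D * M) * c < (1 + c) / 2"
    by eventually_elim auto
  then obtain z :: real where z: "z > 1" "z ^ (D * M) * c < (1 + c) / 2"
    using eventually_happens'[OF trivial_limit_at_right_real] by blast
  define u where "u = 1 + (z - 1) * z ^ (D * M) * c"
  have "(z - 1) * (z ^ (D * M) * c) < (z - 1) * 1"
    using z c by (intro mult_strict_left_mono) auto
  then have u: "u < z" by (simp add: u_def mult.assoc)
  have "((\<lambda>s. s ^ M * u) \<longlongrightarrow> 1 ^ M * u) (at_right 1)" by (intro tendsto_intros)
  then have "\<forall>\<^sub>F s in at_right 1. s ^ M * u < z" using u by (intro order_tendstoD) auto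
  moreover have "\<forall>\<^sub>F s in at_right 1. s > (1::real)" by (simp add: eventually_at_right_less)
  ultimately have "\<forall>\<^sub>F s in at_right 1. s > 1 \<and> s ^ M * u < z" by eventually_elim auto
  then obtain s :: real where s: "s > 1" "s ^ M * u < z"
    using eventually_happens'[OF trivial_limit_at_right_real] by blast
  have "bsum p U (\<lambda>\<eta>. s ^ card (clus E \<eta> Q)) \<le> z ^ card Q"
    if "finite U" "U \<subseteq> I" "Q \<subseteq> U" for U Q
    using that
  proof (induction U arbitrary: Q rule: finite_psubset_induct)
    case (psubset U)
    show ?case
    proof (cases "Q = {}")
      case True
      have "x \<notin> clus E \<eta> {}" for x \<eta>
      proof
        assume "x \<in> clus E \<eta> {}" then show False by induction auto
      qed
      then have "clus E \<eta> {} = {}" for \<eta> by blast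
      then show ?thesis using True bsum_const[OF psubset.hyps(1)] by simp
    next
      case False
      then obtain a where a: "a \<in> Q" by blast
      then obtain A where A: "finite A" "a \<in> A" "card A \<le> M" "phi E p a A \<le> c"
        using ex psubset.prems by blast
      show ?thesis
      proof (rule exploration_step[OF psubset.hyps(1) psubset.prems(2) a A p])
        show "s ^ M * (1 + (z - 1) * z ^ (D * M) * c) \<le> z" using s by (simp add: u_def)
      qed (use s z psubset in auto)
    qed
  qed
  then show ?thesis using s(1) z(1) by (intro exI[of _ s] conjI exI[of _ z]) auto
qed

end

section \<open>Percolation on the infinite graph\<close>

abbreviation bfield :: "'v set \<Rightarrow> real \<Rightarrow> ('v \<Rightarrow> bool) measure" where
  "bfield I p \<equiv> PiM I (\<lambda>_. measure_pmf (bernoulli_pmf p))"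

lemma prob_space_bfield: "prob_space (bfield I p)"
  by (rule prob_space_PiM) (rule prob_space_measure_pmf)

lemma bfield_coordinate:
  "v \<in> I \<Longrightarrow> {\<omega> \<in> space (bfield I p). \<omega> v} \<in> sets (bfield I p)"
  by measurable

lemma bfield_cylinder_sets:
  assumes "finite L" "L \<subseteq> I"
  shows "{\<omega> \<in> space (bfield I p). {v\<in>L. \<omega> v} = \<eta>} \<in> sets (bfield I p)"
proof (cases "\<eta> \<subseteq> L")
  case True
  then have "{\<omega> \<in> space (bfield I p). {v\<in>L. \<omega> v} = \<eta>}
      = {\<omega> \<in> space (bfield I p). \<forall>v\<in>L. \<omega> v \<longleftrightarrow> v \<in> \<eta>}" by auto
  also have "\<dots> \<in> sets (bfield I p)"
  proof (rule sets.sets_Collect_finite_All[OF _ assms(1)])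
    fix v assume "v \<in> L"
    then have "v \<in> I" using assms by auto
    then show "{\<omega> \<in> space (bfield I p). \<omega> v \<longleftrightarrow> v \<in> \<eta>} \<in> sets (bfield I p)"
      by measurable
  qed
  finally show ?thesis .
next
  case False
  then have "{\<omega> \<in> space (bfield I p). {v\<in>L. \<omega> v} = \<eta>} = {}" by auto
  then show ?thesis by (simp only: sets.empty_sets)
qed

lemma bfield_cylinder:
  assumes L: "finite L" "L \<subseteq> I" "\<eta> \<subseteq> L" and p: "0 \<le> p" "p \<le> 1"
  shows "measure (bfield I p) {\<omega> \<in> space (bfield I p). {v\<in>L. \<omega> v} = \<eta>}
     = p ^ card \<eta> * (1 - p) ^ card (L - \<eta>)"
proof -
  interpret product_prob_space "\<lambda>_. measure_pmf (bernoulli_pmf p)" I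
    by (simp add: product_prob_space_def product_prob_space_axioms_def product_sigma_finite_def
        prob_space_measure_pmf prob_space_imp_sigma_finite)
  have "{\<omega> \<in> space (bfield I p). {v\<in>L. \<omega> v} = \<eta>}
      = {\<omega> \<in> space (bfield I p). \<forall>v\<in>L. \<omega> v \<in> {v \<in> \<eta>}}" using L(3) by auto
  then have "emeasure (bfield I p) {\<omega> \<in> space (bfield I p). {v\<in>L. \<omega> v} = \<eta>}
      = (\<Prod>v\<in>L. emeasure (measure_pmf (bernoulli_pmf p)) {v \<in> \<eta>})"
    by (simp only:) (rule emeasure_PiM_Collect[OF L(2,1)], simp)
  also have "\<dots> = (\<Prod>v\<in>L. ennreal (if v \<in> \<eta> then p else 1 - p))"
    using p by (intro prod.cong) (auto simp: emeasure_pmf_single)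
  also have "\<dots> = ennreal (\<Prod>v\<in>L. if v \<in> \<eta> then p else 1 - p)"
    using p by (intro prod_ennreal) auto
  also have "(\<Prod>v\<in>L. if v \<in> \<eta> then p else 1 - p) = p ^ card \<eta> * (1 - p) ^ card (L - \<eta>)"
    using L by (simp add: prod.If_cases Int_absorb1 Diff_eq)
  finally show ?thesis using p by (simp add: measure_def)
qed

text \<open>The bridge from the product measure to \<open>bsum\<close>: an event depending on
  finitely many coordinates is a finite disjoint union of cylinders.\<close>

lemma bfield_local_event:
  assumes L: "finite L" "L \<subseteq> I" and p: "0 \<le> p" "p \<le> 1"
  shows "{\<omega> \<in> space (bfield I p). P {v\<in>L. \<omega> v}} \<in> sets (bfield I p)"
    and "measure (bfield I p) {\<omega> \<in> space (bfield I p). P {v\<in>L. \<omega> v}}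
       = bsum p L (\<lambda>\<eta>. of_bool (P \<eta>))"
proof -
  let ?M = "bfield I p"
  interpret prob_space ?M by (rule prob_space_bfield)
  let ?C = "\<lambda>\<eta>. {\<omega> \<in> space ?M. {v\<in>L. \<omega> v} = \<eta>}"
  have eq: "{\<omega> \<in> space ?M. P {v\<in>L. \<omega> v}} = (\<Union>\<eta>\<in>{\<eta>\<in>Pow L. P \<eta>}. ?C \<eta>)" by auto
  have fin: "finite {\<eta>\<in>Pow L. P \<eta>}" using L by auto
  show "{\<omega> \<in> space ?M. P {v\<in>L. \<omega> v}} \<in> sets ?M"
    unfolding eq by (intro sets.finite_UN fin bfield_cylinder_sets L)
  have "measure ?M (\<Union>\<eta>\<in>{\<eta>\<in>Pow L. P \<eta>}. ?C \<eta>) = (\<Sum>\<eta>\<in>{\<eta>\<in>Pow L. P \<eta>}. measure ?M (?C \<eta>))"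
    using bfield_cylinder_sets[OF L]
    by (intro finite_measure_finite_Union fin) (auto simp: disjoint_family_on_def)
  also have "\<dots> = (\<Sum>\<eta>\<in>{\<eta>\<in>Pow L. P \<eta>}. p ^ card \<eta> * (1 - p) ^ card (L - \<eta>))"
    using bfield_cylinder[OF L _ p] by (intro sum.cong) auto
  also have "\<dots> = bsum p L (\<lambda>\<eta>. of_bool (P \<eta>))"
    unfolding bsum_def using L(1) by (intro sum.mono_neutral_cong_left) auto
  finally show "measure ?M {\<omega> \<in> space ?M. P {v\<in>L. \<omega> v}} = bsum p L (\<lambda>\<eta>. of_bool (P \<eta>))"
    unfolding eq .
qed

lemma finite_subset_UN_incseq:
  fixes C :: "nat \<Rightarrow> 'a set"
  assumes "finite X" "X \<subseteq> (\<Union>m. C m)" "incseq C"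
  obtains m where "X \<subseteq> C m"
proof -
  have "\<exists>m. X \<subseteq> C m" using assms(1,2)
  proof (induction X rule: finite_induct)
    case (insert x X)
    then obtain m n where "X \<subseteq> C m" "x \<in> C n" by auto
    moreover have "C m \<subseteq> C (max m n)" "C n \<subseteq> C (max m n)" using assms(3) by (auto simp: incseq_def)
    ultimately show ?case by blast
  qed simp
  then show thesis using that by blast
qed

context perc_graph
begin

section \<open>Exhaustion by balls and exponential decay of the cluster size\<close>

definition nbhd :: "nat \<Rightarrow> 'v set \<Rightarrow> 'v set" where
  "nbhd n Q = ((\<lambda>A. A \<union> (\<Union>x\<in>A. {y. E x y})) ^^ n) Q"

lemma nbhd_0 [simp]: "nbhd 0 Q = Q"
  by (simp add: nbhd_def)

lemma nbhd_Suc: "nbhd (Suc n) Q = nbhd n Q \<union> (\<Union>x\<in>nbhd n Q. {y. E x y})"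
  by (simp add: nbhd_def)

lemma nbhd_finite: "finite Q \<Longrightarrow> finite (nbhd n Q)"
  by (induction n) (auto simp: nbhd_Suc E_fin)

lemma nbhd_sub: "Q \<subseteq> I \<Longrightarrow> nbhd n Q \<subseteq> I"
  by (induction n) (auto simp: nbhd_Suc intro: E_I[OF E_sym])

lemma nbhd_incseq: "incseq (\<lambda>n. nbhd n Q)"
  by (rule incseq_SucI) (auto simp: nbhd_Suc)

lemma nbhd_self: "Q \<subseteq> nbhd n Q"
  using incseqD[OF nbhd_incseq[of Q], of 0 n] by simp

lemma clus_incseq: "incseq (\<lambda>n. clus E (H \<inter> nbhd n Q) Q')"
proof (rule incseq_SucI)
  show "clus E (H \<inter> nbhd n Q) Q' \<subseteq> clus E (H \<inter> nbhd (Suc n) Q) Q'" for n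
    by (rule clus_mono) (auto simp: nbhd_Suc)
qed

text \<open>A vertex reached in n steps is reached inside the n-ball around the seeds, so a possibly
  infinite cluster is an increasing union of sets determined by finitely many coordinates when
  \<open>Q\<close> is finite.\<close>

lemma clus_eq_UN: "clus E H Q = (\<Union>n. clus E (H \<inter> nbhd n Q) Q)"
proof
  show "clus E H Q \<subseteq> (\<Union>n. clus E (H \<inter> nbhd n Q) Q)"
  proof
    fix x assume "x \<in> clus E H Q"
    then show "x \<in> (\<Union>n. clus E (H \<inter> nbhd n Q) Q)"
    proof induction
      case (seed q)
      then have "q \<in> clus E (H \<inter> nbhd 0 Q) Q" by (intro clus.seed) auto
      then show ?case by blast
    next
      case (step x y)
      then obtain n where n: "x \<in> clus E (H \<inter> nbhd n Q) Q" by blast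
      then have "x \<in> nbhd n Q" using clus_subset[of E "H \<inter> nbhd n Q" Q] by auto
      then have y: "y \<in> H \<inter> nbhd (Suc n) Q" using step by (auto simp: nbhd_Suc)
      have "x \<in> clus E (H \<inter> nbhd (Suc n) Q) Q" using n clus_incseq[of H Q Q] by (auto simp: incseq_Suc_iff)
      then have "y \<in> clus E (H \<inter> nbhd (Suc n) Q) Q" using step(2) y by (rule clus.step)
      then show ?case by blast
    qed
  qed
  show "(\<Union>n. clus E (H \<inter> nbhd n Q) Q) \<subseteq> clus E H Q"
    using clus_mono[of "H \<inter> nbhd n Q" H Q Q E for n] by auto
qed

lemma clus_trans: "x \<in> clus E H {a} \<Longrightarrow> clus E H {x} \<subseteq> clus E H {a}"
proof
  fix y assume x: "x \<in> clus E H {a}" and "y \<in> clus E H {x}"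
  from this(2) show "y \<in> clus E H {a}" by induction (use x in \<open>auto intro: clus.step\<close>)
qed

lemma clus_hits:
  assumes "a \<in> clus E H B" obtains b where "b \<in> B" "b \<in> clus E H {a}"
proof -
  have "\<exists>b\<in>B. b \<in> clus E H {a}" using assms
  proof induction
    case (seed q)
    then show ?case by (auto intro: clus.seed)
  next
    case (step x y)
    then obtain b where b: "b \<in> B" "b \<in> clus E H {x}" by blast
    have "x \<in> H" using step clus_subset by fast
    have "y \<in> clus E H {y}" using step by (auto intro: clus.seed)
    then have "x \<in> clus E H {y}" using E_sym[OF step(2)] \<open>x \<in> H\<close> by (rule clus.step)
    then show ?case using b clus_trans by blast
  qed
  then show thesis using that by blast
qed

text \<open>If phi were at least 1 for all finite sets containing \<open>a\<close>, then at
  parameter q the vertex \<open>a\<close> would be connected to the boundary of each ball with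
  probability at least 1 - exp(p - q), hence to infinitely many of these boundaries with positive
  probability. A finite cluster reaches only finitely many of them.\<close>

lemma exists_phi_less_1:
  assumes a: "a \<in> I" and p: "0 \<le> p" "p < q" "q \<le> 1"
    and fin: "AE \<omega> in bfield I q. finite (clus E {v\<in>I. \<omega> v} {a})"
  shows "\<exists>A. finite A \<and> A \<subseteq> I \<and> a \<in> A \<and> phi E p a A < 1"
proof (rule ccontr)
  assume contra: "\<not> ?thesis"
  let ?M = "bfield I q"
  interpret prob_space ?M by (rule prob_space_bfield)
  define L where "L n = nbhd n {a}" for n
  have L: "finite (L n)" "L n \<subseteq> I" "a \<in> L n" for n
    using a nbhd_finite nbhd_sub nbhd_self[of "{a}" n] by (auto simp: L_def)
  define F where "F n = {\<omega> \<in> space ?M. a \<in> clus E {v\<in>L n. \<omega> v} (bdry (L n))}" for n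
  have q: "0 \<le> q" using p by simp
  note ev = bfield_local_event[OF L(1,2) q p(3), of "\<lambda>\<eta>. a \<in> clus E \<eta> (bdry (L n))" n for n, folded F_def]
  have Fp: "1 - exp (p - q) \<le> prob (F n)" for n
  proof -
    have "1 \<le> phi E p a A" if "A \<subseteq> L n" "a \<in> A" for A
      using contra that L finite_subset by (metis not_less order_trans)
    then show ?thesis
      unfolding ev using p L by (intro connection_lower_bound) auto
  qed
  \<comment> \<open>Tail unions decrease, so continuity from above carries the lower bound over to
    the limit superior of the events.\<close>
  define G where "G N = (\<Union>n\<in>{N..}. F n)" for N
  have Gs: "range G \<subseteq> sets ?M" using ev(1) by (auto simp: G_def)
  have Gd: "decseq G" unfolding decseq_def G_def by (intro allI impI UN_mono) auto
  have "1 - exp (p - q) \<le> prob (G N)" for N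
  proof -
    have "prob (F N) \<le> prob (G N)" using Gs by (intro finite_measure_mono) (auto simp: G_def)
    then show ?thesis using Fp[of N] by simp
  qed
  then have "1 - exp (p - q) \<le> prob (\<Inter>N. G N)"
    using finite_Lim_measure_decseq[OF Gs Gd] by (intro LIMSEQ_le_const) auto
  moreover have "prob (\<Inter>N. G N) = 0"
  proof -
    have "AE \<omega> in ?M. \<omega> \<notin> (\<Inter>N. G N)"
      using fin AE_space
    proof eventually_elim
      case (elim \<omega>)
      define H where "H = {v\<in>I. \<omega> v}"
      have "clus E H {a} \<subseteq> (\<Union>n. L n)"
      proof -
        have "clus E (H \<inter> nbhd n {a}) {a} \<subseteq> L n" for n using clus_subset by (force simp: L_def)
        then show ?thesis by (subst clus_eq_UN) blast
      qed
      moreover have "incseq L" unfolding L_def by (rule nbhd_incseq)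
      ultimately obtain m where m: "clus E H {a} \<subseteq> L m"
        using elim by (metis H_def finite_subset_UN_incseq)
      \<comment> \<open>A cluster within radius m has its neighbours within radius m + 1, so for n >
        m it contains no vertex of the inner boundary of \<open>L n\<close>.\<close>
      have "\<omega> \<notin> F n" if "n \<ge> Suc m" for n
      proof
        assume "\<omega> \<in> F n"
        then have "a \<in> clus E {v\<in>L n. \<omega> v} (bdry (L n))" by (auto simp: F_def)
        then obtain b where b: "b \<in> bdry (L n)" "b \<in> clus E {v\<in>L n. \<omega> v} {a}" by (rule clus_hits)
        have "clus E {v\<in>L n. \<omega> v} {a} \<subseteq> clus E H {a}"
          using L(2)[of n] by (intro clus_mono) (auto simp: H_def)
        then have "b \<in> L m" using b m by blast
        then have "{y. E b y} \<subseteq> L (Suc m)" by (auto simp: L_def nbhd_Suc)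
        moreover have "L (Suc m) \<subseteq> L n" using \<open>incseq L\<close> that by (auto simp: incseq_def)
        ultimately show False using b by (auto simp: bdry_def)
      qed
      then have "\<omega> \<notin> G (Suc m)" by (auto simp: G_def)
      then show ?case by blast
    qed
    moreover have "(\<Inter>N. G N) \<subseteq> space ?M" "(\<Inter>N. G N) \<in> sets ?M"
      using Gs by (auto simp: G_def F_def)
    ultimately have "emeasure ?M (\<Inter>N. G N) = 0"
      by (subst (asm) AE_iff_measurable[of "\<Inter>N. G N"]) auto
    then show ?thesis by (simp add: measure_def)
  qed
  ultimately show False using p by simp
qed

lemma exponential_cluster_tail:
  assumes p: "0 \<le> p" "p < q" "q \<le> 1"
    and fin: "\<And>a. a \<in> I \<Longrightarrow> AE \<omega> in bfield I q. finite (clus E {v\<in>I. \<omega> v} {a})"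
    and T: "finite T" "T \<subseteq> I"
    and orbits: "\<And>v. v \<in> I \<Longrightarrow> \<exists>a\<in>T. \<exists>g. bij_betw g I I \<and>
        (\<forall>x\<in>I. \<forall>y\<in>I. E (g x) (g y) \<longleftrightarrow> E x y) \<and> g a = v"
  shows "\<exists>s>1. \<exists>z\<ge>1. \<forall>Q n. finite Q \<longrightarrow> Q \<subseteq> I \<longrightarrow>
     (\<exists>B \<in> sets (bfield I p). measure (bfield I p) B \<le> z ^ card Q / s ^ n \<and>
       (\<forall>\<omega> \<in> space (bfield I p) - B.
          finite (clus E {v\<in>I. \<omega> v} Q) \<and> card (clus E {v\<in>I. \<omega> v} Q) < n))"
proof -
  let ?M = "bfield I p"
  interpret prob_space ?M by (rule prob_space_bfield)
  have p1: "p \<le> 1" using p by simp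
  have "\<forall>a\<in>T. \<exists>A. finite A \<and> A \<subseteq> I \<and> a \<in> A \<and> phi E p a A < 1"
    using exists_phi_less_1[OF _ p fin] T by blast
  then obtain A where A: "\<And>a. a \<in> T \<Longrightarrow> finite (A a) \<and> A a \<subseteq> I \<and> a \<in> A a \<and> phi E p a (A a) < 1"
    by metis
  \<comment> \<open>The inserted 0 keeps the maxima meaningful for empty \<open>T\<close>.\<close>
  define c where "c = Max (insert 0 ((\<lambda>a. phi E p a (A a)) ` T))"
  define M where "M = Max (insert 0 ((\<lambda>a. card (A a)) ` T))"
  have c: "c < 1" "\<And>a. a \<in> T \<Longrightarrow> phi E p a (A a) \<le> c"
    using T A unfolding c_def by (auto simp: Max_less_iff intro!: Max_ge)
  have M: "card (A a) \<le> M" if "a \<in> T" for a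
    using T that unfolding M_def by (intro Max_ge) auto
  have "\<exists>X. finite X \<and> v \<in> X \<and> card X \<le> M \<and> phi E p v X \<le> c" if v: "v \<in> I" for v
  proof -
    obtain a g where a: "a \<in> T" and g: "bij_betw g I I"
      "\<And>x y. x \<in> I \<Longrightarrow> y \<in> I \<Longrightarrow> E (g x) (g y) \<longleftrightarrow> E x y" and v: "g a = v"
      using orbits[OF v] by blast
    have "phi E p v (g ` A a) \<le> phi E p a (A a)"
      unfolding v[symmetric] using A[OF a] a T p p1 g by (intro phi_automorphism) auto
    moreover have "card (g ` A a) \<le> card (A a)" using A[OF a] by (intro card_image_le) auto
    ultimately show ?thesis
      using A[OF a] c(2)[OF a] M[OF a] v by (intro exI[of _ "g ` A a"]) auto
  qed
  from exponential_moment[OF c(1) p(1) p1 this]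
  obtain s z where s: "s > 1" and z: "z \<ge> 1" and
    moment: "\<And>U Q. finite U \<Longrightarrow> U \<subseteq> I \<Longrightarrow> Q \<subseteq> U \<Longrightarrow> bsum p U (\<lambda>\<eta>. s ^ card (clus E \<eta> Q)) \<le> z ^ card Q"
    by blast
  have "\<exists>B \<in> sets ?M. prob B \<le> z ^ card Q / s ^ n \<and>
       (\<forall>\<omega> \<in> space ?M - B. finite (clus E {v\<in>I. \<omega> v} Q) \<and> card (clus E {v\<in>I. \<omega> v} Q) < n)"
    if Q: "finite Q" "Q \<subseteq> I" for Q n
  proof -
    define L where "L m = nbhd m Q" for m
    have L: "finite (L m)" "L m \<subseteq> I" "Q \<subseteq> L m" for m
      using Q nbhd_finite nbhd_sub nbhd_self[of Q m] by (auto simp: L_def)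
    define G where "G m = {\<omega> \<in> space ?M. n \<le> card (clus E {v\<in>L m. \<omega> v} Q)}" for m
    note ev = bfield_local_event[OF L(1,2) p(1) p1, of "\<lambda>\<eta>. n \<le> card (clus E \<eta> Q)" m for m, folded G_def]
    have Lc: "{v\<in>L m. \<omega> v} = {v\<in>I. \<omega> v} \<inter> nbhd m Q" for m \<omega> using L(2)[of m] by (auto simp: L_def)
    have clf: "finite (clus E {v\<in>L m. \<omega> v} Q)" for m \<omega>
      by (rule finite_subset[OF clus_subset]) (simp add: L(1))
    have Gp: "prob (G m) \<le> z ^ card Q / s ^ n" for m
    proof -
      have "prob (G m) \<le> bsum p (L m) (\<lambda>\<eta>. (1 / s ^ n) * s ^ card (clus E \<eta> Q))"
        unfolding ev
      proof (rule bsum_mono[OF p(1) p1])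
        fix \<eta>
        have "s ^ n \<le> s ^ card (clus E \<eta> Q)" if "n \<le> card (clus E \<eta> Q)"
          using s that by (intro power_increasing) auto
        then show "of_bool (n \<le> card (clus E \<eta> Q)) \<le> 1 / s ^ n * s ^ card (clus E \<eta> Q)"
          using s by (auto simp: field_simps)
      qed
      also have "\<dots> \<le> (1 / s ^ n) * z ^ card Q"
        unfolding bsum_cmult using s L by (intro mult_left_mono moment) auto
      finally show ?thesis by simp
    qed
    have Gi: "incseq G"
    proof (rule incseq_SucI, rule subsetI)
      fix m \<omega> assume w: "\<omega> \<in> G m"
      have "card (clus E {v\<in>L m. \<omega> v} Q) \<le> card (clus E {v\<in>L (Suc m). \<omega> v} Q)"
        by (rule card_mono[OF clf clus_mono]) (auto simp: L_def nbhd_Suc)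
      then show "\<omega> \<in> G (Suc m)" using w by (auto simp: G_def)
    qed
    have Gs: "range G \<subseteq> sets ?M" using ev(1) by auto
    have "prob (\<Union>m. G m) \<le> z ^ card Q / s ^ n"
      using finite_Lim_measure_incseq[OF Gs Gi] Gp by (intro LIMSEQ_le_const2) auto
    moreover have "finite (clus E {v\<in>I. \<omega> v} Q) \<and> card (clus E {v\<in>I. \<omega> v} Q) < n"
      if w: "\<omega> \<in> space ?M - (\<Union>m. G m)" for \<omega>
    proof (rule ccontr)
      let ?K = "clus E {v\<in>I. \<omega> v} Q"
      assume no: "\<not> (finite ?K \<and> card ?K < n)"
      obtain X where X: "finite X" "X \<subseteq> ?K" "card X = n"
      proof (cases "finite ?K")
        case True
        then show ?thesis using no that by (meson not_less obtain_subset_with_card_n)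
      next
        case False
        then show ?thesis using that by (meson infinite_arbitrarily_large)
      qed
      have "X \<subseteq> (\<Union>m. clus E ({v\<in>I. \<omega> v} \<inter> nbhd m Q) Q)" using X(2) by (subst (asm) clus_eq_UN)
      then obtain m where m: "X \<subseteq> clus E ({v\<in>I. \<omega> v} \<inter> nbhd m Q) Q"
        by (rule finite_subset_UN_incseq[OF X(1) _ clus_incseq])
      then have "n \<le> card (clus E {v\<in>L m. \<omega> v} Q)"
        unfolding Lc[symmetric] using card_mono[OF clf] X(3) by blast
      then show False using w by (auto simp: G_def)
    qed
    ultimately show ?thesis using Gs by (intro bexI[of _ "\<Union>m. G m"]) auto
  qed
  then show ?thesis using s z by blast
qed

end

section \<open>Lifshitz tails on Cayley graphs\<close>

text \<open>Let r = sqrt E. The lower bound uses n = ceiling(pi / r), which is at most 5 / r for r <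
  1; as 2 n \<le> 4^n, it is at least (b / 4)^n, whence \<open>g\<close> and the 5 in
  \<open>am\<close>. The upper bound uses n = floor(1 / (5 r)), admissible because 18 / 25 < 1, and
  decays like exp(- ln s / (5 r)); \<open>ap\<close> keeps half of this rate, and the other half
  absorbs the factor K s.\<close>

lemma lifshitz_tailI:
  fixes N :: "real \<Rightarrow> real"
  assumes s: "s > 1" and K: "K > 0" and b: "b > 0"
    and upper: "\<And>n E. 0 < E \<Longrightarrow> 18 * (real n)\<^sup>2 * E < 1 \<Longrightarrow> N E - N 0 \<le> K / s ^ n"
    and lower: "\<And>n E. 2 \<le> n \<Longrightarrow> (pi / real n)\<^sup>2 \<le> E \<Longrightarrow> b ^ n / (2 * real n) \<le> N E - N 0"
  shows "lifshitz_tail N"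
proof -
  \<comment> \<open>The cap 1/2 keeps \<open>ln g\<close> negative for large b.\<close>
  define g where "g = min (b / 4) (1 / 2)"
  have g: "0 < g" "g < 1" "g \<le> b / 4" using b by (auto simp: g_def)
  define am where "am = - 5 * ln g"
  define ap where "ap = ln s / 10"
  have lns: "ln s > 0" using s by simp
  have am: "am > 0" using g by (simp add: am_def)
  have ap: "ap > 0" using lns by (simp add: ap_def)
  \<comment> \<open>Chosen so that r < e implies r < 1 as well as ln (K s) \<le> ap / r.\<close>
  define e where "e = min 1 (ap / (\<bar>ln (K * s)\<bar> + 1))"
  have e: "e > 0" "e \<le> 1" "e * (\<bar>ln (K * s)\<bar> + 1) \<le> ap"
  proof -
    show "e > 0" "e \<le> 1" using ap by (auto simp: e_def)
    have "e \<le> ap / (\<bar>ln (K * s)\<bar> + 1)" by (simp add: e_def)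
    then show "e * (\<bar>ln (K * s)\<bar> + 1) \<le> ap" by (simp add: pos_le_divide_eq)
  qed
  have main: "exp (- am * E powr (-1/2)) \<le> N E - N 0 \<and> N E - N 0 \<le> exp (- ap * E powr (-1/2))"
    if E: "0 < E" "E < e\<^sup>2" for E
  proof
    define r where "r = sqrt E"
    have r0: "r > 0" using E by (simp add: r_def)
    have rE: "r\<^sup>2 = E" using E by (simp add: r_def)
    have re: "r < e" using E e(1) real_less_lsqrt[of e E] by (simp add: r_def)
    have pw: "E powr (-1/2) = 1 / r"
      using E by (simp add: r_def powr_minus powr_half_sqrt field_simps flip: powr_half_sqrt)
    show "exp (- am * E powr (-1/2)) \<le> N E - N 0"
    proof -
      define n where "n = nat \<lceil>pi / r\<rceil>"
      have "r < 1" using re e by simp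
      then have "pi < pi / r" using r0 by (simp add: field_simps)
      then have n: "pi / r \<le> real n" "real n < pi / r + 1" "real n > 2"
        using pi_gt3 unfolding n_def by linarith+
      have "pi / real n \<le> r" using n r0 by (simp add: field_simps)
      then have "(pi / real n)\<^sup>2 \<le> r\<^sup>2" by (intro power_mono) auto
      then have low: "b ^ n / (2 * real n) \<le> N E - N 0" using n by (intro lower) (auto simp: rE)
      have "2 * n \<le> 4 ^ n"
      proof (induction n)
        case (Suc n)
        have "2 * n + 2 \<le> 4 * x" if "1 \<le> x" "2 * n \<le> x" for x :: nat using that by linarith
        from this[of "4 ^ n"] show ?case using Suc by simp
      qed simp
      then have n4: "2 * real n \<le> 4 ^ n" by (metis of_nat_le_iff of_nat_mult of_nat_numeral of_nat_power)
      have "real n \<le> 5 / r"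
      proof -
        have "1 \<le> 1 / r" using r0 \<open>r < 1\<close> by simp
        moreover have "pi / r \<le> 4 / r" using r0 pi_less_4 by (intro divide_right_mono) auto
        moreover have "4 / r + 1 / r = 5 / r" by (simp add: add_divide_distrib[symmetric])
        ultimately show ?thesis using n(2) by linarith
      qed
      then have "ln g * (5 / r) \<le> ln g * real n" using g by (intro mult_left_mono_neg) auto
      then have "exp (- am * E powr (-1/2)) \<le> exp (real n * ln g)"
        unfolding pw am_def by (simp add: mult.commute)
      also have "\<dots> = g ^ n" using g by (simp add: exp_of_nat_mult)
      also have "\<dots> \<le> (b / 4) ^ n" using g by (intro power_mono) auto
      also have "\<dots> = b ^ n / 4 ^ n" by (simp add: power_divide)
      also have "\<dots> \<le> b ^ n / (2 * real n)" using n4 n b by (intro divide_left_mono) auto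
      finally show ?thesis using low by linarith
    qed
    show "N E - N 0 \<le> exp (- ap * E powr (-1/2))"
    proof -
      define n where "n = nat \<lfloor>1 / (5 * r)\<rfloor>"
      have "0 \<le> 1 / (5 * r)" using r0 by simp
      then have n: "real n \<le> 1 / (5 * r)" "1 / (5 * r) < real n + 1" unfolding n_def by linarith+
      have "real n * r \<le> 1 / 5" using n r0 by (simp add: field_simps)
      then have "(real n * r)\<^sup>2 \<le> (1 / 5)\<^sup>2" using r0 by (intro power_mono) auto
      then have "18 * (real n)\<^sup>2 * E < 1" unfolding power_mult_distrib rE by (simp add: power_divide)
      then have "N E - N 0 \<le> K / s ^ n" using E by (intro upper)
      also have "\<dots> = exp (ln (K * s) - (real n + 1) * ln s)"
        using K s by (simp add: exp_diff exp_add ring_distribs exp_of_nat_mult)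
      also have "\<dots> \<le> exp (- ap * E powr (-1/2))"
      proof -
        have "1 / (5 * r) * ln s \<le> (real n + 1) * ln s" using n lns by (intro mult_right_mono) auto
        moreover have "1 / (5 * r) * ln s = 2 * (ap / r)" by (simp add: ap_def)
        moreover have "ln (K * s) \<le> ap / r"
        proof -
          have "r * ln (K * s) \<le> r * (\<bar>ln (K * s)\<bar> + 1)"
            using r0 by (intro mult_left_mono) auto
          also have "\<dots> \<le> e * (\<bar>ln (K * s)\<bar> + 1)" using re by (intro mult_right_mono) auto
          finally have "r * ln (K * s) \<le> ap" using e by linarith
          then show ?thesis using r0 by (simp add: field_simps)
        qed
        ultimately show ?thesis unfolding pw by simp
      qed
      finally show ?thesis .
    qed
  qed
  show ?thesis
    unfolding lifshitz_tail_def
    by (intro exI[of _ am] exI[of _ ap] conjI am ap exI[of _ "e\<^sup>2"] allI impI)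
       (use main e in auto)
qed

text \<open>\<open>F x\<close> is a finite set of possible neighbours independent of the
  configuration. With it every entry of a power of the random Laplacian is a finite expression in
  measurable functions.\<close>

locale random_lap_graph = prob_space M
  for M :: "'w measure" +
  fixes V :: "'w \<Rightarrow> 'v set" and adj :: "'w \<Rightarrow> 'v \<Rightarrow> 'v \<Rightarrow> bool" and k :: nat
    and F :: "'v \<Rightarrow> 'v set" and x0 :: 'v
  assumes lap: "lap_graph (V \<omega>) (adj \<omega>) k"
    and F_fin: "finite (F x)" and adj_F: "adj \<omega> x y \<Longrightarrow> y \<in> F x"
    and adj_measurable: "{\<omega> \<in> space M. adj \<omega> x y} \<in> sets M"
    and V_measurable: "{\<omega> \<in> space M. x0 \<in> V \<omega>} \<in> sets M"
begin

lemma power_measurable: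
  "(\<lambda>\<omega>. ((neumann_lap (V \<omega>) (adj \<omega>) ^^ n) (delta x0)) x) \<in> borel_measurable M"
proof (induction n arbitrary: x)
  case (Suc n)
  let ?f = "\<lambda>\<omega>. (neumann_lap (V \<omega>) (adj \<omega>) ^^ n) (delta x0)"
  have "((neumann_lap (V \<omega>) (adj \<omega>) ^^ Suc n) (delta x0)) x
      = (\<Sum>y\<in>F x. if adj \<omega> x y then ?f \<omega> x - ?f \<omega> y else 0)" for \<omega>
  proof -
    interpret lap_graph "V \<omega>" "adj \<omega>" k by (rule lap)
    have "((neumann_lap (V \<omega>) (adj \<omega>) ^^ Suc n) (delta x0)) x = (\<Sum>y\<in>{y. adj \<omega> x y}. ?f \<omega> x - ?f \<omega> y)"
      by (simp add: T_eq)
    also have "\<dots> = (\<Sum>y\<in>F x. if adj \<omega> x y then ?f \<omega> x - ?f \<omega> y else 0)"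
      using adj_F[of \<omega> x] F_fin[of x] by (intro sum.mono_neutral_cong_left) auto
    finally show ?thesis .
  qed
  moreover have "(\<lambda>\<omega>. \<Sum>y\<in>F x. if adj \<omega> x y then ?f \<omega> x - ?f \<omega> y else 0) \<in> borel_measurable M"
    by (intro borel_measurable_sum measurable_If borel_measurable_diff Suc adj_measurable) auto
  ultimately show ?case by simp
qed simp

lemma spec_measurable [measurable]:
  "(\<lambda>\<omega>. spec_proj_diag (V \<omega>) (adj \<omega>) x0 E) \<in> borel_measurable M"
proof -
  obtain q where q: "\<And>j t. \<bar>t\<bar> \<le> 2 * real k + 1 \<Longrightarrow> \<bar>poly (q j) t\<bar> \<le> 2"
      "\<And>t. \<bar>t\<bar> \<le> 2 * real k + 1 \<Longrightarrow> (\<lambda>j. poly (q j) t) \<longlonglongrightarrow> indicator {..E} t"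
    by (rule poly_approx_indicator[of "2 * real k + 1" E]) blast
  let ?u = "\<lambda>j \<omega>. if x0 \<in> V \<omega> then mlin (\<lambda>i. ((neumann_lap (V \<omega>) (adj \<omega>) ^^ i) (delta x0)) x0) (q j) else 0"
  show ?thesis
  proof (rule borel_measurable_LIMSEQ_real[of _ ?u])
    show "?u j \<in> borel_measurable M" for j
      unfolding mlin_def
      by (intro measurable_If borel_measurable_sum borel_measurable_times power_measurable V_measurable) auto
    show "(\<lambda>j. ?u j \<omega>) \<longlonglongrightarrow> spec_proj_diag (V \<omega>) (adj \<omega>) x0 E" for \<omega>
    proof (cases "x0 \<in> V \<omega>")
      case True
      interpret lap_graph "V \<omega>" "adj \<omega>" k by (rule lap)
      show ?thesis using spec_proj_diag_tendsto[OF True q] True by (simp add: moment_def[abs_def])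
    qed (simp add: spec_proj_diag_def)
  qed
qed

abbreviation ids :: "real \<Rightarrow> real" where
  "ids E \<equiv> \<integral>\<omega>. spec_proj_diag (V \<omega>) (adj \<omega>) x0 E \<partial>M"

lemma spec_integrable: "integrable M (\<lambda>\<omega>. spec_proj_diag (V \<omega>) (adj \<omega>) x0 E)"
  by (rule integrable_const_bound[of _ 1])
     (use lap_graph.spec_proj_diag_bounds[OF lap] in auto)

lemma ids_diff: "ids E - ids 0
   = (\<integral>\<omega>. spec_proj_diag (V \<omega>) (adj \<omega>) x0 E - spec_proj_diag (V \<omega>) (adj \<omega>) x0 0 \<partial>M)"
  using spec_integrable by simp

lemma ids_diff_upper:
  assumes B: "B \<in> sets M" and E: "0 \<le> E"
    and eq: "\<And>\<omega>. \<omega> \<in> space M - B \<Longrightarrow> spec_proj_diag (V \<omega>) (adj \<omega>) x0 E = spec_proj_diag (V \<omega>) (adj \<omega>) x0 0"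
  shows "ids E - ids 0 \<le> prob B"
proof -
  have "ids E - ids 0 \<le> (\<integral>\<omega>. indicator B \<omega> \<partial>M)"
    unfolding ids_diff
  proof (rule integral_mono)
    fix \<omega> assume w: "\<omega> \<in> space M"
    show "spec_proj_diag (V \<omega>) (adj \<omega>) x0 E - spec_proj_diag (V \<omega>) (adj \<omega>) x0 0 \<le> indicator B \<omega>"
      using lap_graph.spec_proj_diag_bounds[OF lap, of \<omega> x0 E] lap_graph.spec_proj_diag_bounds[OF lap, of \<omega> x0 0]
        eq[of \<omega>] w by (cases "\<omega> \<in> B") auto
  qed (use spec_integrable B in \<open>auto intro!: integrable_const_bound[of "indicator B" 1]\<close>)
  then show ?thesis using B by simp
qed

lemma ids_diff_lower:
  assumes A: "A \<in> sets M" and E: "0 \<le> E"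
    and le: "\<And>\<omega>. \<omega> \<in> A \<Longrightarrow> c \<le> spec_proj_diag (V \<omega>) (adj \<omega>) x0 E - spec_proj_diag (V \<omega>) (adj \<omega>) x0 0"
  shows "c * prob A \<le> ids E - ids 0"
proof -
  have "(\<integral>\<omega>. c * indicator A \<omega> \<partial>M) \<le> ids E - ids 0"
    unfolding ids_diff
  proof (rule integral_mono)
    fix \<omega>
    show "c * indicator A \<omega> \<le> spec_proj_diag (V \<omega>) (adj \<omega>) x0 E - spec_proj_diag (V \<omega>) (adj \<omega>) x0 0"
      using le[of \<omega>] lap_graph.spec_proj_diag_diff_le[OF lap E, of \<omega> x0] by (cases "\<omega> \<in> A") auto
  qed (use spec_integrable A in \<open>auto intro!: integrable_mult_right integrable_const_bound[of "indicator A" 1]\<close>)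
  then show ?thesis using A by simp
qed

text \<open>The bound 3 n covers both models: fewer than n open sites besides possibly the starting
  vertex, or fewer than n open edges with two endpoints each plus the starting vertex. The 18 is 2 *
  3^2, from the gap condition 2 |C|^2 E < 1.\<close>

lemma lifshitz_tail_ids:
  assumes s: "s > 1" and K: "K > 0" and b: "b > 0"
    and tail: "\<And>n. \<exists>B\<in>sets M. prob B \<le> K / s ^ n \<and> (\<forall>\<omega>\<in>space M - B.
        finite {y. (adj \<omega>)\<^sup>*\<^sup>* x0 y} \<and> card {y. (adj \<omega>)\<^sup>*\<^sup>* x0 y} \<le> 3 * n)"
    and paths: "\<And>n. 2 \<le> n \<Longrightarrow> \<exists>A\<in>sets M. \<exists>w. b ^ n \<le> prob A \<and> inj_on w {..<n} \<and> w 0 = x0 \<and>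
        (\<forall>\<omega>\<in>A. x0 \<in> V \<omega> \<and> (\<forall>i<n. {y. adj \<omega> (w i) y} = w ` {j. j < n \<and> (j = Suc i \<or> i = Suc j)}))"
  shows "lifshitz_tail ids"
proof (rule lifshitz_tailI[OF s K b])
  fix n :: nat and E :: real assume E: "0 < E" "18 * (real n)\<^sup>2 * E < 1"
  obtain B where B: "B \<in> sets M" "prob B \<le> K / s ^ n"
    and fin: "\<And>\<omega>. \<omega> \<in> space M - B \<Longrightarrow> finite {y. (adj \<omega>)\<^sup>*\<^sup>* x0 y}"
    and card: "\<And>\<omega>. \<omega> \<in> space M - B \<Longrightarrow> card {y. (adj \<omega>)\<^sup>*\<^sup>* x0 y} \<le> 3 * n"
    using tail[of n] by blast
  have "ids E - ids 0 \<le> prob B"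
  proof (rule ids_diff_upper[OF B(1)])
    fix \<omega> assume w: "\<omega> \<in> space M - B"
    have "(real (card {y. (adj \<omega>)\<^sup>*\<^sup>* x0 y}))\<^sup>2 \<le> (real (3 * n))\<^sup>2"
      by (intro power_mono) (use card[OF w] in simp_all)
    then have "2 * (real (card {y. (adj \<omega>)\<^sup>*\<^sup>* x0 y}))\<^sup>2 * E \<le> 18 * (real n)\<^sup>2 * E"
      using E by (intro mult_right_mono) (auto simp: power_mult_distrib)
    then have "2 * (real (card {y. (adj \<omega>)\<^sup>*\<^sup>* x0 y}))\<^sup>2 * E < 1" using E by linarith
    then show "spec_proj_diag (V \<omega>) (adj \<omega>) x0 E = spec_proj_diag (V \<omega>) (adj \<omega>) x0 0"
      using E by (intro lap_graph.cluster_spectral_gap[OF lap fin[OF w]]) auto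
  qed (use E in simp)
  then show "ids E - ids 0 \<le> K / s ^ n" using B by simp
next
  fix n :: nat and E :: real assume n: "2 \<le> n" and E: "(pi / real n)\<^sup>2 \<le> E"
  obtain A w where A: "A \<in> sets M" "b ^ n \<le> prob A" and w: "inj_on w {..<n}" "w 0 = x0"
    and nb: "\<And>\<omega>. \<omega> \<in> A \<Longrightarrow> x0 \<in> V \<omega>"
      "\<And>\<omega> i. \<omega> \<in> A \<Longrightarrow> i < n \<Longrightarrow> {y. adj \<omega> (w i) y} = w ` {j. j < n \<and> (j = Suc i \<or> i = Suc j)}"
    using paths[OF n] by blast
  have "1 / (2 * real n) * prob A \<le> ids E - ids 0"
  proof (rule ids_diff_lower[OF A(1)])
    show "0 \<le> E" using E zero_le_power2 order_trans by blast
    fix \<omega> assume "\<omega> \<in> A"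
    then show "1 / (2 * real n) \<le> spec_proj_diag (V \<omega>) (adj \<omega>) x0 E - spec_proj_diag (V \<omega>) (adj \<omega>) x0 0"
      unfolding w(2)[symmetric] using nb w(2)
      by (intro lap_graph.path_spectrum[OF lap n w(1) _ _ E]) auto
  qed
  moreover have "b ^ n / (2 * real n) \<le> 1 / (2 * real n) * prob A"
    using A by (simp add: divide_right_mono)
  ultimately show "b ^ n / (2 * real n) \<le> ids E - ids 0" by linarith
qed

end

text \<open>Places the parameter 0 in the set whose supremum is the critical parameter, which is
  therefore nonempty. Countability of \<open>I\<close> lets the null events of all coordinates be
  united.\<close>

lemma bfield_0:
  assumes "countable I"
  shows "AE \<omega> in bfield I 0. \<forall>v\<in>I. \<not> \<omega> v"
proof (rule AE_ball_countable'[OF _ assms])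
  fix v assume v: "v \<in> I"
  interpret prob_space "bfield I 0" by (rule prob_space_bfield)
  have eq: "{\<omega> \<in> space (bfield I 0). {u\<in>{v}. \<omega> u} = {v}} = {\<omega> \<in> space (bfield I 0). \<not> \<not> \<omega> v}"
    by auto
  have "prob {\<omega> \<in> space (bfield I 0). \<not> \<not> \<omega> v} = 0"
    using bfield_cylinder[of "{v}" I "{v}" 0] v unfolding eq by simp
  moreover have "{\<omega> \<in> space (bfield I 0). \<not> \<not> \<omega> v} \<in> sets (bfield I 0)"
    using bfield_coordinate[OF v] by simp
  ultimately show "AE \<omega> in bfield I 0. \<not> \<omega> v"
    by (subst AE_iff_measurable[OF _ refl]) (simp_all add: emeasure_eq_measure)
qed

section \<open>Cayley graphs, word length and geodesics\<close>

context
  fixes S :: "'g::group_add set"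
  assumes gen: "finite_symm_gen_set S"
begin

lemma S_fin: "finite S" and S_0: "0 \<notin> S" and S_minus: "s \<in> S \<Longrightarrow> - s \<in> S"
  and S_gen: "\<exists>xs. set xs \<subseteq> S \<and> x = sum_list xs"
  using gen by (auto simp: finite_symm_gen_set_def)

lemma countable_group: "countable (UNIV :: 'g set)"
proof -
  have "(UNIV :: 'g set) \<subseteq> sum_list ` lists S"
    using S_gen by (force simp: in_lists_conv_set)
  moreover have "countable (sum_list ` lists S)"
    using S_fin by (intro countable_image countable_lists) (simp add: countable_finite)
  ultimately show ?thesis by (rule countable_subset)
qed

lemma cayley_nbrs: "{y. cayley_adj S x y} = (+) x ` S"
proof -
  have "y \<in> (+) x ` S" if "- x + y \<in> S" for y
    using that by (intro image_eqI[of _ _ "- x + y"]) (auto simp: add.assoc[symmetric])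
  then show ?thesis by (auto simp: cayley_adj_def add.assoc[symmetric])
qed

lemma cayley_fin: "finite {y. cayley_adj S x y}"
  using S_fin by (simp add: cayley_nbrs)

lemma cayley_card: "card {y. cayley_adj S x y} \<le> card S"
  using S_fin by (simp add: cayley_nbrs card_image_le)

lemma cayley_sym: "cayley_adj S x y \<Longrightarrow> cayley_adj S y x"
  using S_minus[of "- x + y"] by (simp add: cayley_adj_def minus_add)

lemma cayley_irrefl: "\<not> cayley_adj S x x"
  using S_0 by (simp add: cayley_adj_def)

lemma cayley_translate: "cayley_adj S (v + x) (v + y) \<longleftrightarrow> cayley_adj S x y"
proof -
  have "- (v + x) + (v + y) = - x + (- v + (v + y))" by (simp only: minus_add add.assoc)
  then show ?thesis by (simp add: cayley_adj_def)
qed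

definition wlen :: "'g \<Rightarrow> nat" where
  "wlen x = (LEAST n. \<exists>xs. set xs \<subseteq> S \<and> x = sum_list xs \<and> length xs = n)"

lemma wlen_le: "set xs \<subseteq> S \<Longrightarrow> wlen (sum_list xs) \<le> length xs"
  unfolding wlen_def by (rule Least_le) auto

lemma wlen_ex: obtains xs where "set xs \<subseteq> S" "x = sum_list xs" "length xs = wlen x"
proof -
  have "\<exists>n xs. set xs \<subseteq> S \<and> x = sum_list xs \<and> length xs = n" using S_gen[of x] by auto
  then have "\<exists>xs. set xs \<subseteq> S \<and> x = sum_list xs \<and> length xs = wlen x"
    unfolding wlen_def by (rule LeastI_ex)
  then show thesis using that by blast
qed

lemma wlen_adj: "cayley_adj S x y \<Longrightarrow> wlen y \<le> Suc (wlen x)"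
proof -
  assume a: "cayley_adj S x y"
  obtain xs where xs: "set xs \<subseteq> S" "x = sum_list xs" "length xs = wlen x" by (rule wlen_ex)
  have "y = sum_list (xs @ [- x + y])" using xs by (simp add: add.assoc[symmetric])
  then show ?thesis
    using wlen_le[of "xs @ [- x + y]"] xs a by (simp add: cayley_adj_def)
qed

text \<open>Balls are finite, so an infinite group has an element of word length above n;
  \<open>w\<close> runs through the prefixes of a shortest word for it. The prefix of length i has
  word length exactly i, for otherwise the whole word could be shortened. Distinct lengths make
  \<open>w\<close> injective, and there are no chords because word length changes by at most 1 along
  an edge.\<close>

lemma geodesic:
  assumes "infinite (UNIV :: 'g set)"
  obtains w where "w 0 = 0" "inj_on w {..<n}"
    "\<And>i. Suc i < n \<Longrightarrow> cayley_adj S (w i) (w (Suc i))"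
    "\<And>i j. i < n \<Longrightarrow> j < n \<Longrightarrow> cayley_adj S (w i) (w j) \<Longrightarrow> j = Suc i \<or> i = Suc j"
proof -
  have "finite {x. wlen x \<le> n}"
  proof (rule finite_subset)
    show "{x. wlen x \<le> n} \<subseteq> sum_list ` {xs. set xs \<subseteq> S \<and> length xs \<le> n}"
    proof
      fix x assume "x \<in> {x. wlen x \<le> n}"
      then show "x \<in> sum_list ` {xs. set xs \<subseteq> S \<and> length xs \<le> n}"
        using wlen_ex[of x] by (metis (mono_tags, lifting) image_eqI mem_Collect_eq)
    qed
    show "finite (sum_list ` {xs. set xs \<subseteq> S \<and> length xs \<le> n})"
      using finite_lists_length_le[OF S_fin] by simp
  qed
  then obtain x where x: "wlen x > n"
    using assms by (metis (mono_tags, lifting) finite_subset mem_Collect_eq not_le subsetI)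
  obtain xs where xs: "set xs \<subseteq> S" "x = sum_list xs" "length xs = wlen x" by (rule wlen_ex)
  define w where "w i = sum_list (take i xs)" for i
  have wl: "wlen (w i) = i" if i: "i < n" for i
  proof (rule antisym)
    show "wlen (w i) \<le> i"
      using wlen_le[of "take i xs"] xs i x set_take_subset[of i xs] by (simp add: w_def)
    show "i \<le> wlen (w i)"
    proof (rule ccontr)
      assume less: "\<not> i \<le> wlen (w i)"
      obtain ys where ys: "set ys \<subseteq> S" "w i = sum_list ys" "length ys = wlen (w i)" by (rule wlen_ex)
      have "x = w i + sum_list (drop i xs)"
        by (simp add: w_def xs(2) flip: sum_list_append)
      then have "x = sum_list (ys @ drop i xs)" using ys by simp
      moreover have "set (ys @ drop i xs) \<subseteq> S" using ys xs set_drop_subset[of i xs] by auto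
      ultimately have "wlen x \<le> length (ys @ drop i xs)" using wlen_le by metis
      then show False using less ys xs i x by simp
    qed
  qed
  show thesis
  proof (rule that[of w])
    show "w 0 = 0" by (simp add: w_def)
    show "inj_on w {..<n}" using wl by (metis inj_onI lessThan_iff)
    show "cayley_adj S (w i) (w (Suc i))" if "Suc i < n" for i
    proof -
      have il: "i < length xs" using that xs x by simp
      then have "w (Suc i) = w i + xs ! i" by (simp add: w_def take_Suc_conv_app_nth)
      then have "- w i + w (Suc i) = xs ! i" by (simp add: add.assoc[symmetric])
      then show ?thesis using il xs(1) by (auto simp: cayley_adj_def)
    qed
    show "j = Suc i \<or> i = Suc j" if "i < n" "j < n" "cayley_adj S (w i) (w j)" for i j
    proof -
      have "i \<noteq> j" using that cayley_irrefl by auto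
      moreover have "j \<le> Suc i" "i \<le> Suc j"
        using wlen_adj[OF that(3)] wlen_adj[OF cayley_sym[OF that(3)]] wl that by auto
      ultimately show ?thesis by linarith
    qed
  qed
qed

text \<open>The free function \<open>f\<close> serves both models: the identity counts neighbouring
  sites, and sending y to {w i, y} counts incident edges.\<close>

lemma card_path_nbhd: "card (\<Union>i<n. f i ` {y. cayley_adj S (w i) y}) \<le> n * card S"
proof -
  have "card (\<Union>i<n. f i ` {y. cayley_adj S (w i) y}) \<le> (\<Sum>i<n. card (f i ` {y. cayley_adj S (w i) y}))"
    by (rule card_UN_le) simp
  also have "\<dots> \<le> (\<Sum>i<n. card S)"
    by (intro sum_mono order_trans[OF card_image_le[OF cayley_fin] cayley_card])
  finally show ?thesis by simp
qed

text \<open>The base p (1 - p)^|S| pays, for every vertex of the path, for at most one open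
  coordinate and at most |S| closed ones.\<close>

lemma cylinder_lower_bound:
  assumes L: "finite L" "L \<subseteq> I" "\<eta> \<subseteq> L" and p: "0 < p" "p < 1"
    and card: "card \<eta> \<le> n" "card (L - \<eta>) \<le> n * card S"
  shows "(p * (1 - p) ^ card S) ^ n
     \<le> measure (bfield I p) {\<omega> \<in> space (bfield I p). {v\<in>L. \<omega> v} = \<eta>}"
proof -
  have "(p * (1 - p) ^ card S) ^ n = p ^ n * (1 - p) ^ (n * card S)"
    by (simp add: power_mult_distrib mult.commute flip: power_mult)
  also have "\<dots> \<le> p ^ card \<eta> * (1 - p) ^ card (L - \<eta>)"
    using p card by (intro mult_mono power_decreasing) auto
  finally show ?thesis using bfield_cylinder[OF L, of p] p by simp
qed

section \<open>Site percolation\<close>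

lemma lap_site: "lap_graph (site_verts \<omega>) (site_adj S \<omega>) (card S)"
proof
  fix x y
  have sub: "{y. site_adj S \<omega> x y} \<subseteq> {y. cayley_adj S x y}" by (auto simp: site_adj_def)
  show "site_adj S \<omega> x y \<Longrightarrow> site_adj S \<omega> y x" by (auto simp: site_adj_def cayley_sym)
  show "site_adj S \<omega> x y \<Longrightarrow> x \<in> site_verts \<omega>" by (auto simp: site_adj_def site_verts_def)
  show "finite {y. site_adj S \<omega> x y}" using sub cayley_fin by (rule finite_subset)
  show "card {y. site_adj S \<omega> x y} \<le> card S"
    using card_mono[OF cayley_fin sub] cayley_card by (rule order_trans)
qed

lemma perc_site: "perc_graph UNIV (cayley_adj S) (card S)"
  by unfold_locales (auto simp: cayley_sym cayley_fin cayley_card)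

lemma site_clus_le:
  assumes "y \<in> clus (cayley_adj S) {v. \<omega> v} {a}"
  shows "\<omega> a" "\<omega> y" "(site_adj S \<omega>)\<^sup>*\<^sup>* a y"
  using assms
  by (induction) (auto simp: site_adj_def intro: rtranclp.rtrancl_into_rtrancl)

text \<open>The reflexive closure contains \<open>a\<close> even when \<open>a\<close> is closed and
  its cluster is empty, hence the \<open>insert\<close>.\<close>

lemma site_clus_ge:
  assumes "(site_adj S \<omega>)\<^sup>*\<^sup>* a y"
  shows "y \<in> insert a (clus (cayley_adj S) {v. \<omega> v} {a})"
  using assms
proof induction
  case (step y z)
  have "y \<in> clus (cayley_adj S) {v. \<omega> v} {a}"
    using step by (auto simp: site_adj_def intro: clus.seed)
  then show ?case using step by (auto simp: site_adj_def intro: clus.step)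
qed simp

text \<open>Any member of the defining set above p will do: the sharpness argument compares p with
  some larger q at which clusters are almost surely finite.\<close>

lemma pc_site_obtain:
  assumes "p < pc_site S"
  obtains q where "p < q" "q \<le> 1"
    "AE \<omega> in bfield UNIV q. \<not> has_infinite_component (site_verts \<omega>) (site_adj S \<omega>)"
proof -
  let ?X = "{p \<in> {0..1}. AE \<omega> in site_measure S p. \<not> has_infinite_component (site_verts \<omega>) (site_adj S \<omega>)}"
  have "AE \<omega> in site_measure S 0. \<not> has_infinite_component (site_verts \<omega>) (site_adj S \<omega>)"
    unfolding site_measure_def
    using bfield_0[OF countable_group]
    by eventually_elim (auto simp: has_infinite_component_def site_verts_def)
  then have "0 \<in> ?X" by simp
  then obtain q where "q \<in> ?X" "p < q"
    using less_cSupE[of p ?X] assms unfolding pc_site_def by blast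
  then show thesis using that[of q] unfolding site_measure_def by simp
qed

lemma lifshitz_site:
  assumes inf: "infinite (UNIV :: 'g set)" and p: "0 < p" "p < pc_site S"
  shows "lifshitz_tail (ids_site S p)"
proof -
  obtain q where q: "p < q" "q \<le> 1"
    and AE: "AE \<omega> in bfield UNIV q. \<not> has_infinite_component (site_verts \<omega>) (site_adj S \<omega>)"
    using pc_site_obtain[OF p(2)] by blast
  let ?M = "bfield (UNIV :: 'g set) p"
  interpret perc_graph UNIV "cayley_adj S" "card S" by (rule perc_site)
  interpret prob_space ?M by (rule prob_space_bfield)
  have coord: "{\<omega> \<in> space ?M. \<omega> x} \<in> sets ?M" for x by (rule bfield_coordinate) simp
  interpret R: random_lap_graph ?M site_verts "site_adj S" "card S" "\<lambda>x. {y. cayley_adj S x y}" "0 :: 'g"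
  proof (intro random_lap_graph.intro random_lap_graph_axioms.intro prob_space_axioms)
    fix x y :: 'g
    show "{\<omega> \<in> space ?M. site_adj S \<omega> x y} \<in> sets ?M"
      using sets.Int[OF coord[of x] coord[of y]]
      by (cases "cayley_adj S x y") (auto simp: site_adj_def Int_def conj_ac)
    show "{\<omega> \<in> space ?M. 0 \<in> site_verts \<omega>} \<in> sets ?M"
      using coord[of 0] by (simp add: site_verts_def)
    show "site_adj S \<omega> x y \<Longrightarrow> y \<in> {y. cayley_adj S x y}" for \<omega> by (simp add: site_adj_def)
  qed (rule lap_site cayley_fin)+
  have fin: "AE \<omega> in bfield UNIV q. finite (clus (cayley_adj S) {v\<in>UNIV. \<omega> v} {a})" for a
    using AE
  proof eventually_elim
    case (elim \<omega>)
    show ?case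
    proof (cases "\<omega> a")
      case True
      then have "finite {y. (site_adj S \<omega>)\<^sup>*\<^sup>* a y}"
        using elim by (auto simp: has_infinite_component_def site_verts_def)
      moreover have "clus (cayley_adj S) {v\<in>UNIV. \<omega> v} {a} \<subseteq> {y. (site_adj S \<omega>)\<^sup>*\<^sup>* a y}"
        using site_clus_le(3)[of _ \<omega> a] by auto
      ultimately show ?thesis by (rule finite_subset[rotated])
    next
      case False
      then have "clus (cayley_adj S) {v\<in>UNIV. \<omega> v} {a} = {}"
        using site_clus_le(1)[of _ \<omega> a] by auto
      then show ?thesis by simp
    qed
  qed
  \<comment> \<open>Left translations act transitively on the vertices, so the identity represents
    the only orbit.\<close>
  have "\<exists>a\<in>{0}. \<exists>g. bij_betw g UNIV UNIV \<and>
      (\<forall>x\<in>UNIV. \<forall>y\<in>UNIV. cayley_adj S (g x) (g y) \<longleftrightarrow> cayley_adj S x y) \<and> g a = v" for v :: 'g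
  proof -
    have "bij_betw ((+) v) UNIV UNIV"
      by (rule bij_betw_byWitness[of _ "(+) (- v)"]) (auto simp: add.assoc[symmetric])
    then show ?thesis by (auto simp: cayley_translate intro!: exI[of _ "(+) v"])
  qed
  from exponential_cluster_tail[OF _ q fin _ _ this] p(1)
  obtain s z where s: "s > 1" and z: "z \<ge> 1" and
    tail: "\<And>Q n. finite Q \<Longrightarrow> \<exists>B \<in> sets ?M. prob B \<le> z ^ card Q / s ^ n \<and>
       (\<forall>\<omega> \<in> space ?M - B. finite (clus (cayley_adj S) {v\<in>UNIV. \<omega> v} Q)
          \<and> card (clus (cayley_adj S) {v\<in>UNIV. \<omega> v} Q) < n)"
    by auto
  have p1: "p < 1" using q by simp
  define b where "b = p * (1 - p) ^ card S"
  have "lifshitz_tail R.ids"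
  proof (rule R.lifshitz_tail_ids[OF s])
    show "z > 0" using z by simp
    show "b > 0" using p p1 by (simp add: b_def)
  next
    fix n
    obtain B where B: "B \<in> sets ?M" "prob B \<le> z / s ^ n"
      and cl: "\<And>\<omega>. \<omega> \<in> space ?M - B \<Longrightarrow> finite (clus (cayley_adj S) {v. \<omega> v} {0})"
        "\<And>\<omega>. \<omega> \<in> space ?M - B \<Longrightarrow> card (clus (cayley_adj S) {v. \<omega> v} {0}) < n"
      using tail[of "{0}" n] by auto
    have "finite {y. (site_adj S \<omega>)\<^sup>*\<^sup>* 0 y} \<and> card {y. (site_adj S \<omega>)\<^sup>*\<^sup>* 0 y} \<le> 3 * n"
      if w: "\<omega> \<in> space ?M - B" for \<omega>
    proof -
      let ?C = "clus (cayley_adj S) {v. \<omega> v} {0}"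
      have sub: "{y. (site_adj S \<omega>)\<^sup>*\<^sup>* 0 y} \<subseteq> insert 0 ?C" using site_clus_ge by auto
      have fin: "finite (insert 0 ?C)" using cl(1)[OF w] by simp
      have "card {y. (site_adj S \<omega>)\<^sup>*\<^sup>* 0 y} \<le> card (insert 0 ?C)" by (rule card_mono[OF fin sub])
      also have "\<dots> \<le> Suc (card ?C)" by (rule card_insert_le_m1) simp_all
      also have "\<dots> \<le> 3 * n" using cl(2)[OF w] by simp
      finally show ?thesis using finite_subset[OF sub fin] by simp
    qed
    then show "\<exists>B\<in>sets ?M. prob B \<le> z / s ^ n \<and> (\<forall>\<omega>\<in>space ?M - B.
        finite {y. (site_adj S \<omega>)\<^sup>*\<^sup>* 0 y} \<and> card {y. (site_adj S \<omega>)\<^sup>*\<^sup>* 0 y} \<le> 3 * n)"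
      using B by blast
  next
    fix n :: nat assume n: "2 \<le> n"
    obtain w where w: "w 0 = 0" "inj_on w {..<n}"
      "\<And>i. Suc i < n \<Longrightarrow> cayley_adj S (w i) (w (Suc i))"
      "\<And>i j. i < n \<Longrightarrow> j < n \<Longrightarrow> cayley_adj S (w i) (w j) \<Longrightarrow> j = Suc i \<or> i = Suc j"
      by (rule geodesic[OF inf, of n]) blast
    \<comment> \<open>Among the path and its neighbours exactly the path is to be open. As the
      geodesic has no chords, the open cluster is then the path as a graph.\<close>
    define \<eta> where "\<eta> = w ` {..<n}"
    define L where "L = \<eta> \<union> (\<Union>i<n. id ` {y. cayley_adj S (w i) y})"
    have Lf: "finite L" using cayley_fin by (auto simp: L_def \<eta>_def)
    define A where "A = {\<omega> \<in> space ?M. {v\<in>L. \<omega> v} = \<eta>}"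
    have As: "A \<in> sets ?M" unfolding A_def by (rule bfield_cylinder_sets[OF Lf]) simp
    have c1: "card \<eta> \<le> n" unfolding \<eta>_def using card_image_le[of "{..<n}" w] by simp
    have "card (L - \<eta>) \<le> card (\<Union>i<n. id ` {y. cayley_adj S (w i) y})"
      using cayley_fin by (intro card_mono) (auto simp: L_def)
    then have c2: "card (L - \<eta>) \<le> n * card S"
      using card_path_nbhd[of "\<lambda>_. id" w n] by linarith
    have Ap: "b ^ n \<le> prob A"
      unfolding A_def b_def by (rule cylinder_lower_bound[OF Lf _ _ p(1) p1 c1 c2]) (auto simp: L_def)
    have "0 \<in> site_verts \<omega> \<and> (\<forall>i<n. {y. site_adj S \<omega> (w i) y} = w ` {j. j < n \<and> (j = Suc i \<or> i = Suc j)})"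
      if "\<omega> \<in> A" for \<omega>
    proof (intro conjI allI impI)
      have op: "\<omega> v \<longleftrightarrow> v \<in> \<eta>" if "v \<in> L" for v using \<open>\<omega> \<in> A\<close> that by (auto simp: A_def)
      have wop: "\<omega> (w i)" if "i < n" for i using op[of "w i"] that by (auto simp: L_def \<eta>_def)
      show "0 \<in> site_verts \<omega>" using wop[of 0] n w(1) by (simp add: site_verts_def)
      fix i assume i: "i < n"
      show "{y. site_adj S \<omega> (w i) y} = w ` {j. j < n \<and> (j = Suc i \<or> i = Suc j)}"
      proof (intro equalityI subsetI)
        fix y assume "y \<in> {y. site_adj S \<omega> (w i) y}"
        then have y: "cayley_adj S (w i) y" "\<omega> y" by (auto simp: site_adj_def)
        then have "y \<in> L" using i by (auto simp: L_def)
        then obtain j where "y = w j" "j < n" using op y by (auto simp: \<eta>_def)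
        then show "y \<in> w ` {j. j < n \<and> (j = Suc i \<or> i = Suc j)}" using w(4)[OF i] y by auto
      next
        fix y assume "y \<in> w ` {j. j < n \<and> (j = Suc i \<or> i = Suc j)}"
        then obtain j where j: "y = w j" "j < n" "j = Suc i \<or> i = Suc j" by auto
        then have "cayley_adj S (w i) (w j)" using w(3)[of i] cayley_sym[OF w(3)[of j]] i by auto
        then show "y \<in> {y. site_adj S \<omega> (w i) y}" using j i wop by (auto simp: site_adj_def)
      qed
    qed
    then show "\<exists>A\<in>sets ?M. \<exists>w. b ^ n \<le> prob A \<and> inj_on w {..<n} \<and> w 0 = 0 \<and>
        (\<forall>\<omega>\<in>A. 0 \<in> site_verts \<omega> \<and> (\<forall>i<n. {y. site_adj S \<omega> (w i) y} = w ` {j. j < n \<and> (j = Suc i \<or> i = Suc j)}))"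
      using As Ap w by blast
  qed
  then show ?thesis by (simp add: ids_site_def[abs_def] site_measure_def)
qed


section \<open>Bond percolation as site percolation on the line graph\<close>

definition bond_nbr :: "'g set \<Rightarrow> 'g set \<Rightarrow> bool" where
  "bond_nbr e f \<longleftrightarrow> e \<in> cayley_edges S \<and> f \<in> cayley_edges S \<and> e \<inter> f \<noteq> {}"

lemma cayley_edgesI: "cayley_adj S x y \<Longrightarrow> {x, y} \<in> cayley_edges S"
  by (auto simp: cayley_edges_def)

lemma cayley_edges_endpoint:
  assumes "f \<in> cayley_edges S" "x \<in> f"
  obtains y where "f = {x, y}" "cayley_adj S x y"
proof -
  obtain a b where f: "f = {a, b}" "cayley_adj S a b" using assms(1) by (auto simp: cayley_edges_def)
  show thesis
  proof (cases "x = a")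
    case False
    then have "x = b" using f assms(2) by auto
    then show thesis using f cayley_sym that[of a] by (auto simp: insert_commute)
  qed (use f that in auto)
qed

lemma bond_adj_edge: "bond_adj S \<omega> x y \<Longrightarrow> {x, y} \<in> cayley_edges S \<and> \<omega> {x, y}"
  by (auto simp: bond_adj_def cayley_edgesI)

lemma bond_adj_sym: "bond_adj S \<omega> x y \<Longrightarrow> bond_adj S \<omega> y x"
  by (auto simp: bond_adj_def cayley_sym insert_commute)

lemma lap_bond: "lap_graph (bond_verts S \<omega>) (bond_adj S \<omega>) (card S)"
proof
  fix x y
  have sub: "{y. bond_adj S \<omega> x y} \<subseteq> {y. cayley_adj S x y}" by (auto simp: bond_adj_def)
  show "bond_adj S \<omega> x y \<Longrightarrow> bond_adj S \<omega> y x" by (rule bond_adj_sym)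
  show "bond_adj S \<omega> x y \<Longrightarrow> x \<in> bond_verts S \<omega>" by (auto simp: bond_verts_def)
  show "finite {y. bond_adj S \<omega> x y}" using sub cayley_fin by (rule finite_subset)
  show "card {y. bond_adj S \<omega> x y} \<le> card S"
    using card_mono[OF cayley_fin sub] cayley_card by (rule order_trans)
qed

lemma bond_nbr_sub:
  assumes "e = {a, b}"
  shows "{f. bond_nbr e f} \<subseteq> (\<lambda>y. {a, y}) ` {y. cayley_adj S a y} \<union> (\<lambda>y. {b, y}) ` {y. cayley_adj S b y}"
proof
  fix f assume "f \<in> {f. bond_nbr e f}"
  then have f: "f \<in> cayley_edges S" "a \<in> f \<or> b \<in> f" using assms by (auto simp: bond_nbr_def)
  from f(2) show "f \<in> (\<lambda>y. {a, y}) ` {y. cayley_adj S a y} \<union> (\<lambda>y. {b, y}) ` {y. cayley_adj S b y}"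
  proof
    assume "a \<in> f"
    with f(1) obtain y where "f = {a, y}" "cayley_adj S a y" by (rule cayley_edges_endpoint)
    then show ?thesis by auto
  next
    assume "b \<in> f"
    with f(1) obtain y where "f = {b, y}" "cayley_adj S b y" by (rule cayley_edges_endpoint)
    then show ?thesis by auto
  qed
qed

text \<open>An edge meets at most |S| edges, itself included, at each of its two endpoints.\<close>

lemma perc_bond: "perc_graph (cayley_edges S) bond_nbr (2 * card S)"
proof
  fix e f
  show "bond_nbr e f \<Longrightarrow> bond_nbr f e" "bond_nbr e f \<Longrightarrow> e \<in> cayley_edges S"
    by (auto simp: bond_nbr_def)
  have "finite {f. bond_nbr e f} \<and> card {f. bond_nbr e f} \<le> 2 * card S"
  proof (cases "e \<in> cayley_edges S")
    case True
    then obtain a b where e: "e = {a, b}" by (auto simp: cayley_edges_def)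
    let ?A = "(\<lambda>y. {a, y}) ` {y. cayley_adj S a y}" and ?B = "(\<lambda>y. {b, y}) ` {y. cayley_adj S b y}"
    have fin: "finite (?A \<union> ?B)" using cayley_fin by auto
    have "card {f. bond_nbr e f} \<le> card (?A \<union> ?B)" by (rule card_mono[OF fin bond_nbr_sub[OF e]])
    also have "\<dots> \<le> card ?A + card ?B" by (rule card_Un_le)
    also have "\<dots> \<le> card S + card S"
      by (intro add_mono order_trans[OF card_image_le[OF cayley_fin] cayley_card])
    finally show ?thesis using finite_subset[OF bond_nbr_sub[OF e] fin] by simp
  next
    case False
    then have "{f. bond_nbr e f} = {}" by (auto simp: bond_nbr_def)
    then show ?thesis by simp
  qed
  then show "finite {f. bond_nbr e f}" "card {f. bond_nbr e f} \<le> 2 * card S" by auto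
qed

text \<open>The vertices x and y are arbitrary in their edges: the two ends of an open edge are
  themselves joined, so a chain of intersecting open edges connects every vertex of the first to
  every vertex of the last.\<close>

lemma bond_clus_le:
  assumes "f \<in> clus bond_nbr {e\<in>cayley_edges S. \<omega> e} {e}" "x \<in> e" "y \<in> f"
  shows "(bond_adj S \<omega>)\<^sup>*\<^sup>* x y"
proof -
  have conn: "(bond_adj S \<omega>)\<^sup>*\<^sup>* u v" if f: "f \<in> cayley_edges S" "\<omega> f" "u \<in> f" "v \<in> f" for u v f
  proof -
    obtain y where y: "f = {u, y}" "cayley_adj S u y" using cayley_edges_endpoint[OF f(1,3)] by blast
    then show ?thesis using f by (cases "v = u") (auto simp: bond_adj_def)
  qed
  from assms(1,3) show ?thesis
  proof (induction arbitrary: y)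
    case (seed f)
    then show ?case using conn assms(2) by auto
  next
    case (step f g)
    then obtain u where u: "u \<in> f" "u \<in> g" by (auto simp: bond_nbr_def)
    have "(bond_adj S \<omega>)\<^sup>*\<^sup>* x u" using step.IH u by simp
    moreover have "(bond_adj S \<omega>)\<^sup>*\<^sup>* u y" using conn[of g u y] step u by auto
    ultimately show ?case by (rule rtranclp_trans)
  qed
qed

text \<open>All edges at x serve as seeds, since it is not known beforehand which of them are open;
  a vertex without open edges is its own cluster, hence the \<open>insert\<close>.\<close>

lemma bond_clus_ge:
  assumes "(bond_adj S \<omega>)\<^sup>*\<^sup>* x y"
  shows "y \<in> insert x (\<Union>(clus bond_nbr {e\<in>cayley_edges S. \<omega> e} {e\<in>cayley_edges S. x \<in> e}))"
  using assms
proof induction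
  case (step y z)
  let ?C = "clus bond_nbr {e\<in>cayley_edges S. \<omega> e} {e\<in>cayley_edges S. x \<in> e}"
  note yz = bond_adj_edge[OF step(2)]
  have "{y, z} \<in> ?C"
  proof (cases "y = x")
    case True
    then show ?thesis using yz by (intro clus.seed) auto
  next
    case False
    then obtain f where f: "f \<in> ?C" "y \<in> f" using step by auto
    have "f \<in> cayley_edges S" using f(1) clus_subset by fast
    then have "bond_nbr f {y, z}" using yz f by (auto simp: bond_nbr_def)
    with f(1) show ?thesis by (rule clus.step) (use yz in auto)
  qed
  then show ?case by auto
qed simp

lemma pc_bond_obtain:
  assumes "p < pc_bond S"
  obtains q where "p < q" "q \<le> 1"
    "AE \<omega> in bfield (cayley_edges S) q. \<not> has_infinite_component (bond_verts S \<omega>) (bond_adj S \<omega>)"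
proof -
  let ?X = "{p \<in> {0..1}. AE \<omega> in bond_measure S p. \<not> has_infinite_component (bond_verts S \<omega>) (bond_adj S \<omega>)}"
  have "cayley_edges S \<subseteq> (\<lambda>(x, y). {x, y}) ` (UNIV \<times> UNIV)" by (auto simp: cayley_edges_def)
  then have cnt: "countable (cayley_edges S)"
    using countable_group by (meson countable_SIGMA countable_image countable_subset)
  have "AE \<omega> in bond_measure S 0. \<not> has_infinite_component (bond_verts S \<omega>) (bond_adj S \<omega>)"
    unfolding bond_measure_def
    using bfield_0[OF cnt]
  proof eventually_elim
    case (elim \<omega>)
    then have "bond_verts S \<omega> = {}" using bond_adj_edge by (fastforce simp: bond_verts_def)
    then show ?case by (simp add: has_infinite_component_def)
  qed
  then have "0 \<in> ?X" by simp
  then obtain q where "q \<in> ?X" "p < q"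
    using less_cSupE[of p ?X] assms unfolding pc_bond_def by blast
  then show thesis using that[of q] unfolding bond_measure_def by simp
qed

text \<open>The edge {x, y} is the translate by x of {0, - x + y}. Translations need not act
  transitively on edges, but they have at most |S| orbits.\<close>

lemma bond_orbits:
  assumes "e \<in> cayley_edges S"
  shows "\<exists>a\<in>{{0, s} | s. s \<in> S}. \<exists>g. bij_betw g (cayley_edges S) (cayley_edges S) \<and>
      (\<forall>x\<in>cayley_edges S. \<forall>y\<in>cayley_edges S. bond_nbr (g x) (g y) \<longleftrightarrow> bond_nbr x y) \<and> g a = e"
proof -
  obtain x y where e: "e = {x, y}" "cayley_adj S x y" using assms by (auto simp: cayley_edges_def)
  let ?g = "\<lambda>v. image ((+) v)"
  have gI: "?g v f \<in> cayley_edges S" if f: "f \<in> cayley_edges S" for v f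
  proof -
    obtain a b where "f = {a, b}" "cayley_adj S a b" using f by (auto simp: cayley_edges_def)
    then show ?thesis using cayley_edgesI[of "v + a" "v + b"] by (simp add: cayley_translate)
  qed
  have inv: "?g (- v) (?g v f) = f" "?g v (?g (- v) f) = f" for v and f :: "'g set"
    by (simp_all add: image_image add.assoc[symmetric])
  have "bij_betw (?g x) (cayley_edges S) (cayley_edges S)"
    by (rule bij_betw_byWitness[of _ "?g (- x)"]) (use inv gI in auto)
  moreover have "bond_nbr (?g x f) (?g x f') \<longleftrightarrow> bond_nbr f f'" if "f \<in> cayley_edges S" "f' \<in> cayley_edges S" for f f'
  proof -
    have "?g x f \<inter> ?g x f' = ?g x (f \<inter> f')" by (rule image_Int[symmetric]) (simp add: inj_on_def)
    then show ?thesis using that gI by (simp add: bond_nbr_def)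
  qed
  moreover have "?g x {0, - x + y} = e" using e by (simp add: add.assoc[symmetric])
  moreover have "- x + y \<in> S" using e(2) by (simp add: cayley_adj_def)
  ultimately show ?thesis by (intro bexI[of _ "{0, - x + y}"] exI[of _ "?g x"]) auto
qed

lemma lifshitz_bond:
  assumes inf: "infinite (UNIV :: 'g set)" and p: "0 < p" "p < pc_bond S"
  shows "lifshitz_tail (ids_bond S p)"
proof -
  let ?I = "cayley_edges S"
  obtain q where q: "p < q" "q \<le> 1"
    and AE: "AE \<omega> in bfield ?I q. \<not> has_infinite_component (bond_verts S \<omega>) (bond_adj S \<omega>)"
    using pc_bond_obtain[OF p(2)] by blast
  let ?M = "bfield ?I p"
  interpret perc_graph ?I bond_nbr "2 * card S" by (rule perc_bond)
  interpret prob_space ?M by (rule prob_space_bfield)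
  have adjm: "{\<omega> \<in> space ?M. bond_adj S \<omega> x y} \<in> sets ?M" for x y
    using bfield_coordinate[of "{x, y}" ?I p] cayley_edgesI[of x y]
    by (cases "cayley_adj S x y") (auto simp: bond_adj_def)
  have vertm: "{\<omega> \<in> space ?M. x \<in> bond_verts S \<omega>} \<in> sets ?M" for x
  proof -
    have "{\<omega> \<in> space ?M. x \<in> bond_verts S \<omega>} = (\<Union>y\<in>{y. cayley_adj S x y}. {\<omega> \<in> space ?M. bond_adj S \<omega> x y})"
      by (auto simp: bond_verts_def bond_adj_def)
    then show ?thesis using adjm cayley_fin by (simp add: sets.finite_UN)
  qed
  interpret R: random_lap_graph ?M "bond_verts S" "bond_adj S" "card S" "\<lambda>x. {y. cayley_adj S x y}" "0 :: 'g"
  proof (intro random_lap_graph.intro random_lap_graph_axioms.intro prob_space_axioms)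
    show "bond_adj S \<omega> x y \<Longrightarrow> y \<in> {y. cayley_adj S x y}" for \<omega> x y by (simp add: bond_adj_def)
  qed (rule lap_bond cayley_fin adjm vertm)+
  have fin: "AE \<omega> in bfield ?I q. finite (clus bond_nbr {e\<in>?I. \<omega> e} {e})"
    if e: "e \<in> ?I" for e
    using AE
  proof eventually_elim
    case (elim \<omega>)
    show ?case
    proof (cases "\<omega> e")
      case True
      obtain x y where xy: "e = {x, y}" "cayley_adj S x y" using e by (auto simp: cayley_edges_def)
      have "x \<in> bond_verts S \<omega>" using xy True by (auto simp: bond_verts_def bond_adj_def)
      then have "finite {z. (bond_adj S \<omega>)\<^sup>*\<^sup>* x z}"
        using elim by (auto simp: has_infinite_component_def)
      \<comment> \<open>A finite vertex cluster has finitely many subsets, and each edge of the edge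
        cluster is one of them.\<close>
      moreover have "clus bond_nbr {e\<in>?I. \<omega> e} {e} \<subseteq> Pow {z. (bond_adj S \<omega>)\<^sup>*\<^sup>* x z}"
        using bond_clus_le[of _ \<omega> e x] xy by auto
      ultimately show ?thesis by (meson finite_Pow_iff finite_subset)
    next
      case False
      have "f \<notin> clus bond_nbr {e\<in>?I. \<omega> e} {e}" for f
      proof
        assume "f \<in> clus bond_nbr {e\<in>?I. \<omega> e} {e}"
        then show False by induction (use False in auto)
      qed
      then have "clus bond_nbr {e\<in>?I. \<omega> e} {e} = {}" by blast
      then show ?thesis by simp
    qed
  qed
  have T: "finite {{0, s} | s. s \<in> S}" "{{0, s} | s. s \<in> S} \<subseteq> ?I"
    using S_fin by (auto intro!: cayley_edgesI simp: cayley_adj_def)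
  from exponential_cluster_tail[OF _ q fin T bond_orbits] p(1)
  obtain s z where s: "s > 1" and z: "z \<ge> 1" and
    tail: "\<And>Q n. finite Q \<Longrightarrow> Q \<subseteq> ?I \<Longrightarrow> \<exists>B \<in> sets ?M. prob B \<le> z ^ card Q / s ^ n \<and>
       (\<forall>\<omega> \<in> space ?M - B. finite (clus bond_nbr {e\<in>?I. \<omega> e} Q)
          \<and> card (clus bond_nbr {e\<in>?I. \<omega> e} Q) < n)"
    by auto
  have p1: "p < 1" using q by simp
  define b where "b = p * (1 - p) ^ card S"
  \<comment> \<open>The seeds for the cluster of the identity: all its Cayley graph edges, open or
    not.\<close>
  define Q where "Q = {e\<in>?I. 0 \<in> e}"
  have Q: "finite Q" "Q \<subseteq> ?I"
  proof -
    have "Q \<subseteq> (\<lambda>y. {0, y}) ` {y. cayley_adj S 0 y}"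
    proof
      fix e assume "e \<in> Q"
      then have "e \<in> ?I" "0 \<in> e" by (auto simp: Q_def)
      then obtain y where "e = {0, y}" "cayley_adj S 0 y" by (rule cayley_edges_endpoint)
      then show "e \<in> (\<lambda>y. {0, y}) ` {y. cayley_adj S 0 y}" by auto
    qed
    then show "finite Q" using cayley_fin by (meson finite_imageI finite_subset)
  qed (auto simp: Q_def)
  have "lifshitz_tail R.ids"
  proof (rule R.lifshitz_tail_ids[OF s])
    show "z ^ card Q > 0" using z by simp
    show "b > 0" using p p1 by (simp add: b_def)
  next
    fix n
    let ?C = "\<lambda>\<omega>. clus bond_nbr {e\<in>?I. \<omega> e} Q"
    obtain B where B: "B \<in> sets ?M" "prob B \<le> z ^ card Q / s ^ n"
      and cl: "\<And>\<omega>. \<omega> \<in> space ?M - B \<Longrightarrow> finite (?C \<omega>)"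
        "\<And>\<omega>. \<omega> \<in> space ?M - B \<Longrightarrow> card (?C \<omega>) < n"
      using tail[OF Q, of n] by blast
    have "finite {y. (bond_adj S \<omega>)\<^sup>*\<^sup>* 0 y} \<and> card {y. (bond_adj S \<omega>)\<^sup>*\<^sup>* 0 y} \<le> 3 * n"
      if w: "\<omega> \<in> space ?M - B" for \<omega>
    proof -
      have sub: "{y. (bond_adj S \<omega>)\<^sup>*\<^sup>* 0 y} \<subseteq> insert 0 (\<Union>(?C \<omega>))"
        using bond_clus_ge[of \<omega> 0] by (auto simp: Q_def)
      have two: "finite f \<and> card f \<le> 2" if "f \<in> ?C \<omega>" for f
      proof -
        have "f \<in> ?I" using that clus_subset by fast
        then obtain a b where "f = {a, b}" by (auto simp: cayley_edges_def)
        then show ?thesis by (simp add: card_insert_le_m1)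
      qed
      have fin: "finite (insert 0 (\<Union>(?C \<omega>)))" using cl(1)[OF w] two by auto
      have "card {y. (bond_adj S \<omega>)\<^sup>*\<^sup>* 0 y} \<le> card (insert 0 (\<Union>(?C \<omega>)))" by (rule card_mono[OF fin sub])
      also have "\<dots> \<le> Suc (card (\<Union>(?C \<omega>)))" by (rule card_insert_le_m1) simp_all
      also have "card (\<Union>(?C \<omega>)) \<le> (\<Sum>f\<in>?C \<omega>. card f)" by (rule card_Union_le_sum_card)
      also have "\<dots> \<le> (\<Sum>f\<in>?C \<omega>. 2)" using two by (intro sum_mono) auto
      also have "Suc (\<Sum>f\<in>?C \<omega>. 2) \<le> 3 * n" using cl(2)[OF w] by simp
      finally show ?thesis using finite_subset[OF sub fin] by simp
    qed
    then show "\<exists>B\<in>sets ?M. prob B \<le> z ^ card Q / s ^ n \<and> (\<forall>\<omega>\<in>space ?M - B.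
        finite {y. (bond_adj S \<omega>)\<^sup>*\<^sup>* 0 y} \<and> card {y. (bond_adj S \<omega>)\<^sup>*\<^sup>* 0 y} \<le> 3 * n)"
      using B by blast
  next
    fix n :: nat assume n: "2 \<le> n"
    obtain w where w: "w 0 = 0" "inj_on w {..<n}"
      "\<And>i. Suc i < n \<Longrightarrow> cayley_adj S (w i) (w (Suc i))"
      by (rule geodesic[OF inf, of n]) blast
    have winj: "w i = w j \<longleftrightarrow> i = j" if "i < n" "j < n" for i j
      using w(2) that by (auto dest: inj_onD)
    \<comment> \<open>The n - 1 edges of the path. \<open>L\<close> holds all edges meeting the
      path, possible chords included, and those outside \<eta> are to be closed.\<close>
    define \<eta> where "\<eta> = (\<lambda>i. {w i, w (Suc i)}) ` {i. Suc i < n}"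
    define L where "L = (\<Union>i<n. (\<lambda>y. {w i, y}) ` {y. cayley_adj S (w i) y})"
    have Lf: "finite L" "L \<subseteq> ?I" using cayley_fin cayley_edgesI by (auto simp: L_def)
    have \<eta>L: "\<eta> \<subseteq> L"
    proof
      fix e assume "e \<in> \<eta>"
      then obtain i where "Suc i < n" "e = {w i, w (Suc i)}" by (auto simp: \<eta>_def)
      then show "e \<in> L" using w(3)[of i] unfolding L_def by (intro UN_I[of i]) auto
    qed
    define A where "A = {\<omega> \<in> space ?M. {v\<in>L. \<omega> v} = \<eta>}"
    have As: "A \<in> sets ?M" unfolding A_def by (rule bfield_cylinder_sets[OF Lf])
    have c1: "card \<eta> \<le> n"
    proof -
      have "{i. Suc i < n} \<subseteq> {..<n}" by auto
      then have "card {i. Suc i < n} \<le> n" "finite {i. Suc i < n}"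
        using card_mono[of "{..<n}"] by (auto intro: finite_subset)
      then show ?thesis
        unfolding \<eta>_def using card_image_le[of "{i. Suc i < n}" "\<lambda>i. {w i, w (Suc i)}"] by linarith
    qed
    have c2: "card (L - \<eta>) \<le> n * card S"
    proof -
      have "card (L - \<eta>) \<le> card L" by (rule card_mono[OF Lf(1) Diff_subset])
      then show ?thesis using card_path_nbhd[of "\<lambda>i y. {w i, y}" w n] unfolding L_def by linarith
    qed
    have Ap: "b ^ n \<le> prob A"
      unfolding A_def b_def by (rule cylinder_lower_bound[OF Lf \<eta>L p(1) p1 c1 c2])
    have "0 \<in> bond_verts S \<omega> \<and> (\<forall>i<n. {y. bond_adj S \<omega> (w i) y} = w ` {j. j < n \<and> (j = Suc i \<or> i = Suc j)})"
      if wA: "\<omega> \<in> A" for \<omega>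
    proof -
      have op: "\<omega> v \<longleftrightarrow> v \<in> \<eta>" if "v \<in> L" for v using wA that by (auto simp: A_def)
      have nxt: "bond_adj S \<omega> (w i) (w (Suc i))" if "Suc i < n" for i
      proof -
        have "{w i, w (Suc i)} \<in> \<eta>" using that by (auto simp: \<eta>_def)
        then show ?thesis using op \<eta>L w(3)[OF that] by (auto simp: bond_adj_def)
      qed
      have "{y. bond_adj S \<omega> (w i) y} = w ` {j. j < n \<and> (j = Suc i \<or> i = Suc j)}" if i: "i < n" for i
      proof (intro equalityI subsetI)
        fix y assume "y \<in> {y. bond_adj S \<omega> (w i) y}"
        then have y: "cayley_adj S (w i) y" "\<omega> {w i, y}" by (auto simp: bond_adj_def)
        then have "{w i, y} \<in> \<eta>" using op i by (auto simp: L_def)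
        then obtain j where j: "Suc j < n" "{w i, y} = {w j, w (Suc j)}" by (auto simp: \<eta>_def)
        then consider "w i = w j" "y = w (Suc j)" | "w i = w (Suc j)" "y = w j"
          by (auto simp: doubleton_eq_iff)
        then show "y \<in> w ` {j. j < n \<and> (j = Suc i \<or> i = Suc j)}"
          using j i winj[of i j] winj[of i "Suc j"] by cases auto
      next
        fix y assume "y \<in> w ` {j. j < n \<and> (j = Suc i \<or> i = Suc j)}"
        then obtain j where j: "y = w j" "j < n" "j = Suc i \<or> i = Suc j" by auto
        then show "y \<in> {y. bond_adj S \<omega> (w i) y}"
          using nxt[of i] bond_adj_sym[OF nxt[of j]] i by auto
      qed
      moreover have "0 \<in> bond_verts S \<omega>"
        using nxt[of 0] n w(1) by (auto simp: bond_verts_def)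
      ultimately show ?thesis by blast
    qed
    then show "\<exists>A\<in>sets ?M. \<exists>w. b ^ n \<le> prob A \<and> inj_on w {..<n} \<and> w 0 = 0 \<and>
        (\<forall>\<omega>\<in>A. 0 \<in> bond_verts S \<omega> \<and> (\<forall>i<n. {y. bond_adj S \<omega> (w i) y} = w ` {j. j < n \<and> (j = Suc i \<or> i = Suc j)}))"
      using As Ap w by blast
  qed
  then show ?thesis by (simp add: ids_bond_def[abs_def] bond_measure_def)
qed

end

theorem theorem2p10:
  fixes S :: "'g::group_add set" and p :: real
  assumes "finite_symm_gen_set S"
    and "amenable_group TYPE('g)"
    and "infinite (UNIV :: 'g set)"
    and "0 < p"
  shows "(p < pc_site S \<longrightarrow> lifshitz_tail (ids_site S p))
       \<and> (p < pc_bond S \<longrightarrow> lifshitz_tail (ids_bond S p))"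
  using lifshitz_site[OF assms(1,3,4)] lifshitz_bond[OF assms(1,3,4)] by blast

end
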